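(* Let $n\geq 2$ be an integer, let $0<p_1,\ldots,p_n<\infty$ satisfy $\frac12 \leq \frac{1}{p_1}+\cdots+\frac{1}{p_n} < 1$, and let $\frac{2}{n}\leq q<\infty$. Then $(\tau_{p_1,\ldots,p_n}, \|\cdot\|_{\tau_{p_1,\ldots,p_n}})$ is a Banach ideal of $n$-linear operators, and $(\mathcal{C}^n_q,\|\cdot\|_{\mathcal{C}^n_q})$ is a $q$-Banach ideal of $n$-linear operators if $q\leq 1$ and a Banach ideal of $n$-linear operators if $q>1$.
   Context: All Banach spaces are over $\mathbb{K}=\mathbb{R}$ or $\mathbb{C}$; $\mathcal{L}(E_1,\ldots,E_n;F)$ is the space of continuous $n$-linear operators from $E_1\times\cdots\times E_n$ to $F$. Let $(r_j)_{j=1}^\infty$ be the Rademacher functions on $[0,1]$. For a finite sequence $(x_j)_{j=1}^k$ in $E$ put $\|(x_j)_{j=1}^k\|_{\mathrm{Rad}(E)} = \left(\int_0^1 \| \sum_{j=1}^k r_j(t)x_j\|^2 dt\right)^{1/2}$ and $\|(x_j)_{j=1}^k\|_{p} = (\sum_{j=1}^k\|x_j\|^p)^{1/p}$. $T \in \mathcal{L}(E_1,\ldots,E_n;F)$ has type $(p_1,\ldots,p_n)$ if there is $C>0$ such that for all $k\in\mathbb{N}$ and $x_j^{(i)}\in E_i$ ($1\le i\le n$, $1\le j\le k$), $$\|(T(x_j^{(1)},\ldots,x_j^{(n)}))_{j=1}^k\|_{\mathrm{Rad}(F)} \leq C\prod_{i=1}^n \|(x_j^{(i)})_{j=1}^k\|_{p_i};$$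 the infimum of such $C$ is $\|T\|_{\tau_{p_1,\ldots,p_n}}$. $T$ has cotype $q$ if there is $M>0$ such that for all such vectors $$\|(T(x_j^{(1)},\ldots,x_j^{(n)}))_{j=1}^k\|_{q} \leq M\prod_{i=1}^n \|(x_j^{(i)})_{j=1}^k\|_{\mathrm{Rad}(E_i)};$$ the infimum of such $M$ is $\|T\|_{\mathcal{C}^n_q}$. $\tau_{p_1,\ldots,p_n}$ and $\mathcal{C}^n_q$ denote the classes of all $n$-linear operators of type $(p_1,\ldots,p_n)$ and of cotype $q$, respectively. For $0<s\leq 1$, an $s$-Banach ideal of $n$-linear operators is a pair $(\mathcal{M},\|\cdot\|_{\mathcal{M}})$, where $\mathcal{M}$ is a subclass of the class of continuous $n$-linear operators between Banach spaces and $\|\cdot\|_{\mathcal{M}}\colon\mathcal{M}\to\mathbb{R}$ is a function such that for all Banach spaces $E_1,\ldots,E_n,F$ the component $\mathcal{M}(E_1,\ldots,E_n;F)=\mathcal{L}(E_1,\ldots,E_n;F)\cap\mathcal{M}$ is a linear subspace of $\mathcal{L}(E_1,\ldots,E_n;F)$ on which $\|\cdot\|_{\mathcal{M}}$ is a complete $s$-norm (so $\|A+B\|_{\mathcal M}^s\leq\|A\|_{\mathcal M}^s+\|B\|_{\mathcal M}^s$), and: (i) $\mathcal{M}(E_1,\ldots,E_n;F)$ contains all $n$-linear operators of finite type (linear combinations of operators $(x_1,\ldots,x_n)\mapsto\varphi_1(x_1)\cdots\varphi_n(x_n)b$ with $\varphi_i\in E_i'$, $b\in F$), and the operator $I_n\colon\mathbb{K}^n\to\mathbb{K}$,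 $I_n(\lambda_1,\ldots,\lambda_n)=\lambda_1\cdots\lambda_n$, satisfies $\|I_n\|_{\mathcal{M}}=1$; (ii) if $A\in\mathcal{M}(E_1,\ldots,E_n;F)$, $u_m\in\mathcal{L}(G_m;E_m)$ for $m=1,\ldots,n$ and $t\in\mathcal{L}(F;H)$, then $t\circ A\circ(u_1,\ldots,u_n)\in\mathcal{M}(G_1,\ldots,G_n;H)$ and $\|t\circ A\circ(u_1,\ldots,u_n)\|_{\mathcal{M}}\leq\|t\|\,\|A\|_{\mathcal{M}}\,\|u_1\|\cdots\|u_n\|$. For $s=1$ it is called a Banach ideal of $n$-linear operators. *)

theory Defs
  imports "HOL-Analysis.Analysis" "HOL-Algebra.Algebraic_Closure_Type"
begin

(* The classes below range over n-tuples of different Banach spaces, so a space is a record with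
   an explicit carrier set inside an ambient type 'v. The module record is extended by a norm; its
   fields mult and one play no role. The scalars are the ring ring_of_type_algebra on the type 'k,
   to be used with 'k = real and 'k = complex. *)

record ('k, 'v) nspace = "('k, 'v) module" +
  vnorm :: "'v \<Rightarrow> real"

(* The metric nu (x - y) ^ s of an s-norm nu on a subspace H. It is set to 0 outside H because
   the locale Metric_space asks for a nonnegative symmetric function on the whole type. *)
definition snorm_dist ::
    "real \<Rightarrow> ('k, 'v, 'm) module_scheme \<Rightarrow> 'v set \<Rightarrow> ('v \<Rightarrow> real) \<Rightarrow> 'v \<Rightarrow> 'v \<Rightarrow> real" where
  "snorm_dist s V H \<nu> x y = (if x \<in> H \<and> y \<in> H then \<nu> (x \<ominus>\<^bsub>V\<^esub> y) powr s else 0)"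

definition complete_snorm ::
    "real \<Rightarrow> ('k::real_normed_field, 'v, 'm) module_scheme \<Rightarrow> 'v set \<Rightarrow> ('v \<Rightarrow> real) \<Rightarrow> bool" where
  "complete_snorm s V H \<nu> \<longleftrightarrow>
     (\<forall>x\<in>H. 0 \<le> \<nu> x) \<and>
     (\<forall>x\<in>H. \<nu> x = 0 \<longleftrightarrow> x = \<zero>\<^bsub>V\<^esub>) \<and>
     (\<forall>c. \<forall>x\<in>H. \<nu> (c \<odot>\<^bsub>V\<^esub> x) = norm c * \<nu> x) \<and>
     (\<forall>x\<in>H. \<forall>y\<in>H. \<nu> (x \<oplus>\<^bsub>V\<^esub> y) powr s \<le> \<nu> x powr s + \<nu> y powr s) \<and>
     Metric_space.mcomplete H (snorm_dist s V H \<nu>)"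

definition banach_space :: "('k::real_normed_field, 'v) nspace \<Rightarrow> bool" where
  "banach_space V \<longleftrightarrow>
     Module.module (ring_of_type_algebra :: 'k ring) V \<and>
     complete_snorm 1 V (carrier V) (vnorm V)"

definition norm_topology :: "('k, 'v) nspace \<Rightarrow> 'v topology" where
  "norm_topology V = Metric_space.mtopology (carrier V) (snorm_dist 1 V (carrier V) (vnorm V))"

(* The scalar field as a Banach space. The ambient type 'a + 'k contains it as the right summand;
   since 'a is arbitrary, any set of Banach spaces has a copy in some such ambient type. *)
definition scalar_space :: "('k::real_normed_field, 'a + 'k) nspace" where
  "scalar_space =
     \<lparr>carrier = range Inr, mult = undefined, one = undefined,
      zero = Inr 0, add = (\<lambda>x y. Inr (projr x + projr y)),
      smult = (\<lambda>c x. Inr (c * projr x)), vnorm = (\<lambda>x. norm (projr x))\<rparr>"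

definition linear_ops :: "('k, 'v) nspace \<Rightarrow> ('k, 'w) nspace \<Rightarrow> ('v \<Rightarrow> 'w) set" where
  "linear_ops G E =
     {u \<in> carrier G \<rightarrow> carrier E.
        (\<forall>x\<in>carrier G. \<forall>y\<in>carrier G. u (x \<oplus>\<^bsub>G\<^esub> y) = u x \<oplus>\<^bsub>E\<^esub> u y) \<and>
        (\<forall>c. \<forall>x\<in>carrier G. u (c \<odot>\<^bsub>G\<^esub> x) = c \<odot>\<^bsub>E\<^esub> u x) \<and>
        continuous_map (norm_topology G) (norm_topology E) u}"

definition op_norm :: "('k, 'v) nspace \<Rightarrow> ('k, 'w) nspace \<Rightarrow> ('v \<Rightarrow> 'w) \<Rightarrow> real" where
  "op_norm G E u = (SUP x\<in>{x \<in> carrier G. vnorm G x \<le> 1}. vnorm E (u x))"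

definition prod_carrier :: "nat \<Rightarrow> (nat \<Rightarrow> ('k, 'v) nspace) \<Rightarrow> (nat \<Rightarrow> 'v) set" where
  "prod_carrier n E = (\<Pi>\<^sub>E i\<in>{1..n}. carrier (E i))"

(* Operators are extensional functions, so that equal operators are equal functions. *)
definition multilinear_ops ::
    "nat \<Rightarrow> (nat \<Rightarrow> ('k, 'v) nspace) \<Rightarrow> ('k, 'v) nspace \<Rightarrow> ((nat \<Rightarrow> 'v) \<Rightarrow> 'v) set" where
  "multilinear_ops n E F =
     {T \<in> prod_carrier n E \<rightarrow>\<^sub>E carrier F.
        (\<forall>x\<in>prod_carrier n E. \<forall>i\<in>{1..n}. \<forall>a\<in>carrier (E i). \<forall>b\<in>carrier (E i).
           T (x(i := a \<oplus>\<^bsub>E i\<^esub> b)) = T (x(i := a)) \<oplus>\<^bsub>F\<^esub> T (x(i := b))) \<and>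
        (\<forall>x\<in>prod_carrier n E. \<forall>i\<in>{1..n}. \<forall>c. \<forall>a\<in>carrier (E i).
           T (x(i := c \<odot>\<^bsub>E i\<^esub> a)) = c \<odot>\<^bsub>F\<^esub> T (x(i := a))) \<and>
        continuous_map (product_topology (\<lambda>i. norm_topology (E i)) {1..n}) (norm_topology F) T}"

definition multilinear_space ::
    "nat \<Rightarrow> (nat \<Rightarrow> ('k, 'v) nspace) \<Rightarrow> ('k, 'v) nspace \<Rightarrow> ('k, (nat \<Rightarrow> 'v) \<Rightarrow> 'v) module" where
  "multilinear_space n E F =
     \<lparr>carrier = multilinear_ops n E F, mult = undefined, one = undefined,
      zero = (\<lambda>x\<in>prod_carrier n E. \<zero>\<^bsub>F\<^esub>),
      add = (\<lambda>S T. \<lambda>x\<in>prod_carrier n E. S x \<oplus>\<^bsub>F\<^esub> T x),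
      smult = (\<lambda>c T. \<lambda>x\<in>prod_carrier n E. c \<odot>\<^bsub>F\<^esub> T x)\<rparr>"

(* An operator together with its domain spaces and its codomain. *)
type_synonym ('k, 'v) mop =
  "(nat \<Rightarrow> ('k, 'v) nspace) \<times> ('k, 'v) nspace \<times> ((nat \<Rightarrow> 'v) \<Rightarrow> 'v)"

definition banach_family :: "nat \<Rightarrow> (nat \<Rightarrow> ('k::real_normed_field, 'v) nspace) set" where
  "banach_family n = {1..n} \<rightarrow>\<^sub>E Collect banach_space"

definition all_mops :: "nat \<Rightarrow> ('k::real_normed_field, 'v) mop set" where
  "all_mops n = {(E, F, T). E \<in> banach_family n \<and> banach_space F \<and> T \<in> multilinear_ops n E F}"

definition component ::
    "('k, 'v) mop set \<Rightarrow> (nat \<Rightarrow> ('k, 'v) nspace) \<Rightarrow> ('k, 'v) nspace \<Rightarrow> ((nat \<Rightarrow> 'v) \<Rightarrow> 'v) set" where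
  "component M E F = {T. (E, F, T) \<in> M}"

definition elementary_op ::
    "nat \<Rightarrow> (nat \<Rightarrow> ('k::real_normed_field, 'a + 'k) nspace) \<Rightarrow> ('k, 'a + 'k) nspace \<Rightarrow>
     (nat \<Rightarrow> 'a + 'k \<Rightarrow> 'a + 'k) \<Rightarrow> 'a + 'k \<Rightarrow> (nat \<Rightarrow> 'a + 'k) \<Rightarrow> 'a + 'k" where
  "elementary_op n E F \<phi> b = (\<lambda>x\<in>prod_carrier n E. (\<Prod>i=1..n. projr (\<phi> i (x i))) \<odot>\<^bsub>F\<^esub> b)"

definition finite_type_ops ::
    "nat \<Rightarrow> (nat \<Rightarrow> ('k::real_normed_field, 'a + 'k) nspace) \<Rightarrow> ('k, 'a + 'k) nspace \<Rightarrow>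
     ((nat \<Rightarrow> 'a + 'k) \<Rightarrow> 'a + 'k) set" where
  "finite_type_ops n E F =
     {finsum (multilinear_space n E F)
        (\<lambda>j. c j \<odot>\<^bsub>multilinear_space n E F\<^esub> elementary_op n E F (\<phi> j) (b j)) {1..m}
      | (m::nat) c \<phi> b.
        (\<forall>j\<in>{1..m}. (\<forall>i\<in>{1..n}. \<phi> j i \<in> linear_ops (E i) scalar_space) \<and> b j \<in> carrier F)}"

definition scalar_mult_op :: "nat \<Rightarrow> ('k::real_normed_field, 'a + 'k) mop" where
  "scalar_mult_op n =
     ((\<lambda>i\<in>{1..n}. scalar_space), scalar_space,
      (\<lambda>x\<in>prod_carrier n (\<lambda>i. scalar_space :: ('k, 'a + 'k) nspace).
         Inr (\<Prod>i=1..n. projr (x i))))"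

definition comp_op ::
    "nat \<Rightarrow> (nat \<Rightarrow> ('k, 'v) nspace) \<Rightarrow> ('v \<Rightarrow> 'v) \<Rightarrow> ((nat \<Rightarrow> 'v) \<Rightarrow> 'v) \<Rightarrow> (nat \<Rightarrow> 'v \<Rightarrow> 'v) \<Rightarrow>
     (nat \<Rightarrow> 'v) \<Rightarrow> 'v" where
  "comp_op n G t A u = (\<lambda>x\<in>prod_carrier n G. t (A (\<lambda>i\<in>{1..n}. u i (x i))))"

definition s_banach_ideal ::
    "nat \<Rightarrow> real \<Rightarrow> ('k::real_normed_field, 'a + 'k) mop set \<Rightarrow> (('k, 'a + 'k) mop \<Rightarrow> real) \<Rightarrow> bool" where
  "s_banach_ideal n s M \<nu> \<longleftrightarrow>
     0 < s \<and> s \<le> 1 \<and> M \<subseteq> all_mops n \<and>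
     (\<forall>E\<in>banach_family n. \<forall>F\<in>Collect banach_space.
        submodule (component M E F) (ring_of_type_algebra :: 'k ring) (multilinear_space n E F) \<and>
        complete_snorm s (multilinear_space n E F) (component M E F) (\<lambda>T. \<nu> (E, F, T)) \<and>
        finite_type_ops n E F \<subseteq> component M E F) \<and>
     \<nu> (scalar_mult_op n) = 1 \<and>
     (\<forall>E\<in>banach_family n. \<forall>G\<in>banach_family n.
        \<forall>F\<in>Collect banach_space. \<forall>H\<in>Collect banach_space. \<forall>A\<in>component M E F.
        \<forall>u t. (\<forall>m\<in>{1..n}. u m \<in> linear_ops (G m) (E m)) \<and> t \<in> linear_ops F H \<longrightarrow>
          comp_op n G t A u \<in> component M G H \<and>
          \<nu> (G, H, comp_op n G t A u)
            \<le> op_norm F H t * \<nu> (E, F, A) * (\<Prod>m=1..n. op_norm (G m) (E m) (u m)))"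

definition banach_ideal ::
    "nat \<Rightarrow> ('k::real_normed_field, 'a + 'k) mop set \<Rightarrow> (('k, 'a + 'k) mop \<Rightarrow> real) \<Rightarrow> bool" where
  "banach_ideal n M \<nu> \<longleftrightarrow> s_banach_ideal n 1 M \<nu>"

definition rademacher :: "nat \<Rightarrow> real \<Rightarrow> real" where
  "rademacher j t = sgn (sin (2 ^ j * pi * t))"

definition rad_norm :: "('k::real_normed_field, 'v) nspace \<Rightarrow> nat \<Rightarrow> (nat \<Rightarrow> 'v) \<Rightarrow> real" where
  "rad_norm V k x =
     sqrt (LINT t:{0..1}|lborel.
       (vnorm V (\<Oplus>\<^bsub>V\<^esub>j\<in>{1..k}. (of_real (rademacher j t) :: 'k) \<odot>\<^bsub>V\<^esub> x j))\<^sup>2)"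

definition lp_norm :: "('k, 'v) nspace \<Rightarrow> nat \<Rightarrow> real \<Rightarrow> (nat \<Rightarrow> 'v) \<Rightarrow> real" where
  "lp_norm V k p x = (\<Sum>j=1..k. vnorm V (x j) powr p) powr (1 / p)"

definition type_consts ::
    "nat \<Rightarrow> (nat \<Rightarrow> real) \<Rightarrow> ('k::real_normed_field, 'v) mop \<Rightarrow> real set" where
  "type_consts n p = (\<lambda>(E, F, T).
     {C. C > 0 \<and>
        (\<forall>k x. (\<forall>i\<in>{1..n}. \<forall>j\<in>{1..k}. x i j \<in> carrier (E i)) \<longrightarrow>
           rad_norm F k (\<lambda>j. T (\<lambda>i\<in>{1..n}. x i j)) \<le> C * (\<Prod>i=1..n. lp_norm (E i) k (p i) (x i)))})"

definition type_ops :: "nat \<Rightarrow> (nat \<Rightarrow> real) \<Rightarrow> ('k::real_normed_field, 'v) mop set" where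
  "type_ops n p = {A \<in> all_mops n. type_consts n p A \<noteq> {}}"

definition type_norm :: "nat \<Rightarrow> (nat \<Rightarrow> real) \<Rightarrow> ('k::real_normed_field, 'v) mop \<Rightarrow> real" where
  "type_norm n p A = Inf (type_consts n p A)"

definition cotype_consts :: "nat \<Rightarrow> real \<Rightarrow> ('k::real_normed_field, 'v) mop \<Rightarrow> real set" where
  "cotype_consts n q = (\<lambda>(E, F, T).
     {M. M > 0 \<and>
        (\<forall>k x. (\<forall>i\<in>{1..n}. \<forall>j\<in>{1..k}. x i j \<in> carrier (E i)) \<longrightarrow>
           lp_norm F k q (\<lambda>j. T (\<lambda>i\<in>{1..n}. x i j)) \<le> M * (\<Prod>i=1..n. rad_norm (E i) k (x i)))})"

definition cotype_ops :: "nat \<Rightarrow> real \<Rightarrow> ('k::real_normed_field, 'v) mop set" where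
  "cotype_ops n q = {A \<in> all_mops n. cotype_consts n q A \<noteq> {}}"

definition cotype_norm :: "nat \<Rightarrow> real \<Rightarrow> ('k::real_normed_field, 'v) mop \<Rightarrow> real" where
  "cotype_norm n q A = Inf (cotype_consts n q A)"

end

(* Both classes consist of the n-linear T with Phi (T x_1, ..., T x_k) <= C Psi_1(x^(1)) ... Psi_n(x^(n)),
   where Phi and the Psi_i are homogeneous functionals on finite sequences (a Rademacher average or an l_p
   norm). The best constant C dominates the sup norm (take k = 1), so a Cauchy sequence converges pointwise;
   since Phi^s is subadditive and dominated by the sum of the s-th powers of the norms, the inequality
   passes to the limit. This gives completeness, and the ideal property follows because Phi and Psi_i are
   compatible with bounded linear maps. Operators of finite type reduce to scalar sequences. There
   the Rademacher average is the l_2 norm by orthonormality, and what remains is Hoelder's inequality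
   |a_1 ... a_n|_r <= |a_1|_{p_1} ... |a_n|_{p_n} for 1/r <= 1/p_1 + ... + 1/p_n, used with r = 2 for type
   and with r = q, p_i = 2 for cotype. *)

theory Submission
  imports Defs
begin

section \<open>Inequalities for finite sums\<close>

text \<open>The numerical hypotheses are the Hoelder conditions for scalar sequences: 1/2 \<le>
  1/p_1 + ... + 1/p_n is the case r = 2, and 2/n \<le> q says 1/q \<le> n/2, the sum of n
  reciprocals of the exponent 2. The power s is 1 where Phi is a norm and q where Phi is the l_q
  quasi-norm with q \<le> 1; hence the uniform choice s = min 1 q for cotype. Continuity and the
  inequality are decoupled. A multilinear map satisfying the inequality is bounded by the case k =
  1, hence continuous, so for limits, compositions and elementary operators only the algebraic
  identities and the inequality have to be checked. The best constant is an infimum over positive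
  numbers, and for the zero operator it is 0, outside the set. For this reason the inequality is
  studied with arbitrary constants and positivity is imposed afterwards.\<close>

lemma weighted_arith_geom_mean:
  fixes a \<theta> :: "'i \<Rightarrow> real"
  assumes "finite I" "\<And>i. i \<in> I \<Longrightarrow> 0 \<le> \<theta> i" "sum \<theta> I = 1" "\<And>i. i \<in> I \<Longrightarrow> 0 \<le> a i"
  shows "(\<Prod>i\<in>I. a i powr \<theta> i) \<le> (\<Sum>i\<in>I. \<theta> i * a i)"
\<comment> \<open>A zero entry is split off because \<open>ln\<close> follows. As
  \<open>0 powr 0 = 0\<close>, the product then vanishes even if the weight of that entry is
  0.\<close>
proof (cases "\<exists>i\<in>I. a i = 0")
  case True
  then have "(\<Prod>i\<in>I. a i powr \<theta> i) = 0"
    using assms(1) by (auto intro!: prod_zero)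
  then show ?thesis
    using assms(2,4) by (auto intro!: sum_nonneg mult_nonneg_nonneg)
next
  case False
  then have pos: "0 < a i" if "i \<in> I" for i
    using assms(4) that by (metis less_eq_real_def)
  have "I \<noteq> {}"
    using assms(3) by auto
  \<comment> \<open>In logarithmic form the claim is Jensen's inequality for the convex function
    \<open>exp\<close>.\<close>
  have "(\<Prod>i\<in>I. a i powr \<theta> i) = exp (\<Sum>i\<in>I. \<theta> i * ln (a i))"
    unfolding exp_sum[OF assms(1)]
  proof (intro prod.cong refl)
    fix i assume "i \<in> I"
    then show "a i powr \<theta> i = exp (\<theta> i * ln (a i))"
      using pos[of i] by (simp add: powr_def)
  qed
  also have "\<dots> \<le> (\<Sum>i\<in>I. \<theta> i * exp (ln (a i)))"
    using convex_on_sum[OF assms(1) \<open>I \<noteq> {}\<close> exp_convex assms(3), of "\<lambda>i. ln (a i)"] assms(2)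
    by simp
  also have "\<dots> = (\<Sum>i\<in>I. \<theta> i * a i)"
    using pos by (intro sum.cong) auto
  finally show ?thesis .
qed

text \<open>After each row \<open>b i\<close> is divided by its sum, weighted AM-GM bounds the j-th
  product by a convex combination of the j-th entries, and these combinations add up over j to
  \<open>sum \<theta> I = 1\<close>. A row with sum 0 cannot be normalised and is treated
  apart.\<close>

lemma Holder_inequality_sum_prod:
  fixes b :: "'i \<Rightarrow> 'j \<Rightarrow> real"
  assumes "finite I" "finite J" "\<And>i. i \<in> I \<Longrightarrow> 0 \<le> \<theta> i" "sum \<theta> I = 1"
    and b: "\<And>i j. i \<in> I \<Longrightarrow> j \<in> J \<Longrightarrow> 0 \<le> b i j"
  shows "(\<Sum>j\<in>J. \<Prod>i\<in>I. b i j powr \<theta> i) \<le> (\<Prod>i\<in>I. (\<Sum>j\<in>J. b i j) powr \<theta> i)"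
proof (cases "\<exists>i\<in>I. (\<Sum>j\<in>J. b i j) = 0")
  case True
  then obtain i where i: "i \<in> I" "(\<Sum>j\<in>J. b i j) = 0" by auto
  then have "b i j = 0" if "j \<in> J" for j
    using sum_nonneg_eq_0_iff[of J "b i"] b that assms(2) by auto
  then have "(\<Prod>i\<in>I. b i j powr \<theta> i) = 0" if "j \<in> J" for j
    using i assms(1) that by (auto intro!: prod_zero)
  then show ?thesis
    by (simp add: prod_nonneg)
next
  case False
  define B where "B i = (\<Sum>j\<in>J. b i j)" for i
  have B: "0 < B i" if "i \<in> I" for i
    using False b that unfolding B_def by (metis less_eq_real_def sum_nonneg)
  have "(\<Prod>i\<in>I. b i j powr \<theta> i) \<le> (\<Prod>i\<in>I. B i powr \<theta> i) * (\<Sum>i\<in>I. \<theta> i * (b i j / B i))"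
    if "j \<in> J" for j
  proof -
    have "(\<Prod>i\<in>I. b i j powr \<theta> i) = (\<Prod>i\<in>I. B i powr \<theta> i * (b i j / B i) powr \<theta> i)"
    proof (intro prod.cong refl)
      fix i assume "i \<in> I"
      then show "b i j powr \<theta> i = B i powr \<theta> i * (b i j / B i) powr \<theta> i"
        using B[of i] b[of i j] that by (simp add: powr_divide)
    qed
    also have "\<dots> = (\<Prod>i\<in>I. B i powr \<theta> i) * (\<Prod>i\<in>I. (b i j / B i) powr \<theta> i)"
      by (rule prod.distrib)
    also have "\<dots> \<le> (\<Prod>i\<in>I. B i powr \<theta> i) * (\<Sum>i\<in>I. \<theta> i * (b i j / B i))"
      using B b that assms
      by (intro mult_left_mono weighted_arith_geom_mean) (auto simp: prod_nonneg less_imp_le)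
    finally show ?thesis .
  qed
  then have "(\<Sum>j\<in>J. \<Prod>i\<in>I. b i j powr \<theta> i) \<le>
      (\<Sum>j\<in>J. (\<Prod>i\<in>I. B i powr \<theta> i) * (\<Sum>i\<in>I. \<theta> i * (b i j / B i)))"
    by (rule sum_mono)
  also have "\<dots> = (\<Prod>i\<in>I. B i powr \<theta> i) * (\<Sum>i\<in>I. \<theta> i * ((\<Sum>j\<in>J. b i j) / B i))"
    unfolding sum_distrib_left[symmetric]
    by (subst sum.swap) (simp add: sum_distrib_left sum_divide_distrib)
  also have "(\<Sum>i\<in>I. \<theta> i * ((\<Sum>j\<in>J. b i j) / B i)) = sum \<theta> I"
    using B by (intro sum.cong) (auto simp: B_def[symmetric] less_imp_neq[THEN not_sym])
  finally show ?thesis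
    by (simp add: assms(4) B_def)
qed

text \<open>With S the total, each term d^e = d * d^(e-1) is at most d * S^(e-1), and the d add up
  to S. This is the monotonicity of l_p norms in p.\<close>

lemma sum_powr_le_powr_sum:
  fixes d :: "'j \<Rightarrow> real"
  assumes "finite J" "1 \<le> e" "\<And>j. j \<in> J \<Longrightarrow> 0 \<le> d j"
  shows "(\<Sum>j\<in>J. d j powr e) \<le> (\<Sum>j\<in>J. d j) powr e"
proof -
  define S where "S = (\<Sum>j\<in>J. d j)"
  have split: "u powr e = u * u powr (e - 1)" if "0 \<le> u" for u :: real
    using that by (cases "u = 0") (auto simp: powr_diff)
  have "d j powr e \<le> d j * S powr (e - 1)" if "j \<in> J" for j
    unfolding split[OF assms(3)[OF that]] S_def using assms that
    by (intro mult_left_mono powr_mono2 member_le_sum) auto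
  then have "(\<Sum>j\<in>J. d j powr e) \<le> (\<Sum>j\<in>J. d j * S powr (e - 1))"
    by (rule sum_mono)
  also have "\<dots> = S powr e"
    using split[of S] assms by (simp add: S_def sum_nonneg sum_distrib_right)
  finally show ?thesis
    by (simp add: S_def)
qed

text \<open>The previous lemma with exponent 1 / e, applied to the two numbers a^e and b^e.\<close>

lemma powr_add_le:
  fixes a b :: real
  assumes "0 \<le> a" "0 \<le> b" "0 < e" "e \<le> 1"
  shows "(a + b) powr e \<le> a powr e + b powr e"
proof -
  have "(\<Sum>j\<in>{0, 1::nat}. ((if j = 0 then a else b) powr e) powr (1 / e)) \<le>
      (\<Sum>j\<in>{0, 1::nat}. (if j = 0 then a else b) powr e) powr (1 / e)"
    using assms by (intro sum_powr_le_powr_sum) auto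
  then have "a + b \<le> (a powr e + b powr e) powr (1 / e)"
    using assms by (simp add: powr_powr)
  then have "(a + b) powr e \<le> ((a powr e + b powr e) powr (1 / e)) powr e"
    using assms by (intro powr_mono2) auto
  then show ?thesis
    using assms by (simp add: powr_powr)
qed

lemma lp_Holder:
  fixes a :: "'i \<Rightarrow> 'j \<Rightarrow> real"
  assumes "finite I" "finite J" "\<And>i. i \<in> I \<Longrightarrow> 0 < p i" "0 < r" "1 / r \<le> (\<Sum>i\<in>I. 1 / p i)"
    and a: "\<And>i j. i \<in> I \<Longrightarrow> j \<in> J \<Longrightarrow> 0 \<le> a i j"
  shows "(\<Sum>j\<in>J. (\<Prod>i\<in>I. a i j) powr r) powr (1 / r) \<le>
    (\<Prod>i\<in>I. (\<Sum>j\<in>J. a i j powr p i) powr (1 / p i))"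
proof -
  \<comment> \<open>Hoelder with the exponents normalised to sum 1 bounds the $\ell_{1/\sigma}$ norm, which dominates
    the $\ell_r$ norm because $1/\sigma \le r$.\<close>
  define \<sigma> where "\<sigma> = (\<Sum>i\<in>I. 1 / p i)"
  define \<theta> where "\<theta> i = 1 / (p i * \<sigma>)" for i
  define B where "B i = (\<Sum>j\<in>J. a i j powr p i)" for i
  have "0 < 1 / r"
    using assms(4) by simp
  then have \<sigma>: "0 < \<sigma>" "1 \<le> r * \<sigma>"
    using assms(4,5) unfolding \<sigma>_def by (linarith, simp add: field_simps)
  have \<theta>: "sum \<theta> I = 1"
  proof -
    have "sum \<theta> I = (\<Sum>i\<in>I. 1 / p i) / \<sigma>"
      unfolding sum_divide_distrib \<theta>_def by (intro sum.cong) auto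
    then show ?thesis
      using \<sigma> by (simp add: \<sigma>_def)
  qed
  \<comment> \<open>Since \<open>p i * \<theta> i = 1 / \<sigma>\<close> for every i, all factors
    end up with one common exponent.\<close>
  have c: "(\<Prod>i\<in>I. a i j) powr (1 / \<sigma>) = (\<Prod>i\<in>I. (a i j powr p i) powr \<theta> i)" if "j \<in> J" for j
    unfolding \<theta>_def using assms(3) a that
    by (subst prod_powr_distrib) (auto simp: powr_powr intro!: prod.cong,
        metis less_irrefl nonzero_divide_mult_cancel_left mult.right_neutral times_divide_eq_right)
  have "(\<Sum>j\<in>J. (\<Prod>i\<in>I. a i j) powr r) = (\<Sum>j\<in>J. ((\<Prod>i\<in>I. a i j) powr (1 / \<sigma>)) powr (r * \<sigma>))"
    using \<sigma> by (simp add: powr_powr)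
  also have "\<dots> \<le> (\<Sum>j\<in>J. (\<Prod>i\<in>I. a i j) powr (1 / \<sigma>)) powr (r * \<sigma>)"
    using assms(2) \<sigma> by (intro sum_powr_le_powr_sum) auto
  also have "\<dots> \<le> (\<Prod>i\<in>I. B i powr \<theta> i) powr (r * \<sigma>)"
  proof (intro powr_mono2)
    show "(\<Sum>j\<in>J. (\<Prod>i\<in>I. a i j) powr (1 / \<sigma>)) \<le> (\<Prod>i\<in>I. B i powr \<theta> i)"
      using Holder_inequality_sum_prod[OF assms(1,2) _ \<theta>, of "\<lambda>i j. a i j powr p i"] assms(3) \<sigma>
      by (simp add: c B_def \<theta>_def less_imp_le)
  qed (use \<sigma> in \<open>auto intro: sum_nonneg\<close>)
  finally have "(\<Sum>j\<in>J. (\<Prod>i\<in>I. a i j) powr r) powr (1 / r) \<le>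
      ((\<Prod>i\<in>I. B i powr \<theta> i) powr (r * \<sigma>)) powr (1 / r)"
    using assms(4) by (intro powr_mono2) (auto intro: sum_nonneg)
  also have "\<dots> = (\<Prod>i\<in>I. B i powr \<theta> i) powr \<sigma>"
    using assms(4) by (simp add: powr_powr)
  also have "\<dots> = (\<Prod>i\<in>I. B i powr (1 / p i))"
    using \<sigma> by (subst prod_powr_distrib) (auto simp: powr_powr \<theta>_def intro!: prod.cong)
  finally show ?thesis
    by (simp add: B_def)
qed

text \<open>With S = \<alpha> + \<beta>, the number (a j + b j) / S is the convex combination of a j
  / \<alpha> and b j / \<beta> with weights \<alpha> / S and \<beta> / S. Convexity of the q-th
  power and summation over j give the bound 1 for the normalised sum.\<close>

lemma lp_Minkowski:
  fixes a b :: "'j \<Rightarrow> real"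
  assumes "finite J" "1 \<le> q" "\<And>j. j \<in> J \<Longrightarrow> 0 \<le> a j" "\<And>j. j \<in> J \<Longrightarrow> 0 \<le> b j"
  shows "(\<Sum>j\<in>J. (a j + b j) powr q) powr (1 / q) \<le>
    (\<Sum>j\<in>J. a j powr q) powr (1 / q) + (\<Sum>j\<in>J. b j powr q) powr (1 / q)"
proof -
  define \<alpha> where "\<alpha> = (\<Sum>j\<in>J. a j powr q) powr (1 / q)"
  define \<beta> where "\<beta> = (\<Sum>j\<in>J. b j powr q) powr (1 / q)"
  have q: "q > 0" using assms(2) by simp
  have \<alpha>q: "\<alpha> powr q = (\<Sum>j\<in>J. a j powr q)" and \<beta>q: "\<beta> powr q = (\<Sum>j\<in>J. b j powr q)"
    using q by (auto simp: \<alpha>_def \<beta>_def powr_powr sum_nonneg)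
  have "0 \<le> \<alpha>" "0 \<le> \<beta>"
    by (auto simp: \<alpha>_def \<beta>_def)
  have zero: "\<forall>j\<in>J. u j = 0" if "(\<Sum>j\<in>J. u j powr q) = 0" for u
    using that assms(1) by (subst (asm) sum_nonneg_eq_0_iff) auto
  consider "\<alpha> = 0" | "\<beta> = 0" | "0 < \<alpha>" "0 < \<beta>"
    using \<open>0 \<le> \<alpha>\<close> \<open>0 \<le> \<beta>\<close> by linarith
  then show ?thesis
  proof cases
    case 1
    then have "\<forall>j\<in>J. a j = 0"
      using \<alpha>q zero by simp
    then show ?thesis by simp
  next
    case 2
    then have "\<forall>j\<in>J. b j = 0"
      using \<beta>q zero by simp
    then show ?thesis by simp
  next
    case 3
    define S where "S = \<alpha> + \<beta>"
    have S: "0 < S" using 3 by (simp add: S_def)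
    have conv: "(\<alpha> / S * u + \<beta> / S * v) powr q \<le> \<alpha> / S * u powr q + \<beta> / S * v powr q"
      if "0 \<le> u" "0 \<le> v" for u v :: real
    \<comment> \<open>\<open>powr_convex\<close> speaks of the open half-line, so arguments equal to
      0 are handled by c^q \<le> c for 0 \<le> c \<le> 1 and q \<ge> 1.\<close>
    proof (cases "u = 0 \<or> v = 0")
      case False
      then have uv: "u \<in> {0<..}" "v \<in> {0<..}" using that by auto
      have 1: "1 - \<beta> / S = \<alpha> / S"
        using S by (simp add: S_def field_simps)
      show ?thesis
        using convex_onD[OF powr_convex[OF assms(2)], of "\<beta> / S" u v] uv 3 S
        unfolding 1 by (simp add: S_def)
    next
      case True
      have le: "(c * w) powr q \<le> c * w powr q" if "0 \<le> c" "c \<le> 1" "0 \<le> w" for c w :: real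
      proof -
        have "c powr q \<le> c"
          using that assms(2) powr_mono'[of 1 q c] by simp
        then show ?thesis
          using that by (simp add: powr_mult mult_right_mono)
      qed
      show ?thesis
        using True le[of "\<alpha> / S" u] le[of "\<beta> / S" v] that 3 S by (auto simp: S_def)
    qed
    have "(a j + b j) powr q \<le> S powr q * (\<alpha> / S * (a j / \<alpha>) powr q + \<beta> / S * (b j / \<beta>) powr q)"
      if "j \<in> J" for j
    proof -
      have "(a j + b j) powr q = S powr q * (\<alpha> / S * (a j / \<alpha>) + \<beta> / S * (b j / \<beta>)) powr q"
        using 3 S assms(3,4)[OF that]
        by (subst powr_mult[symmetric]) (auto simp: field_simps)
      also have "\<dots> \<le> S powr q * (\<alpha> / S * (a j / \<alpha>) powr q + \<beta> / S * (b j / \<beta>) powr q)"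
        using 3 assms(3,4)[OF that] by (intro mult_left_mono conv) auto
      finally show ?thesis .
    qed
    then have "(\<Sum>j\<in>J. (a j + b j) powr q) \<le>
        (\<Sum>j\<in>J. S powr q * (\<alpha> / S * (a j / \<alpha>) powr q + \<beta> / S * (b j / \<beta>) powr q))"
      by (rule sum_mono)
    also have "\<dots> = S powr q * (\<alpha> / S * ((\<Sum>j\<in>J. a j powr q) / \<alpha> powr q)
        + \<beta> / S * ((\<Sum>j\<in>J. b j powr q) / \<beta> powr q))"
      unfolding sum_distrib_left[symmetric] sum.distrib sum_divide_distrib
      using 3 assms(3,4) by (simp add: powr_divide)
    also have "\<dots> = S powr q"
      using 3 S by (simp add: \<alpha>q[symmetric] \<beta>q[symmetric] S_def flip: add_divide_distrib)
    finally have "(\<Sum>j\<in>J. (a j + b j) powr q) powr (1 / q) \<le> (S powr q) powr (1 / q)"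
      using q by (intro powr_mono2) (auto intro: sum_nonneg)
    then show ?thesis
      using q S by (simp add: powr_powr S_def \<alpha>_def \<beta>_def)
  qed
qed

section \<open>Normed spaces on an explicit carrier\<close>

lemma ring_of_type_algebra_simps [simp]:
  "carrier (ring_of_type_algebra :: 'k::ring_1 ring) = UNIV"
  "\<one>\<^bsub>ring_of_type_algebra :: 'k ring\<^esub> = 1"
  "\<zero>\<^bsub>ring_of_type_algebra :: 'k ring\<^esub> = 0"
  "x \<oplus>\<^bsub>ring_of_type_algebra :: 'k ring\<^esub> y = x + y"
  "x \<otimes>\<^bsub>ring_of_type_algebra :: 'k ring\<^esub> y = x * y"
  by (simp_all add: ring_of_type_algebra_def)

section \<open>Vector space arithmetic with scalars from a type\<close>

locale scalar_module = Module.module "ring_of_type_algebra :: 'k ring" V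
  for V :: "('k::real_normed_field, 'v, 'm) module_scheme" (structure)
begin

lemma scale_closed [simp, intro]: "x \<in> carrier V \<Longrightarrow> c \<odot> x \<in> carrier V"
  by (rule smult_closed) simp_all

lemma scale_l_distr: "x \<in> carrier V \<Longrightarrow> (a + b) \<odot> x = a \<odot> x \<oplus> b \<odot> x"
  using smult_l_distr[of a b x] by simp

lemma scale_r_distr: "x \<in> carrier V \<Longrightarrow> y \<in> carrier V \<Longrightarrow> a \<odot> (x \<oplus> y) = a \<odot> x \<oplus> a \<odot> y"
  by (rule smult_r_distr) simp_all

lemma scale_scale: "x \<in> carrier V \<Longrightarrow> a \<odot> (b \<odot> x) = (a * b) \<odot> x"
  using smult_assoc1[of a b x] by simp

lemma scale_one [simp]: "x \<in> carrier V \<Longrightarrow> 1 \<odot> x = x"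
  using smult_one[of x] by simp

lemma scale_zero_left [simp]: "x \<in> carrier V \<Longrightarrow> 0 \<odot> x = \<zero>"
  using smult_l_null[of x] by simp

lemma scale_minus_one: "x \<in> carrier V \<Longrightarrow> (- 1) \<odot> x = \<ominus> x"
proof -
  assume x: "x \<in> carrier V"
  have "(- 1) \<odot> x \<oplus> x = (- 1 + 1) \<odot> x"
    using scale_l_distr[OF x, of "- 1" 1] x by simp
  then have "(- 1) \<odot> x \<oplus> x = \<zero>"
    using x by simp
  then show ?thesis
    using x by (intro M.minus_equality[symmetric]) auto
qed

lemma submodule_carrier: "submodule (carrier V) ring_of_type_algebra V"
  by (rule submoduleI) auto

lemma diff_add_diff:
  "x \<in> carrier V \<Longrightarrow> y \<in> carrier V \<Longrightarrow> z \<in> carrier V \<Longrightarrow> (x \<ominus> y) \<oplus> (y \<ominus> z) = x \<ominus> z"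
  by (simp add: a_minus_def M.a_assoc M.r_neg1)

lemma minus_diff: "x \<in> carrier V \<Longrightarrow> y \<in> carrier V \<Longrightarrow> \<ominus> (x \<ominus> y) = y \<ominus> x"
  by (simp add: a_minus_def M.minus_add M.a_comm)

lemma diff_eq_zero: "x \<in> carrier V \<Longrightarrow> y \<in> carrier V \<Longrightarrow> x \<ominus> y = \<zero> \<longleftrightarrow> x = y"
  by (metis M.minus_equality M.minus_minus M.r_neg M.a_inv_closed a_minus_def)

lemma add_diff_cancel_right: "x \<in> carrier V \<Longrightarrow> y \<in> carrier V \<Longrightarrow> (x \<oplus> y) \<ominus> x = y"
  by (metis M.a_comm M.a_assoc M.r_neg M.r_zero M.a_inv_closed a_minus_def)

lemma diff_zero [simp]: "x \<in> carrier V \<Longrightarrow> x \<ominus> \<zero> = x"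
  using add_diff_cancel_right[of \<zero> x] by simp

lemma diff_add_cancel: "x \<in> carrier V \<Longrightarrow> y \<in> carrier V \<Longrightarrow> x \<oplus> (y \<ominus> x) = y"
  by (metis M.a_lcomm M.r_neg M.r_zero M.a_inv_closed a_minus_def)

lemma add_diff_add:
  "a \<in> carrier V \<Longrightarrow> b \<in> carrier V \<Longrightarrow> c \<in> carrier V \<Longrightarrow> d \<in> carrier V \<Longrightarrow>
    (a \<oplus> b) \<ominus> (c \<oplus> d) = (a \<ominus> c) \<oplus> (b \<ominus> d)"
  by (simp add: a_minus_def M.minus_add M.a_ac)

lemma scale_diff:
  "x \<in> carrier V \<Longrightarrow> y \<in> carrier V \<Longrightarrow> c \<odot> (x \<ominus> y) = c \<odot> x \<ominus> c \<odot> y"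
  by (simp add: a_minus_def scale_r_distr scale_scale flip: scale_minus_one)

end

text \<open>The locale is used twice: with \<open>H\<close> the whole carrier and s = 1 for the
  spaces themselves, and with \<open>H\<close> a class of operators inside
  \<open>multilinear_space\<close> for the ideal norm. Facts on the metric, Cauchy sequences and
  completeness thus serve both.\<close>

locale snormed_module = scalar_module V
  for V :: "('k::real_normed_field, 'v, 'm) module_scheme" (structure) +
  fixes H :: "'v set" and \<nu> :: "'v \<Rightarrow> real" and s :: real
  assumes s_pos: "0 < s"
    and sub: "submodule H (ring_of_type_algebra :: 'k ring) V"
    and snorm_nonneg [simp]: "x \<in> H \<Longrightarrow> 0 \<le> \<nu> x"
    and snorm_eq_0: "x \<in> H \<Longrightarrow> \<nu> x = 0 \<longleftrightarrow> x = \<zero>"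
    and snorm_scale: "x \<in> H \<Longrightarrow> \<nu> (c \<odot> x) = norm c * \<nu> x"
    and snorm_add: "x \<in> H \<Longrightarrow> y \<in> H \<Longrightarrow> \<nu> (x \<oplus> y) powr s \<le> \<nu> x powr s + \<nu> y powr s"
begin

lemma sub_carrier: "x \<in> H \<Longrightarrow> x \<in> carrier V"
  using submoduleE(1)[OF sub] by auto

lemma sub_diff: "x \<in> H \<Longrightarrow> y \<in> H \<Longrightarrow> x \<ominus> y \<in> H"
  unfolding a_minus_def by (intro submoduleE(5)[OF sub] submoduleE(3)[OF sub])

lemma snorm_minus: "x \<in> H \<Longrightarrow> \<nu> (\<ominus> x) = \<nu> x"
  using snorm_scale[of x "- 1"] scale_minus_one[OF sub_carrier] by simp

lemma snorm_diff_commute: "x \<in> H \<Longrightarrow> y \<in> H \<Longrightarrow> \<nu> (x \<ominus> y) = \<nu> (y \<ominus> x)"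
  using snorm_minus[OF sub_diff, of x y] by (simp add: minus_diff sub_carrier)

lemma snorm_diff_triangle:
  "x \<in> H \<Longrightarrow> y \<in> H \<Longrightarrow> z \<in> H \<Longrightarrow> \<nu> (x \<ominus> z) powr s \<le> \<nu> (x \<ominus> y) powr s + \<nu> (y \<ominus> z) powr s"
  using snorm_add[OF sub_diff sub_diff, of x y y z] by (simp add: diff_add_diff sub_carrier)

sublocale Metric_space H "snorm_dist s V H \<nu>"
proof
  fix x y z
  show "0 \<le> snorm_dist s V H \<nu> x y"
    by (simp add: snorm_dist_def)
  show "snorm_dist s V H \<nu> x y = snorm_dist s V H \<nu> y x"
    by (simp add: snorm_dist_def snorm_diff_commute)
  show "snorm_dist s V H \<nu> x y = 0 \<longleftrightarrow> x = y" if "x \<in> H" "y \<in> H"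
    using that by (simp add: snorm_dist_def snorm_eq_0 sub_diff diff_eq_zero sub_carrier)
  show "snorm_dist s V H \<nu> x z \<le> snorm_dist s V H \<nu> x y + snorm_dist s V H \<nu> y z"
    if "x \<in> H" "y \<in> H" "z \<in> H"
    using that by (simp add: snorm_dist_def snorm_diff_triangle)
qed

lemma dist_less_iff:
  assumes "x \<in> H" "y \<in> H" "0 < e"
  shows "snorm_dist s V H \<nu> x y < e powr s \<longleftrightarrow> \<nu> (x \<ominus> y) < e"
  using assms s_pos sub_diff[of x y] powr_less_mono2[of s "\<nu> (x \<ominus> y)" e]
    powr_mono2[of s e "\<nu> (x \<ominus> y)"]
  by (force simp: snorm_dist_def not_less)

text \<open>The map e \<mapsto> e powr s permutes the positive reals. Hence Cauchy sequences, limits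
  and completeness for the metric \<nu> powr s can be expressed with \<nu> itself.\<close>

lemma all_powr: "(\<forall>e>0. P (e powr s)) \<longleftrightarrow> (\<forall>e>0. P (e::real))"
proof safe
  fix e :: real assume "\<forall>e>0. P (e powr s)" "e > 0"
  then have "P ((e powr (1 / s)) powr s)" by simp
  then show "P e" using \<open>e > 0\<close> s_pos by (simp add: powr_powr)
qed simp

lemma MCauchy_snorm:
  "MCauchy u \<longleftrightarrow> range u \<subseteq> H \<and> (\<forall>e>0. \<exists>N. \<forall>m\<ge>N. \<forall>n\<ge>N. \<nu> (u m \<ominus> u n) < e)"
proof (cases "range u \<subseteq> H")
  case True
  then have u: "u n \<in> H" for n by auto
  have "(\<forall>e>0. \<exists>N. \<forall>m n. N \<le> m \<longrightarrow> N \<le> n \<longrightarrow> snorm_dist s V H \<nu> (u m) (u n) < e) \<longleftrightarrow>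
      (\<forall>e>0. \<exists>N. \<forall>m n. N \<le> m \<longrightarrow> N \<le> n \<longrightarrow> snorm_dist s V H \<nu> (u m) (u n) < e powr s)"
    by (rule all_powr[symmetric])
  also have "\<dots> \<longleftrightarrow> (\<forall>e>0. \<exists>N. \<forall>m\<ge>N. \<forall>n\<ge>N. \<nu> (u m \<ominus> u n) < e)"
    by (simp add: dist_less_iff u)
  finally show ?thesis
    by (simp add: MCauchy_def True)
qed (simp add: MCauchy_def)

lemma limitin_snorm:
  assumes "range u \<subseteq> H"
  shows "limitin mtopology u l sequentially \<longleftrightarrow>
    l \<in> H \<and> (\<forall>e>0. \<exists>N. \<forall>n\<ge>N. \<nu> (u n \<ominus> l) < e)"
proof (cases "l \<in> H")
  case True
  have u: "u n \<in> H" for n using assms by auto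
  have "(\<forall>e>0. \<exists>N. \<forall>n\<ge>N. snorm_dist s V H \<nu> (u n) l < e) \<longleftrightarrow>
      (\<forall>e>0. \<exists>N. \<forall>n\<ge>N. snorm_dist s V H \<nu> (u n) l < e powr s)"
    by (rule all_powr[symmetric])
  also have "\<dots> \<longleftrightarrow> (\<forall>e>0. \<exists>N. \<forall>n\<ge>N. \<nu> (u n \<ominus> l) < e)"
    by (simp add: dist_less_iff u True)
  finally show ?thesis
    by (simp add: limit_metric_sequentially True u)
qed (simp add: limit_metric_sequentially)

lemma mcomplete_snorm:
  "mcomplete \<longleftrightarrow>
    (\<forall>u :: nat \<Rightarrow> 'v. range u \<subseteq> H \<and> (\<forall>e>0. \<exists>N. \<forall>m\<ge>N. \<forall>n\<ge>N. \<nu> (u m \<ominus> u n) < e) \<longrightarrow>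
      (\<exists>l\<in>H. \<forall>e>0. \<exists>N. \<forall>n\<ge>N. \<nu> (u n \<ominus> l) < e))"
  by (simp add: mcomplete_def MCauchy_snorm limitin_snorm Bex_def cong: imp_cong conj_cong)

end

section \<open>Normed spaces, their topology and completeness\<close>

locale normed_nspace = snormed_module V "carrier V" "vnorm V" 1
  for V :: "('k::real_normed_field, 'v) nspace" (structure)
begin

lemma norm_triangle: "x \<in> carrier V \<Longrightarrow> y \<in> carrier V \<Longrightarrow> vnorm V (x \<oplus> y) \<le> vnorm V x + vnorm V y"
  using snorm_add[of x y] by simp

lemma norm_zero [simp]: "vnorm V \<zero> = 0"
  using snorm_eq_0[of \<zero>] by simp

lemma norm_finsum:
  "finite J \<Longrightarrow> x \<in> J \<rightarrow> carrier V \<Longrightarrow> vnorm V (finsum V x J) \<le> (\<Sum>j\<in>J. vnorm V (x j))"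
proof (induction J rule: finite_induct)
  case (insert j J)
  then have "vnorm V (finsum V x (insert j J)) = vnorm V (x j \<oplus> finsum V x J)"
    by (subst M.finsum_insert) auto
  also have "\<dots> \<le> vnorm V (x j) + vnorm V (finsum V x J)"
    using insert by (intro norm_triangle) auto
  finally show ?case
    using insert by auto
qed simp

lemma topspace_norm_topology [simp]: "topspace (norm_topology V) = carrier V"
  by (simp add: norm_topology_def)

lemma norm_ball_open:
  assumes "x \<in> carrier V"
  shows "openin (norm_topology V) {y \<in> carrier V. vnorm V (y \<ominus> x) < e}"
proof (cases "0 < e")
  case True
  have "{y \<in> carrier V. vnorm V (y \<ominus> x) < e} = mball x e"
    using assms dist_less_iff[OF assms _ True] True by (auto simp: snorm_diff_commute)
  then show ?thesis
    by (simp add: norm_topology_def)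
next
  case False
  then have "{y \<in> carrier V. vnorm V (y \<ominus> x) < e} = {}"
    using assms snorm_nonneg[OF sub_diff] by fastforce
  then show ?thesis by (simp only: openin_empty)
qed

text \<open>The domain is an arbitrary topological space because the criterion is applied both to a
  normed space, for linear maps, and to a product of normed spaces, for multilinear ones.\<close>

lemma continuous_map_into_norm_topology:
  "continuous_map W (norm_topology V) f \<longleftrightarrow> f \<in> topspace W \<rightarrow> carrier V \<and>
    (\<forall>x\<in>topspace W. \<forall>e>0. \<exists>U. openin W U \<and> x \<in> U \<and> (\<forall>y\<in>U. vnorm V (f y \<ominus> f x) < e))"
proof (cases "f \<in> topspace W \<rightarrow> carrier V")
  case True
  have *: "(\<forall>y\<in>U. f y \<in> mball (f x) e) \<longleftrightarrow> (\<forall>y\<in>U. vnorm V (f y \<ominus> f x) < e)"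
    if "openin W U" "x \<in> topspace W" "e > 0" for U x e
  proof (intro ball_cong refl)
    fix y assume "y \<in> U"
    then have "f y \<in> carrier V" "f x \<in> carrier V"
      using that True openin_subset by blast+
    then show "f y \<in> mball (f x) e \<longleftrightarrow> vnorm V (f y \<ominus> f x) < e"
      using dist_less_iff[of "f x" "f y" e] that by (auto simp: snorm_diff_commute)
  qed
  show ?thesis
    unfolding norm_topology_def continuous_map_to_metric using True * by (simp cong: conj_cong)
next
  case False
  then show ?thesis
    using continuous_map_funspace[of W "norm_topology V" f] by auto
qed

lemma mcomplete_norm:
  "mcomplete \<longleftrightarrow>
    (\<forall>u :: nat \<Rightarrow> 'v. range u \<subseteq> carrier V \<and> (\<forall>e>0. \<exists>N. \<forall>m\<ge>N. \<forall>n\<ge>N. vnorm V (u m \<ominus> u n) < e) \<longrightarrow>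
      (\<exists>l\<in>carrier V. \<forall>e>0. \<exists>N. \<forall>n\<ge>N. vnorm V (u n \<ominus> l) < e))"
  by (rule mcomplete_snorm)

end

lemma banach_space_iff:
  "banach_space V \<longleftrightarrow>
    normed_nspace V \<and> Metric_space.mcomplete (carrier V) (snorm_dist 1 V (carrier V) (vnorm V))"
proof
  assume V: "banach_space V"
  then interpret scalar_module V
    by (simp add: banach_space_def scalar_module_def)
  \<comment> \<open>The powers with exponent 1 disappear for nonnegative bases; for the norm of the
    sum this uses that the carrier is closed under addition.\<close>
  have "vnorm V (x \<oplus>\<^bsub>V\<^esub> y) \<le> vnorm V x + vnorm V y" if "x \<in> carrier V" "y \<in> carrier V" for x y
    using V that a_closed[OF that] by (force simp: banach_space_def complete_snorm_def)
  then show "normed_nspace V \<and> Metric_space.mcomplete (carrier V) (snorm_dist 1 V (carrier V) (vnorm V))"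
    using V
    by (simp add: banach_space_def complete_snorm_def normed_nspace_def snormed_module_def
        snormed_module_axioms_def scalar_module_axioms submodule_carrier)
next
  assume V: "normed_nspace V \<and> Metric_space.mcomplete (carrier V) (snorm_dist 1 V (carrier V) (vnorm V))"
  then interpret normed_nspace V by simp
  show "banach_space V"
    using V module_axioms norm_triangle snorm_scale snorm_eq_0
    by (simp add: banach_space_def complete_snorm_def)
qed

section \<open>Linear and multilinear operators\<close>

text \<open>The algebraic part of \<open>linear_ops\<close>. Maps fed to the axioms
  \<open>\<Phi>_linear\<close> and \<open>\<Psi>_linear\<close> below come with an explicit bound in
  place of continuity, for instance y \<mapsto> c y and c \<mapsto> c b.
  \<open>multilinear_on\<close> makes the same separation.\<close>

definition linear_on :: "('k, 'v) nspace \<Rightarrow> ('k, 'w) nspace \<Rightarrow> ('v \<Rightarrow> 'w) \<Rightarrow> bool" where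
  "linear_on G E u \<longleftrightarrow> u \<in> carrier G \<rightarrow> carrier E \<and>
     (\<forall>x\<in>carrier G. \<forall>y\<in>carrier G. u (x \<oplus>\<^bsub>G\<^esub> y) = u x \<oplus>\<^bsub>E\<^esub> u y) \<and>
     (\<forall>c. \<forall>x\<in>carrier G. u (c \<odot>\<^bsub>G\<^esub> x) = c \<odot>\<^bsub>E\<^esub> u x)"

lemma linear_onD:
  assumes "linear_on G E u"
  shows "x \<in> carrier G \<Longrightarrow> u x \<in> carrier E"
    and "x \<in> carrier G \<Longrightarrow> y \<in> carrier G \<Longrightarrow> u (x \<oplus>\<^bsub>G\<^esub> y) = u x \<oplus>\<^bsub>E\<^esub> u y"
    and "x \<in> carrier G \<Longrightarrow> u (c \<odot>\<^bsub>G\<^esub> x) = c \<odot>\<^bsub>E\<^esub> u x"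
  using assms by (auto simp: linear_on_def)

lemma linear_on_zero:
  assumes "normed_nspace G" "normed_nspace E" "linear_on G E u"
  shows "u \<zero>\<^bsub>G\<^esub> = \<zero>\<^bsub>E\<^esub>"
proof -
  interpret G: normed_nspace G by fact
  interpret E: normed_nspace E by fact
  have z: "\<zero>\<^bsub>G\<^esub> \<in> carrier G" by simp
  have "u (0 \<odot>\<^bsub>G\<^esub> \<zero>\<^bsub>G\<^esub>) = 0 \<odot>\<^bsub>E\<^esub> u \<zero>\<^bsub>G\<^esub>"
    using linear_onD(3)[OF assms(3) z] .
  then show ?thesis
    using E.scale_zero_left[OF linear_onD(1)[OF assms(3) z]] by simp
qed

lemma linear_on_finsum:
  assumes "normed_nspace G" "normed_nspace E" "linear_on G E u" "finite J" "x \<in> J \<rightarrow> carrier G"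
  shows "u (finsum G x J) = finsum E (\<lambda>j. u (x j)) J"
proof -
  interpret G: normed_nspace G by fact
  interpret E: normed_nspace E by fact
  note u = linear_onD[OF assms(3)]
  show ?thesis
    using assms(4,5)
  proof (induction J rule: finite_induct)
    case empty
    then show ?case
      using linear_on_zero[OF assms(1-3)] by simp
  next
    case (insert j J)
    then have "u (x j \<oplus>\<^bsub>G\<^esub> finsum G x J) = u (x j) \<oplus>\<^bsub>E\<^esub> finsum E (\<lambda>j. u (x j)) J"
      by (subst u(2)) auto
    with insert show ?case
      by (simp add: G.M.finsum_insert E.M.finsum_insert Pi_def u(1))
  qed
qed

lemma linear_on_of_linear_ops: "u \<in> linear_ops G E \<Longrightarrow> linear_on G E u"
  by (simp add: linear_ops_def linear_on_def)

text \<open>\<open>op_norm\<close> is a supremum of reals and carries no information until the set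
  is known to be bounded. By continuity at zero some ball of radius r is mapped into the unit ball,
  and homogeneity turns this into the bound 2 / r on the closed unit ball.\<close>

lemma linear_ops_bounded:
  fixes G :: "('k::real_normed_field, 'v) nspace" and E :: "('k, 'w) nspace"
  assumes "normed_nspace G" "normed_nspace E" "u \<in> linear_ops G E"
  shows "0 \<le> op_norm G E u" "\<And>x. x \<in> carrier G \<Longrightarrow> vnorm E (u x) \<le> op_norm G E u * vnorm G x"
proof -
  interpret G: normed_nspace G by fact
  interpret E: normed_nspace E by fact
  note u = linear_onD[OF linear_on_of_linear_ops[OF assms(3)]]
  have u0: "u \<zero>\<^bsub>G\<^esub> = \<zero>\<^bsub>E\<^esub>"
    using linear_on_zero assms linear_on_of_linear_ops by blast
  have "continuous_map (norm_topology G) (norm_topology E) u"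
    using assms(3) by (simp add: linear_ops_def)
  then obtain U where U: "openin (norm_topology G) U" "\<zero>\<^bsub>G\<^esub> \<in> U"
      "\<And>y. y \<in> U \<Longrightarrow> vnorm E (u y \<ominus>\<^bsub>E\<^esub> u \<zero>\<^bsub>G\<^esub>) < 1"
    unfolding E.continuous_map_into_norm_topology
    by (metis G.M.zero_closed G.topspace_norm_topology zero_less_one)
  then obtain r where r: "r > 0" "G.mball \<zero>\<^bsub>G\<^esub> r \<subseteq> U"
    unfolding norm_topology_def G.openin_mtopology by blast
  have small: "vnorm E (u y) < 1" if "y \<in> carrier G" "vnorm G y < r" for y
  proof -
    have "y \<in> G.mball \<zero>\<^bsub>G\<^esub> r"
      using that r(1) G.dist_less_iff[of "\<zero>\<^bsub>G\<^esub>" y r] by (simp add: a_minus_def G.snorm_minus)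
    then show ?thesis
      using U(3)[of y] r(2) u0 u(1)[OF that(1)] by auto
  qed
  have bound: "vnorm E (u x) \<le> 2 / r" if x: "x \<in> carrier G" "vnorm G x \<le> 1" for x
  proof -
    \<comment> \<open>A factor of norm r / 2 shrinks the closed unit ball strictly into the ball of
      radius r.\<close>
    define c where "c = (of_real (r / 2) :: 'k)"
    have c: "norm c = r / 2"
      using r(1) by (simp add: c_def)
    have "vnorm G (c \<odot>\<^bsub>G\<^esub> x) < r"
    proof -
      have "vnorm G (c \<odot>\<^bsub>G\<^esub> x) = r / 2 * vnorm G x"
        using G.snorm_scale[OF x(1), of c] by (simp add: c)
      also have "\<dots> \<le> r / 2 * 1"
        using x r(1) by (intro mult_left_mono) auto
      also have "\<dots> < r"
        using r(1) by simp
      finally show ?thesis .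
    qed
    then have "norm c * vnorm E (u x) < 1"
      using small[of "c \<odot>\<^bsub>G\<^esub> x"] x by (simp add: u E.snorm_scale)
    then show ?thesis
      using r(1) by (simp add: c field_simps)
  qed
  have bdd: "bdd_above ((\<lambda>x. vnorm E (u x)) ` {x \<in> carrier G. vnorm G x \<le> 1})"
    using bound by (intro bdd_aboveI[of _ "2 / r"]) auto
  have le: "vnorm E (u x) \<le> op_norm G E u" if "x \<in> carrier G" "vnorm G x \<le> 1" for x
    unfolding op_norm_def using bdd that by (intro cSUP_upper) auto
  show "0 \<le> op_norm G E u"
    using le[of "\<zero>\<^bsub>G\<^esub>"] by (simp add: u0)
  fix x assume x: "x \<in> carrier G"
  show "vnorm E (u x) \<le> op_norm G E u * vnorm G x"
  proof (cases "x = \<zero>\<^bsub>G\<^esub>")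
    case True
    then show ?thesis by (simp add: u0)
  next
    case False
    then have pos: "0 < vnorm G x"
      using G.snorm_eq_0[OF x] G.snorm_nonneg[OF x] by linarith
    define c where "c = (of_real (1 / vnorm G x) :: 'k)"
    have c: "norm c = 1 / vnorm G x"
      using pos by (simp add: c_def del: of_real_divide)
    have "norm c * vnorm E (u x) \<le> op_norm G E u"
      using le[of "c \<odot>\<^bsub>G\<^esub> x"] x pos by (simp add: u E.snorm_scale G.snorm_scale c)
    then show ?thesis
      using pos by (simp add: c field_simps)
  qed
qed

section \<open>Multilinear maps: boundedness implies continuity\<close>

definition multilinear_on ::
    "nat \<Rightarrow> (nat \<Rightarrow> ('k, 'v) nspace) \<Rightarrow> ('k, 'v) nspace \<Rightarrow> ((nat \<Rightarrow> 'v) \<Rightarrow> 'v) \<Rightarrow> bool" where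
  "multilinear_on n E F T \<longleftrightarrow> T \<in> prod_carrier n E \<rightarrow>\<^sub>E carrier F \<and>
     (\<forall>x\<in>prod_carrier n E. \<forall>i\<in>{1..n}. \<forall>a\<in>carrier (E i). \<forall>b\<in>carrier (E i).
        T (x(i := a \<oplus>\<^bsub>E i\<^esub> b)) = T (x(i := a)) \<oplus>\<^bsub>F\<^esub> T (x(i := b))) \<and>
     (\<forall>x\<in>prod_carrier n E. \<forall>i\<in>{1..n}. \<forall>c. \<forall>a\<in>carrier (E i).
        T (x(i := c \<odot>\<^bsub>E i\<^esub> a)) = c \<odot>\<^bsub>F\<^esub> T (x(i := a)))"

lemma multilinear_onD:
  assumes "multilinear_on n E F T"
  shows "x \<in> prod_carrier n E \<Longrightarrow> T x \<in> carrier F"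
    and "x \<notin> prod_carrier n E \<Longrightarrow> T x = undefined"
    and "x \<in> prod_carrier n E \<Longrightarrow> i \<in> {1..n} \<Longrightarrow> a \<in> carrier (E i) \<Longrightarrow> b \<in> carrier (E i) \<Longrightarrow>
      T (x(i := a \<oplus>\<^bsub>E i\<^esub> b)) = T (x(i := a)) \<oplus>\<^bsub>F\<^esub> T (x(i := b))"
    and "x \<in> prod_carrier n E \<Longrightarrow> i \<in> {1..n} \<Longrightarrow> a \<in> carrier (E i) \<Longrightarrow>
      T (x(i := c \<odot>\<^bsub>E i\<^esub> a)) = c \<odot>\<^bsub>F\<^esub> T (x(i := a))"
  using assms unfolding multilinear_on_def by (blast dest: PiE_mem PiE_arb)+

lemma multilinear_ops_iff:
  "T \<in> multilinear_ops n E F \<longleftrightarrow> multilinear_on n E F T \<and>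
     continuous_map (product_topology (\<lambda>i. norm_topology (E i)) {1..n}) (norm_topology F) T"
  by (simp add: multilinear_ops_def multilinear_on_def)

lemma prod_carrier_upd:
  "x \<in> prod_carrier n E \<Longrightarrow> i \<in> {1..n} \<Longrightarrow> a \<in> carrier (E i) \<Longrightarrow> x(i := a) \<in> prod_carrier n E"
  unfolding prod_carrier_def by (auto simp: PiE_def extensional_def)

lemma prod_carrier_mem: "x \<in> prod_carrier n E \<Longrightarrow> i \<in> {1..n} \<Longrightarrow> x i \<in> carrier (E i)"
  unfolding prod_carrier_def by (rule PiE_mem)

lemma multilinear_space_simps [simp]:
  "carrier (multilinear_space n E F) = multilinear_ops n E F"
  "\<zero>\<^bsub>multilinear_space n E F\<^esub> = (\<lambda>x\<in>prod_carrier n E. \<zero>\<^bsub>F\<^esub>)"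
  "S \<oplus>\<^bsub>multilinear_space n E F\<^esub> T = (\<lambda>x\<in>prod_carrier n E. S x \<oplus>\<^bsub>F\<^esub> T x)"
  "c \<odot>\<^bsub>multilinear_space n E F\<^esub> T = (\<lambda>x\<in>prod_carrier n E. c \<odot>\<^bsub>F\<^esub> T x)"
  by (simp_all add: multilinear_space_def)

locale normed_tuple = F: normed_nspace F
  for F :: "('k::real_normed_field, 'v) nspace" +
  fixes n :: nat and E :: "nat \<Rightarrow> ('k, 'v) nspace"
  assumes E: "i \<in> {1..n} \<Longrightarrow> normed_nspace (E i)"
begin

text \<open>The hybrid point z m has the coordinates of y up to m and those of x beyond. Passing to
  the next hybrid changes T by its value at a point with one coordinate y i - x i, while the other n
  - 1 coordinates have norm at most R. The assumption 1 \<le> R allows R ^ n in place of R ^ (n -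
  1).\<close>

lemma multilinear_telescope:
  assumes T: "multilinear_on n E F T"
    and bound: "\<And>x. x \<in> prod_carrier n E \<Longrightarrow> vnorm F (T x) \<le> C * (\<Prod>i=1..n. vnorm (E i) (x i))"
    and x: "x \<in> prod_carrier n E" and y: "y \<in> prod_carrier n E"
    and R: "1 \<le> R" "\<And>i. i \<in> {1..n} \<Longrightarrow> vnorm (E i) (x i) \<le> R"
      "\<And>i. i \<in> {1..n} \<Longrightarrow> vnorm (E i) (y i) \<le> R"
    and C: "0 \<le> C"
  shows "vnorm F (T y \<ominus>\<^bsub>F\<^esub> T x) \<le> (\<Sum>i=1..n. C * R ^ n * vnorm (E i) (y i \<ominus>\<^bsub>E i\<^esub> x i))"
proof -
  note T' = multilinear_onD[OF T]
  define z where "z m = (\<lambda>i. if i \<le> m then y i else x i)" for m :: nat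
  have z: "z m \<in> prod_carrier n E" for m
    using x y unfolding z_def prod_carrier_def by (auto simp: PiE_iff extensional_def)
  have "vnorm F (T (z m) \<ominus>\<^bsub>F\<^esub> T x) \<le> (\<Sum>i=1..m. C * R ^ n * vnorm (E i) (y i \<ominus>\<^bsub>E i\<^esub> x i))"
    if "m \<le> n" for m
    using that
  proof (induction m)
    case 0
    have "z 0 = x"
      using x y by (auto simp: z_def prod_carrier_def PiE_def extensional_def)
    then show ?case
      using T'(1)[OF x] by (simp add: a_minus_def F.M.r_neg)
  next
    case (Suc m)
    define i where "i = Suc m"
    then have i: "i \<in> {1..n}" using Suc by auto
    interpret Ei: normed_nspace "E i" using E i .
    have xi: "x i \<in> carrier (E i)" and yi: "y i \<in> carrier (E i)"
      using x y i by (auto intro: prod_carrier_mem)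
    define d where "d = y i \<ominus>\<^bsub>E i\<^esub> x i"
    have d: "d \<in> carrier (E i)" using xi yi by (simp add: d_def)
    have zi: "z m = (z m)(i := x i)" "z i = (z m)(i := y i)"
      by (auto simp: z_def i_def)
    have "T (z i) = T ((z m)(i := x i \<oplus>\<^bsub>E i\<^esub> d))"
      using zi(2) Ei.diff_add_cancel[OF xi yi] by (simp add: d_def)
    also have "\<dots> = T (z m) \<oplus>\<^bsub>F\<^esub> T ((z m)(i := d))"
      using T'(3)[OF z i xi d] zi(1) by simp
    finally have Tz: "T (z i) = T (z m) \<oplus>\<^bsub>F\<^esub> T ((z m)(i := d))" .
    have zd: "(z m)(i := d) \<in> prod_carrier n E"
      using z i d by (rule prod_carrier_upd)
    have "T (z i) \<ominus>\<^bsub>F\<^esub> T x = T ((z m)(i := d)) \<oplus>\<^bsub>F\<^esub> (T (z m) \<ominus>\<^bsub>F\<^esub> T x)"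
      unfolding Tz using T'(1)[OF z] T'(1)[OF x] T'(1)[OF zd] by (simp add: a_minus_def F.M.a_ac)
    then have 1: "vnorm F (T (z i) \<ominus>\<^bsub>F\<^esub> T x) \<le> vnorm F (T ((z m)(i := d))) + vnorm F (T (z m) \<ominus>\<^bsub>F\<^esub> T x)"
      using F.norm_triangle T'(1)[OF z] T'(1)[OF x] T'(1)[OF zd] by simp
    have "(\<Prod>l\<in>{1..n} - {i}. vnorm (E l) (z m l)) \<le> (\<Prod>l\<in>{1..n} - {i}. R)"
    proof (rule prod_mono)
      fix l assume l: "l \<in> {1..n} - {i}"
      then interpret El: normed_nspace "E l" using E by simp
      show "0 \<le> vnorm (E l) (z m l) \<and> vnorm (E l) (z m l) \<le> R"
        using R l El.snorm_nonneg[OF prod_carrier_mem[OF z, of l]] by (auto simp: z_def)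
    qed
    also have "\<dots> \<le> R ^ n"
      using R(1) card_Diff1_le[of "{1..n}" i] by (simp add: power_increasing)
    finally have "C * (vnorm (E i) d * (\<Prod>l\<in>{1..n} - {i}. vnorm (E l) (z m l))) \<le> C * (vnorm (E i) d * R ^ n)"
      using C Ei.snorm_nonneg[OF d] by (simp add: mult_left_mono)
    moreover have "(\<Prod>l=1..n. vnorm (E l) (((z m)(i := d)) l)) =
        vnorm (E i) d * (\<Prod>l\<in>{1..n} - {i}. vnorm (E l) (z m l))"
      using i by (subst prod.remove[of _ i]) auto
    ultimately have "vnorm F (T ((z m)(i := d))) \<le> C * R ^ n * vnorm (E i) d"
      using bound[OF zd] by (simp add: mult_ac)
    with 1 have "vnorm F (T (z i) \<ominus>\<^bsub>F\<^esub> T x) \<le>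
        C * R ^ n * vnorm (E i) d + vnorm F (T (z m) \<ominus>\<^bsub>F\<^esub> T x)"
      by simp
    with Suc show ?case
      by (simp add: i_def d_def)
  qed
  from this[of n] have "vnorm F (T (z n) \<ominus>\<^bsub>F\<^esub> T x) \<le> (\<Sum>i=1..n. C * R ^ n * vnorm (E i) (y i \<ominus>\<^bsub>E i\<^esub> x i))"
    by simp
  moreover have "z n = y"
    using x y by (auto simp: z_def prod_carrier_def PiE_def extensional_def)
  ultimately show ?thesis by simp
qed

lemma topspace_product_norm_topology:
  "topspace (product_topology (\<lambda>i. norm_topology (E i)) {1..n}) = prod_carrier n E"
  unfolding topspace_product_topology prod_carrier_def
  by (intro PiE_cong) (use E normed_nspace.topspace_norm_topology in blast)

text \<open>In a box around x all coordinates are bounded by one number R, and the telescope becomes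
  a Lipschitz estimate. This is the source of continuity for the operators that are given by an
  inequality.\<close>

lemma bounded_multilinear_continuous:
  assumes T: "multilinear_on n E F T" and C: "0 \<le> C"
    and bound: "\<And>x. x \<in> prod_carrier n E \<Longrightarrow> vnorm F (T x) \<le> C * (\<Prod>i=1..n. vnorm (E i) (x i))"
  shows "T \<in> multilinear_ops n E F"
proof -
  note T' = multilinear_onD[OF T]
  have "\<exists>U. openin (product_topology (\<lambda>i. norm_topology (E i)) {1..n}) U \<and> x \<in> U \<and>
      (\<forall>y\<in>U. vnorm F (T y \<ominus>\<^bsub>F\<^esub> T x) < e)" if x: "x \<in> prod_carrier n E" and e: "0 < e" for x e
  proof -
    \<comment> \<open>R exceeds the norm of every x i by at least 1. The box U has radius at most 1,
      so R bounds the coordinates of all its points too.\<close>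
    define R where "R = 2 + (\<Sum>i=1..n. vnorm (E i) (x i))"
    have nn: "0 \<le> vnorm (E i) (x i)" if "i \<in> {1..n}" for i
      using normed_nspace.axioms(1)[OF E[OF that]] prod_carrier_mem[OF x that]
      by (rule snormed_module.snorm_nonneg)
    have xR: "vnorm (E i) (x i) + 1 \<le> R" if "i \<in> {1..n}" for i
      using member_le_sum[of i "{1..n}" "\<lambda>i. vnorm (E i) (x i)"] that nn by (simp add: R_def)
    have R: "1 \<le> R"
      using sum_nonneg[of "{1..n}" "\<lambda>i. vnorm (E i) (x i)"] nn by (simp add: R_def)
    define M where "M = C * R ^ n"
    have M: "0 \<le> M" using C R by (simp add: M_def)
    \<comment> \<open>The telescope bounds the variation over the box by n M r. The 1 added in the
      denominator keeps it nonzero and makes n M r < e strict.\<close>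
    define r where "r = min 1 (e / (real n * M + 1))"
    have D: "0 < real n * M + 1" using M by (simp add: add_nonneg_pos)
    have r: "0 < r" "r \<le> 1" "real n * M * r < e"
    proof -
      show "0 < r" using e D by (simp add: r_def)
      show "r \<le> 1" by (simp add: r_def)
      have "r \<le> e / (real n * M + 1)" by (simp add: r_def)
      then have "(real n * M + 1) * r \<le> e"
        using D by (simp add: pos_le_divide_eq mult.commute)
      then show "real n * M * r < e"
        using \<open>0 < r\<close> by (simp add: algebra_simps)
    qed
    define U where "U = (\<Pi>\<^sub>E i\<in>{1..n}. {w \<in> carrier (E i). vnorm (E i) (w \<ominus>\<^bsub>E i\<^esub> x i) < r})"
    have "openin (product_topology (\<lambda>i. norm_topology (E i)) {1..n}) U"
      unfolding U_def openin_PiE[OF finite_atLeastAtMost]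
      by (auto intro!: disjI2 normed_nspace.norm_ball_open[OF E] prod_carrier_mem[OF x])
    moreover have "x \<in> U"
      unfolding U_def
    proof (rule PiE_I)
      fix i assume i: "i \<in> {1..n}"
      interpret Ei: normed_nspace "E i" using E i .
      show "x i \<in> {w \<in> carrier (E i). vnorm (E i) (w \<ominus>\<^bsub>E i\<^esub> x i) < r}"
        using prod_carrier_mem[OF x i] r by (simp add: a_minus_def Ei.M.r_neg)
    next
      show "x i = undefined" if "i \<notin> {1..n}" for i
        using x that unfolding prod_carrier_def by (rule PiE_arb)
    qed
    moreover have "vnorm F (T y \<ominus>\<^bsub>F\<^esub> T x) < e" if "y \<in> U" for y
    proof -
      have y: "y \<in> prod_carrier n E"
        using that unfolding U_def prod_carrier_def by (rule PiE_mono[THEN subsetD, rotated]) auto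
      have yr: "vnorm (E i) (y i \<ominus>\<^bsub>E i\<^esub> x i) < r" if "i \<in> {1..n}" for i
        using PiE_mem[OF \<open>y \<in> U\<close>[unfolded U_def] that] by simp
      have yR: "vnorm (E i) (y i) \<le> R" if i: "i \<in> {1..n}" for i
      proof -
        interpret Ei: normed_nspace "E i" using E i .
        have "vnorm (E i) (x i \<oplus>\<^bsub>E i\<^esub> (y i \<ominus>\<^bsub>E i\<^esub> x i)) \<le> vnorm (E i) (x i) + vnorm (E i) (y i \<ominus>\<^bsub>E i\<^esub> x i)"
          using prod_carrier_mem[OF x i] prod_carrier_mem[OF y i] by (intro Ei.norm_triangle) auto
        then show ?thesis
          using xR[OF i] yr[OF i] r prod_carrier_mem[OF x i] prod_carrier_mem[OF y i]
          by (simp add: Ei.diff_add_cancel)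
      qed
      have "vnorm F (T y \<ominus>\<^bsub>F\<^esub> T x) \<le> (\<Sum>i=1..n. C * R ^ n * vnorm (E i) (y i \<ominus>\<^bsub>E i\<^esub> x i))"
      proof (rule multilinear_telescope[OF T bound x y R _ yR C])
        show "vnorm (E i) (x i) \<le> R" if "i \<in> {1..n}" for i
          using xR[OF that] by simp
      qed
      also have "\<dots> \<le> (\<Sum>i=1..n. M * r)"
        unfolding M_def[symmetric] using yr M by (intro sum_mono mult_left_mono) (auto simp: less_imp_le)
      also have "\<dots> < e"
        using r(3) by simp
      finally show ?thesis .
    qed
    ultimately show ?thesis by blast
  qed
  then show ?thesis
    using T T' unfolding multilinear_ops_iff F.continuous_map_into_norm_topology
      topspace_product_norm_topology by blast
qed

text \<open>Membership of the updated points in the domain is offered as a premise so that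
  restricted functions can be evaluated there by \<open>simp\<close>.\<close>

lemma multilinear_onI:
  assumes "\<And>x. x \<in> prod_carrier n E \<Longrightarrow> T x \<in> carrier F"
    and "\<And>x. x \<notin> prod_carrier n E \<Longrightarrow> T x = undefined"
    and "\<And>x i a b. \<lbrakk>x \<in> prod_carrier n E; i \<in> {1..n}; a \<in> carrier (E i); b \<in> carrier (E i);
      x(i := a) \<in> prod_carrier n E; x(i := b) \<in> prod_carrier n E; x(i := a \<oplus>\<^bsub>E i\<^esub> b) \<in> prod_carrier n E\<rbrakk> \<Longrightarrow>
      T (x(i := a \<oplus>\<^bsub>E i\<^esub> b)) = T (x(i := a)) \<oplus>\<^bsub>F\<^esub> T (x(i := b))"
    and "\<And>x i a c. \<lbrakk>x \<in> prod_carrier n E; i \<in> {1..n}; a \<in> carrier (E i);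
      x(i := a) \<in> prod_carrier n E; x(i := c \<odot>\<^bsub>E i\<^esub> a) \<in> prod_carrier n E\<rbrakk> \<Longrightarrow>
      T (x(i := c \<odot>\<^bsub>E i\<^esub> a)) = c \<odot>\<^bsub>F\<^esub> T (x(i := a))"
  shows "multilinear_on n E F T"
  unfolding multilinear_on_def
proof (intro conjI ballI allI)
  show "T \<in> prod_carrier n E \<rightarrow>\<^sub>E carrier F"
    using assms(1,2) by (auto intro!: PiE_I)
next
  fix x i a b
  assume *: "x \<in> prod_carrier n E" "i \<in> {1..n}" "a \<in> carrier (E i)" "b \<in> carrier (E i)"
  interpret Ei: normed_nspace "E i" using E *(2) .
  show "T (x(i := a \<oplus>\<^bsub>E i\<^esub> b)) = T (x(i := a)) \<oplus>\<^bsub>F\<^esub> T (x(i := b))"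
    using * by (intro assms(3) prod_carrier_upd) auto
next
  fix x i c a
  assume *: "x \<in> prod_carrier n E" "i \<in> {1..n}" "a \<in> carrier (E i)"
  interpret Ei: normed_nspace "E i" using E *(2) .
  show "T (x(i := c \<odot>\<^bsub>E i\<^esub> a)) = c \<odot>\<^bsub>F\<^esub> T (x(i := a))"
    using * by (intro assms(4) prod_carrier_upd) auto
qed

section \<open>The vector space of continuous multilinear operators\<close>

lemma multilinear_on_zero: "multilinear_on n E F (\<lambda>x\<in>prod_carrier n E. \<zero>\<^bsub>F\<^esub>)"
  by (rule multilinear_onI) auto

lemma multilinear_on_add:
  assumes "multilinear_on n E F S" "multilinear_on n E F T"
  shows "multilinear_on n E F (\<lambda>x\<in>prod_carrier n E. S x \<oplus>\<^bsub>F\<^esub> T x)"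
proof -
  note S = multilinear_onD[OF assms(1)] and T = multilinear_onD[OF assms(2)]
  show ?thesis
    by (rule multilinear_onI) (simp_all add: S T F.M.a_ac F.scale_r_distr)
qed

lemma multilinear_on_scale:
  assumes "multilinear_on n E F T"
  shows "multilinear_on n E F (\<lambda>x\<in>prod_carrier n E. c \<odot>\<^bsub>F\<^esub> T x)"
proof -
  note T = multilinear_onD[OF assms]
  show ?thesis
    by (rule multilinear_onI) (simp_all add: T F.scale_r_distr F.scale_scale mult.commute)
qed

text \<open>Neighbourhoods are taken inside \<open>prod_carrier n E\<close>, where pointwise sums
  and multiples, being restricted functions, can be evaluated. The \<epsilon>-form is used for them
  because membership in \<open>multilinear_ops\<close> provides continuity and no explicit
  bound.\<close>

lemma multilinear_ops_continuous:
  "T \<in> multilinear_ops n E F \<longleftrightarrow> multilinear_on n E F T \<and>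
    (\<forall>x\<in>prod_carrier n E. \<forall>e>0. \<exists>U\<subseteq>prod_carrier n E.
      openin (product_topology (\<lambda>i. norm_topology (E i)) {1..n}) U \<and> x \<in> U \<and>
      (\<forall>y\<in>U. vnorm F (T y \<ominus>\<^bsub>F\<^esub> T x) < e))" (is "_ \<longleftrightarrow> ?R")
proof
  show "T \<in> multilinear_ops n E F \<Longrightarrow> ?R"
    unfolding multilinear_ops_iff F.continuous_map_into_norm_topology
    using openin_subset topspace_product_norm_topology by metis
  show "?R \<Longrightarrow> T \<in> multilinear_ops n E F"
    unfolding multilinear_ops_iff F.continuous_map_into_norm_topology topspace_product_norm_topology
    using multilinear_onD(1) by blast
qed

lemma multilinear_ops_zero: "(\<lambda>x\<in>prod_carrier n E. \<zero>\<^bsub>F\<^esub>) \<in> multilinear_ops n E F"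
  by (rule bounded_multilinear_continuous[where C = 0]) (auto simp: multilinear_on_zero)

lemma multilinear_ops_add:
  assumes S: "S \<in> multilinear_ops n E F" and T: "T \<in> multilinear_ops n E F"
  shows "(\<lambda>x\<in>prod_carrier n E. S x \<oplus>\<^bsub>F\<^esub> T x) \<in> multilinear_ops n E F"
  unfolding multilinear_ops_continuous
proof (intro conjI ballI allI impI)
  note S' = S[unfolded multilinear_ops_continuous] and T' = T[unfolded multilinear_ops_continuous]
  show "multilinear_on n E F (\<lambda>x\<in>prod_carrier n E. S x \<oplus>\<^bsub>F\<^esub> T x)"
    using S' T' multilinear_on_add by blast
  have SF: "S x \<in> carrier F" and TF: "T x \<in> carrier F" if "x \<in> prod_carrier n E" for x
    using S' T' that multilinear_onD(1) by blast+
  fix x and e :: real assume x: "x \<in> prod_carrier n E" and "0 < e"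
  then have e: "0 < e / 2" by simp
  obtain U where U: "U \<subseteq> prod_carrier n E"
      "openin (product_topology (\<lambda>i. norm_topology (E i)) {1..n}) U" "x \<in> U"
      "\<forall>y\<in>U. vnorm F (S y \<ominus>\<^bsub>F\<^esub> S x) < e / 2"
    using S' x e by blast
  obtain W where W: "openin (product_topology (\<lambda>i. norm_topology (E i)) {1..n}) W" "x \<in> W"
      "\<forall>y\<in>W. vnorm F (T y \<ominus>\<^bsub>F\<^esub> T x) < e / 2"
    using T' x e by blast
  have "vnorm F ((S y \<oplus>\<^bsub>F\<^esub> T y) \<ominus>\<^bsub>F\<^esub> (S x \<oplus>\<^bsub>F\<^esub> T x)) < e" if y: "y \<in> U \<inter> W" for y
  proof -
    have yc: "y \<in> prod_carrier n E" using y U by auto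
    have "vnorm F ((S y \<oplus>\<^bsub>F\<^esub> T y) \<ominus>\<^bsub>F\<^esub> (S x \<oplus>\<^bsub>F\<^esub> T x)) \<le>
        vnorm F (S y \<ominus>\<^bsub>F\<^esub> S x) + vnorm F (T y \<ominus>\<^bsub>F\<^esub> T x)"
      using x yc by (simp add: SF TF F.add_diff_add F.norm_triangle)
    also have "\<dots> < e"
      using U(4) W(3) y by fastforce
    finally show ?thesis .
  qed
  then show "\<exists>U\<subseteq>prod_carrier n E. openin (product_topology (\<lambda>i. norm_topology (E i)) {1..n}) U \<and> x \<in> U \<and>
      (\<forall>y\<in>U. vnorm F ((\<lambda>x\<in>prod_carrier n E. S x \<oplus>\<^bsub>F\<^esub> T x) y \<ominus>\<^bsub>F\<^esub>
        (\<lambda>x\<in>prod_carrier n E. S x \<oplus>\<^bsub>F\<^esub> T x) x) < e)"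
    using U W x by (intro exI[of _ "U \<inter> W"]) (auto simp: openin_Int subset_iff)
qed

lemma multilinear_ops_scale:
  assumes T: "T \<in> multilinear_ops n E F"
  shows "(\<lambda>x\<in>prod_carrier n E. c \<odot>\<^bsub>F\<^esub> T x) \<in> multilinear_ops n E F"
  unfolding multilinear_ops_continuous
proof (intro conjI ballI allI impI)
  note T' = T[unfolded multilinear_ops_continuous]
  show "multilinear_on n E F (\<lambda>x\<in>prod_carrier n E. c \<odot>\<^bsub>F\<^esub> T x)"
    using T' multilinear_on_scale by blast
  have TF: "T x \<in> carrier F" if "x \<in> prod_carrier n E" for x
    using T' that multilinear_onD(1) by blast
  fix x and e :: real assume x: "x \<in> prod_carrier n E" and "0 < e"
  then have e: "0 < e / (norm c + 1)"
    by (simp add: add_nonneg_pos)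
  obtain U where U: "U \<subseteq> prod_carrier n E"
      "openin (product_topology (\<lambda>i. norm_topology (E i)) {1..n}) U" "x \<in> U"
      "\<forall>y\<in>U. vnorm F (T y \<ominus>\<^bsub>F\<^esub> T x) < e / (norm c + 1)"
    using T' x e by blast
  have "vnorm F ((c \<odot>\<^bsub>F\<^esub> T y) \<ominus>\<^bsub>F\<^esub> (c \<odot>\<^bsub>F\<^esub> T x)) < e" if y: "y \<in> U" for y
  proof -
    have yc: "y \<in> prod_carrier n E" using y U by auto
    have "vnorm F ((c \<odot>\<^bsub>F\<^esub> T y) \<ominus>\<^bsub>F\<^esub> (c \<odot>\<^bsub>F\<^esub> T x)) = norm c * vnorm F (T y \<ominus>\<^bsub>F\<^esub> T x)"
      using x yc by (simp add: TF F.scale_diff[symmetric] F.snorm_scale)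
    also have "\<dots> \<le> (norm c + 1) * vnorm F (T y \<ominus>\<^bsub>F\<^esub> T x)"
      using x yc by (intro mult_right_mono) (auto simp: TF)
    also have "\<dots> < e"
      using U(4) y by (simp add: pos_less_divide_eq add_nonneg_pos mult.commute)
    finally show ?thesis .
  qed
  then show "\<exists>U\<subseteq>prod_carrier n E. openin (product_topology (\<lambda>i. norm_topology (E i)) {1..n}) U \<and> x \<in> U \<and>
      (\<forall>y\<in>U. vnorm F ((\<lambda>x\<in>prod_carrier n E. c \<odot>\<^bsub>F\<^esub> T x) y \<ominus>\<^bsub>F\<^esub>
        (\<lambda>x\<in>prod_carrier n E. c \<odot>\<^bsub>F\<^esub> T x) x) < e)"
    using U x by (intro exI[of _ U]) (auto simp: subset_iff)
qed

lemma scalar_module_multilinear_space: "scalar_module (multilinear_space n E F)"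
proof -
  have C: "T x \<in> carrier F" if "T \<in> multilinear_ops n E F" "x \<in> prod_carrier n E" for T x
    using that multilinear_onD(1) by (auto simp: multilinear_ops_iff)
  \<comment> \<open>The module laws are equations between functions on the whole type; this settles
    them outside the domain, for instance that adding zero returns T.\<close>
  have U: "T x = undefined" if "T \<in> multilinear_ops n E F" "x \<notin> prod_carrier n E" for T x
    using that multilinear_onD(2) by (auto simp: multilinear_ops_iff)
  have "abelian_group (multilinear_space n E F)"
  proof (rule abelian_groupI)
    fix T assume T: "T \<in> carrier (multilinear_space n E F)"
    show "\<exists>S\<in>carrier (multilinear_space n E F).
        S \<oplus>\<^bsub>multilinear_space n E F\<^esub> T = \<zero>\<^bsub>multilinear_space n E F\<^esub>"
      using T multilinear_ops_scale[of T "- 1"]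
      by (intro bexI[of _ "\<lambda>x\<in>prod_carrier n E. (- 1) \<odot>\<^bsub>F\<^esub> T x"])
        (auto simp: fun_eq_iff C F.scale_minus_one F.M.l_neg)
  qed (auto simp: multilinear_ops_add multilinear_ops_zero fun_eq_iff C U F.M.a_ac)
  then show ?thesis
    unfolding scalar_module_def
    by (intro moduleI cring_from_type_algebra)
      (auto simp: multilinear_ops_scale fun_eq_iff C U F.scale_l_distr F.scale_r_distr F.scale_scale)
qed

end

section \<open>Ideals defined by sequence norms\<close>

lemma null_sequence_le:
  fixes a b :: "nat \<Rightarrow> real"
  assumes "\<And>m. 0 \<le> a m" "\<And>m. a m \<le> b m" "b \<longlonglongrightarrow> 0"
  shows "a \<longlonglongrightarrow> 0"
  using assms by (intro tendsto_sandwich[of "\<lambda>_. 0" a sequentially b]) auto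

section \<open>Convergent sequences in a normed space\<close>

context normed_nspace
begin

text \<open>A real null sequence is used rather than \<open>limitin\<close>, so that uniqueness and
  the algebra of limits reduce to limit rules for real sequences.\<close>

definition conv :: "(nat \<Rightarrow> 'v) \<Rightarrow> 'v \<Rightarrow> bool" where
  "conv f l \<longleftrightarrow> range f \<subseteq> carrier V \<and> l \<in> carrier V \<and> (\<lambda>m. vnorm V (f m \<ominus> l)) \<longlonglongrightarrow> 0"

lemma tendsto_norm_diff_iff:
  assumes "range f \<subseteq> carrier V" "l \<in> carrier V"
  shows "(\<lambda>m. vnorm V (f m \<ominus> l)) \<longlonglongrightarrow> 0 \<longleftrightarrow> (\<forall>e>0. \<exists>N. \<forall>m\<ge>N. vnorm V (f m \<ominus> l) < e)"
proof -
  have "\<bar>vnorm V (f m \<ominus> l)\<bar> = vnorm V (f m \<ominus> l)" for m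
    using assms by (intro abs_of_nonneg snorm_nonneg sub_diff) auto
  then show ?thesis
    by (simp add: LIMSEQ_def dist_real_def)
qed

lemma mcomplete_conv:
  assumes "mcomplete" "\<And>m. f m \<in> carrier V"
    and "\<And>e. 0 < e \<Longrightarrow> \<exists>N. \<forall>m\<ge>N. \<forall>m'\<ge>N. vnorm V (f m \<ominus> f m') < e"
  shows "\<exists>l. conv f l"
  using assms tendsto_norm_diff_iff[of f] unfolding mcomplete_norm conv_def
  by (metis (no_types, lifting) image_subset_iff)

lemma conv_bound:
  assumes "conv f l" "\<And>m. g m \<in> carrier V" "l' \<in> carrier V" "0 \<le> B"
    and "\<And>m. vnorm V (g m \<ominus> l') \<le> B * vnorm V (f m \<ominus> l)"
  shows "conv g l'"
  unfolding conv_def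
proof (intro conjI)
  have "(\<lambda>m. B * vnorm V (f m \<ominus> l)) \<longlonglongrightarrow> 0"
    using assms(1) by (intro tendsto_mult_right_zero) (simp add: conv_def)
  then show "(\<lambda>m. vnorm V (g m \<ominus> l')) \<longlonglongrightarrow> 0"
    by (rule null_sequence_le[rotated 2]) (use assms in auto)
qed (use assms in auto)

lemma conv_scale:
  assumes "conv f l"
  shows "conv (\<lambda>m. c \<odot> f m) (c \<odot> l)"
proof (rule conv_bound[OF assms, of _ _ "norm c"])
  have f: "f m \<in> carrier V" "l \<in> carrier V" for m using assms by (auto simp: conv_def)
  then show "c \<odot> f m \<in> carrier V" "c \<odot> l \<in> carrier V" for m by auto
  show "vnorm V (c \<odot> f m \<ominus> c \<odot> l) \<le> norm c * vnorm V (f m \<ominus> l)" for m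
    using f by (simp add: scale_diff[symmetric] snorm_scale)
qed simp

lemma conv_add:
  assumes "conv f l" "conv g l'"
  shows "conv (\<lambda>m. f m \<oplus> g m) (l \<oplus> l')"
proof -
  have f: "f m \<in> carrier V" "l \<in> carrier V" "g m \<in> carrier V" "l' \<in> carrier V" for m
    using assms by (auto simp: conv_def)
  have "(\<lambda>m. vnorm V (f m \<ominus> l) + vnorm V (g m \<ominus> l')) \<longlonglongrightarrow> 0"
    using tendsto_add[of _ 0 _ _ 0] assms by (fastforce simp: conv_def)
  then have "(\<lambda>m. vnorm V ((f m \<oplus> g m) \<ominus> (l \<oplus> l'))) \<longlonglongrightarrow> 0"
  proof (rule null_sequence_le[rotated 2])
    fix m
    show "0 \<le> vnorm V ((f m \<oplus> g m) \<ominus> (l \<oplus> l'))"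
      using f by simp
    show "vnorm V ((f m \<oplus> g m) \<ominus> (l \<oplus> l')) \<le> vnorm V (f m \<ominus> l) + vnorm V (g m \<ominus> l')"
      using f norm_triangle[of "f m \<ominus> l" "g m \<ominus> l'"] by (simp add: add_diff_add)
  qed
  then show ?thesis
    using f by (auto simp: conv_def)
qed

lemma conv_unique:
  assumes "conv f l" "conv f l'"
  shows "l = l'"
proof -
  have f: "f m \<in> carrier V" "l \<in> carrier V" "l' \<in> carrier V" for m
    using assms by (auto simp: conv_def)
  have "(\<lambda>m. vnorm V (f m \<ominus> l) + vnorm V (f m \<ominus> l')) \<longlonglongrightarrow> 0 + 0"
    using assms by (intro tendsto_intros) (simp_all add: conv_def)
  moreover have "vnorm V (l \<ominus> l') \<le> vnorm V (f m \<ominus> l) + vnorm V (f m \<ominus> l')" for m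
    using snorm_diff_triangle[of l "f m" l'] f by (simp add: snorm_diff_commute)
  ultimately have "vnorm V (l \<ominus> l') \<le> 0"
    by (intro LIMSEQ_le_const[of "\<lambda>m. vnorm V (f m \<ominus> l) + vnorm V (f m \<ominus> l')"]) auto
  moreover have d: "l \<ominus> l' \<in> carrier V"
    using f by simp
  ultimately have "vnorm V (l \<ominus> l') = 0"
    using snorm_nonneg[OF d] by linarith
  then have "l \<ominus> l' = \<zero>"
    using snorm_eq_0[OF d] by blast
  then show ?thesis
    using f diff_eq_zero by blast
qed

end

section \<open>The scalar field as a normed space\<close>

lemma scalar_space_simps [simp]:
  "carrier (scalar_space :: ('k::real_normed_field, 'a + 'k) nspace) = range Inr"
  "\<zero>\<^bsub>scalar_space :: ('k, 'a + 'k) nspace\<^esub> = Inr 0"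
  "x \<oplus>\<^bsub>scalar_space :: ('k, 'a + 'k) nspace\<^esub> y = Inr (projr x + projr y)"
  "c \<odot>\<^bsub>scalar_space :: ('k, 'a + 'k) nspace\<^esub> x = Inr (c * projr x)"
  "vnorm (scalar_space :: ('k, 'a + 'k) nspace) x = norm (projr x)"
  by (simp_all add: scalar_space_def)

lemma normed_nspace_scalar_space:
  "normed_nspace (scalar_space :: ('k::real_normed_field, 'a + 'k) nspace)"
proof -
  let ?K = "scalar_space :: ('k, 'a + 'k) nspace"
  have "abelian_group ?K"
  proof (rule abelian_groupI)
    fix x assume "x \<in> carrier ?K"
    then show "\<exists>y\<in>carrier ?K. y \<oplus>\<^bsub>?K\<^esub> x = \<zero>\<^bsub>?K\<^esub>"
      by (intro bexI[of _ "Inr (- projr x)"]) auto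
  qed (auto simp: algebra_simps)
  then have "scalar_module ?K"
    unfolding scalar_module_def
    by (intro moduleI cring_from_type_algebra) (auto simp: algebra_simps)
  then interpret scalar_module ?K .
  show ?thesis
  proof (intro normed_nspace.intro snormed_module.intro snormed_module_axioms.intro)
    show "scalar_module ?K" by (rule scalar_module_axioms)
    show "submodule (carrier ?K) (ring_of_type_algebra :: 'k ring) ?K" by (rule submodule_carrier)
    fix x y assume "x \<in> carrier ?K" "y \<in> carrier ?K"
    then show "vnorm ?K x = 0 \<longleftrightarrow> x = \<zero>\<^bsub>?K\<^esub>"
      "vnorm ?K (x \<oplus>\<^bsub>?K\<^esub> y) powr 1 \<le> vnorm ?K x powr 1 + vnorm ?K y powr 1"
      by (auto simp: norm_triangle_ineq)
  qed (simp_all add: norm_mult)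
qed

text \<open>The inequality behind \<open>type_consts\<close> and \<open>cotype_consts\<close> with
  the sign condition on C removed: the best constant of the zero operator is 0, while those sets
  contain positive numbers only.\<close>

definition op_bound ::
    "nat \<Rightarrow> (('k::real_normed_field, 'v) nspace \<Rightarrow> nat \<Rightarrow> (nat \<Rightarrow> 'v) \<Rightarrow> real) \<Rightarrow>
     (nat \<Rightarrow> ('k, 'v) nspace \<Rightarrow> nat \<Rightarrow> (nat \<Rightarrow> 'v) \<Rightarrow> real) \<Rightarrow> ('k, 'v) mop \<Rightarrow> real \<Rightarrow> bool" where
  "op_bound n \<Phi> \<Psi> = (\<lambda>(E, F, T) C. \<forall>k x. (\<forall>i\<in>{1..n}. \<forall>j\<in>{1..k}. x i j \<in> carrier (E i)) \<longrightarrow>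
     \<Phi> F k (\<lambda>j. T (\<lambda>i\<in>{1..n}. x i j)) \<le> C * (\<Prod>i=1..n. \<Psi> i (E i) k (x i)))"

text \<open>\<open>\<Phi>\<close> measures sequences in the target and \<open>\<Psi> i\<close>
  sequences in the i-th factor. \<open>\<Phi>_single\<close> and \<open>\<Psi>_single\<close> make
  every admissible constant a bound for the operator; \<open>\<Phi>_add\<close> gives the s-triangle
  inequality; \<open>\<Phi>_le\<close> turns pointwise null sequences of operators into null
  sequences for \<open>\<Phi>\<close> at each fixed length; the two linear axioms give homogeneity
  and the ideal inequality; \<open>scalar_Holder\<close> puts operators of finite type into the
  class and bounds the norm of I_n by 1. The set \<open>range Inr\<close> is the carrier of
  \<open>scalar_space\<close>.\<close>

locale sequence_norms =
  fixes n :: nat and s :: real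
    and \<Phi> :: "('k::real_normed_field, 'a + 'k) nspace \<Rightarrow> nat \<Rightarrow> (nat \<Rightarrow> 'a + 'k) \<Rightarrow> real"
    and \<Psi> :: "nat \<Rightarrow> ('k, 'a + 'k) nspace \<Rightarrow> nat \<Rightarrow> (nat \<Rightarrow> 'a + 'k) \<Rightarrow> real"
  assumes n: "1 \<le> n" and s: "0 < s" "s \<le> 1"
    and \<Phi>_nonneg: "\<lbrakk>normed_nspace V; x \<in> {1..k} \<rightarrow> carrier V\<rbrakk> \<Longrightarrow> 0 \<le> \<Phi> V k x"
    and \<Phi>_cong: "\<lbrakk>normed_nspace V; y \<in> {1..k} \<rightarrow> carrier V; \<And>j. j \<in> {1..k} \<Longrightarrow> x j = y j\<rbrakk> \<Longrightarrow>
      \<Phi> V k x = \<Phi> V k y"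
    and \<Phi>_linear: "\<lbrakk>normed_nspace V; normed_nspace W; linear_on V W t; 0 \<le> B;
      \<And>y. y \<in> carrier V \<Longrightarrow> vnorm W (t y) \<le> B * vnorm V y; x \<in> {1..k} \<rightarrow> carrier V\<rbrakk> \<Longrightarrow>
      \<Phi> W k (\<lambda>j. t (x j)) \<le> B * \<Phi> V k x"
    and \<Phi>_add: "\<lbrakk>normed_nspace V; x \<in> {1..k} \<rightarrow> carrier V; y \<in> {1..k} \<rightarrow> carrier V\<rbrakk> \<Longrightarrow>
      \<Phi> V k (\<lambda>j. x j \<oplus>\<^bsub>V\<^esub> y j) powr s \<le> \<Phi> V k x powr s + \<Phi> V k y powr s"
    and \<Phi>_single: "\<lbrakk>normed_nspace V; x 1 \<in> carrier V\<rbrakk> \<Longrightarrow> \<Phi> V 1 x = vnorm V (x 1)"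
    and \<Phi>_le: "\<lbrakk>normed_nspace V; x \<in> {1..k} \<rightarrow> carrier V\<rbrakk> \<Longrightarrow>
      \<Phi> V k x powr s \<le> (\<Sum>j=1..k. vnorm V (x j) powr s)"
    and \<Psi>_nonneg: "\<lbrakk>i \<in> {1..n}; normed_nspace V; x \<in> {1..k} \<rightarrow> carrier V\<rbrakk> \<Longrightarrow> 0 \<le> \<Psi> i V k x"
    and \<Psi>_linear: "\<lbrakk>i \<in> {1..n}; normed_nspace V; normed_nspace W; linear_on V W t; 0 \<le> B;
      \<And>y. y \<in> carrier V \<Longrightarrow> vnorm W (t y) \<le> B * vnorm V y; x \<in> {1..k} \<rightarrow> carrier V\<rbrakk> \<Longrightarrow>
      \<Psi> i W k (\<lambda>j. t (x j)) \<le> B * \<Psi> i V k x"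
    and \<Psi>_single: "\<lbrakk>i \<in> {1..n}; normed_nspace V; x 1 \<in> carrier V\<rbrakk> \<Longrightarrow> \<Psi> i V 1 x = vnorm V (x 1)"
    and scalar_Holder: "\<lbrakk>normed_nspace V; b \<in> carrier V; \<And>i. i \<in> {1..n} \<Longrightarrow> z i \<in> {1..k} \<rightarrow> range Inr\<rbrakk> \<Longrightarrow>
      \<Phi> V k (\<lambda>j. (\<Prod>i=1..n. projr (z i j)) \<odot>\<^bsub>V\<^esub> b) \<le>
        vnorm V b * (\<Prod>i=1..n. \<Psi> i scalar_space k (z i))"
begin

definition bounds :: "('k, 'a + 'k) mop \<Rightarrow> real set" where
  "bounds A = {C. C > 0 \<and> op_bound n \<Phi> \<Psi> A C}"

definition ops :: "('k, 'a + 'k) mop set" where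
  "ops = {A \<in> all_mops n. bounds A \<noteq> {}}"

definition nrm :: "('k, 'a + 'k) mop \<Rightarrow> real" where
  "nrm A = Inf (bounds A)"

end

section \<open>Operators between fixed spaces and their best constants\<close>

locale sequence_norms_tuple = sequence_norms n s \<Phi> \<Psi> + normed_tuple F n E
  for n s and \<Phi> :: "('k::real_normed_field, 'a + 'k) nspace \<Rightarrow> nat \<Rightarrow> (nat \<Rightarrow> 'a + 'k) \<Rightarrow> real"
    and \<Psi> and F :: "('k, 'a + 'k) nspace" and E
begin

abbreviation bound :: "((nat \<Rightarrow> 'a + 'k) \<Rightarrow> 'a + 'k) \<Rightarrow> real \<Rightarrow> bool" where
  "bound T \<equiv> op_bound n \<Phi> \<Psi> (E, F, T)"

abbreviation prodn :: "nat \<Rightarrow> (nat \<Rightarrow> nat \<Rightarrow> 'a + 'k) \<Rightarrow> real" where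
  "prodn k x \<equiv> \<Prod>i=1..n. \<Psi> i (E i) k (x i)"

abbreviation arg :: "(nat \<Rightarrow> nat \<Rightarrow> 'a + 'k) \<Rightarrow> nat \<Rightarrow> nat \<Rightarrow> 'a + 'k" where
  "arg x j \<equiv> (\<lambda>i\<in>{1..n}. x i j)"

definition adm :: "nat \<Rightarrow> (nat \<Rightarrow> nat \<Rightarrow> 'a + 'k) \<Rightarrow> bool" where
  "adm k x \<longleftrightarrow> (\<forall>i\<in>{1..n}. \<forall>j\<in>{1..k}. x i j \<in> carrier (E i))"

lemma admD: "adm k x \<Longrightarrow> i \<in> {1..n} \<Longrightarrow> x i \<in> {1..k} \<rightarrow> carrier (E i)"
  by (auto simp: adm_def)

lemma boundI:
  assumes "\<And>k x. adm k x \<Longrightarrow>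
    \<Phi> F k (\<lambda>j. T (arg x j)) \<le> C * prodn k x"
  shows "bound T C"
  unfolding op_bound_def prod.case adm_def[symmetric] by (intro allI impI assms)

lemma boundD:
  assumes "bound T C" "adm k x"
  shows "\<Phi> F k (\<lambda>j. T (arg x j)) \<le> C * prodn k x"
  using assms unfolding op_bound_def prod.case adm_def[symmetric] by blast

lemma arg_mem:
  assumes "adm k x" "j \<in> {1..k}"
  shows "arg x j \<in> prod_carrier n E"
  using assms by (auto simp: prod_carrier_def adm_def)

lemma prodn_nonneg:
  assumes "adm k x"
  shows "0 \<le> prodn k x"
proof (rule prod_nonneg)
  fix i assume i: "i \<in> {1..n}"
  show "0 \<le> \<Psi> i (E i) k (x i)"
    using i E[OF i] admD[OF assms i] by (intro \<Psi>_nonneg)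
qed

lemma op_seq_mem:
  assumes "multilinear_on n E F T" "adm k x"
  shows "(\<lambda>j. T (arg x j)) \<in> {1..k} \<rightarrow> carrier F"
  using multilinear_onD(1)[OF assms(1) arg_mem[OF assms(2)]] by blast

lemma bound_norm:
  assumes "multilinear_on n E F T" "bound T C" "x \<in> prod_carrier n E"
  shows "vnorm F (T x) \<le> C * (\<Prod>i=1..n. vnorm (E i) (x i))"
proof -
  have "arg (\<lambda>i j. x i) j = x" for j
    using assms(3) by (auto simp: prod_carrier_def PiE_def extensional_def)
  then have "\<Phi> F 1 (\<lambda>j. T x) \<le> C * prodn 1 (\<lambda>i j. x i)"
    using boundD[OF assms(2), of 1 "\<lambda>i j. x i"] prod_carrier_mem[OF assms(3)] by (simp add: adm_def)
  also have "prodn 1 (\<lambda>i j. x i) = (\<Prod>i=1..n. vnorm (E i) (x i))"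
    using E prod_carrier_mem[OF assms(3)] by (intro prod.cong refl \<Psi>_single) auto
  finally show ?thesis
    using \<Phi>_single[OF F.normed_nspace_axioms, of "\<lambda>j. T x"] multilinear_onD(1)[OF assms(1,3)] by simp
qed

lemma bound_mono:
  assumes "bound T C" "C \<le> C'"
  shows "bound T C'"
proof (rule boundI)
  fix k :: nat and x assume x: "adm k x"
  show "\<Phi> F k (\<lambda>j. T (arg x j)) \<le> C' * prodn k x"
    using boundD[OF assms(1) x] mult_right_mono[OF assms(2) prodn_nonneg[OF x]] by linarith
qed

lemma bounds_nonempty:
  assumes "0 \<le> C" "bound T C"
  shows "bounds (E, F, T) \<noteq> {}"
proof -
  have "C + 1 \<in> bounds (E, F, T)"
    using assms bound_mono[OF assms(2), of "C + 1"] by (simp add: bounds_def)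
  then show ?thesis by auto
qed

text \<open>The number C is not in \<open>bounds\<close> when C = 0, so the infimum is compared with
  C + e for every e > 0.\<close>

lemma nrm_le:
  assumes "0 \<le> C" "bound T C"
  shows "nrm (E, F, T) \<le> C"
proof (rule field_le_epsilon)
  fix e :: real assume "0 < e"
  then have "C + e \<in> bounds (E, F, T)"
    using assms bound_mono[OF assms(2), of "C + e"] by (simp add: bounds_def)
  then show "nrm (E, F, T) \<le> C + e"
    unfolding nrm_def by (intro cInf_lower) (auto simp: bounds_def intro!: bdd_belowI[of _ 0])
qed

lemma nrm_nonneg:
  assumes "bounds (E, F, T) \<noteq> {}"
  shows "0 \<le> nrm (E, F, T)"
  unfolding nrm_def using assms by (intro cInf_greatest) (auto simp: bounds_def)

text \<open>The infimum itself is an admissible constant. Where the product on the right is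
  positive, dividing by it gives a lower bound of \<open>bounds\<close>; where it is 0, any element
  of \<open>bounds\<close> already gives the inequality.\<close>

lemma bound_nrm:
  assumes "bounds (E, F, T) \<noteq> {}"
  shows "bound T (nrm (E, F, T))"
proof (rule boundI)
  fix k :: nat and x assume x: "adm k x"
  have le: "\<Phi> F k (\<lambda>j. T (arg x j)) \<le> C * prodn k x" if "C \<in> bounds (E, F, T)" for C
    using boundD[OF _ x] that by (simp add: bounds_def)
  show "\<Phi> F k (\<lambda>j. T (arg x j)) \<le> nrm (E, F, T) * prodn k x"
  proof (cases "prodn k x = 0")
    case True
    obtain C where "C \<in> bounds (E, F, T)" using assms by blast
    from le[OF this] show ?thesis unfolding True by simp
  next
    case False
    then have "0 < prodn k x" using prodn_nonneg[OF x] by linarith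
    then have "\<Phi> F k (\<lambda>j. T (arg x j)) / prodn k x \<le> nrm (E, F, T)"
      unfolding nrm_def using assms le by (intro cInf_greatest) (auto simp: pos_divide_le_eq)
    then show ?thesis
      using \<open>0 < prodn k x\<close> by (simp add: pos_divide_le_eq)
  qed
qed

text \<open>For Banach spaces this is the component of \<open>ops\<close> at E and F, see
  \<open>component_ops\<close>. Only algebraic multilinearity is required, since
  \<open>bounded_multilinear_continuous\<close> recovers continuity from the inequality.\<close>

definition bops :: "((nat \<Rightarrow> 'a + 'k) \<Rightarrow> 'a + 'k) set" where
  "bops = {T. multilinear_on n E F T \<and> bounds (E, F, T) \<noteq> {}}"

lemma bopsI: "multilinear_on n E F T \<Longrightarrow> 0 \<le> C \<Longrightarrow> bound T C \<Longrightarrow> T \<in> bops"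
  using bounds_nonempty by (simp add: bops_def)

lemma bopsD:
  assumes "T \<in> bops"
  shows "multilinear_on n E F T" "bound T (nrm (E, F, T))" "0 \<le> nrm (E, F, T)"
  using assms bound_nrm nrm_nonneg by (auto simp: bops_def)

lemma bops_subset: "bops \<subseteq> multilinear_ops n E F"
  using bounded_multilinear_continuous bopsD bound_norm by blast

lemma bound_zero: "bound (\<lambda>x\<in>prod_carrier n E. \<zero>\<^bsub>F\<^esub>) 0"
proof (rule boundI)
  fix k :: nat and x assume x: "adm k x"
  have "\<Phi> F k (\<lambda>j. (\<lambda>x\<in>prod_carrier n E. \<zero>\<^bsub>F\<^esub>) (arg x j)) = \<Phi> F k (\<lambda>j. \<zero>\<^bsub>F\<^esub>)"
    using arg_mem[OF x] by (intro \<Phi>_cong) (auto simp: F.normed_nspace_axioms)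
  \<comment> \<open>\<open>\<Phi>_le\<close> bounds the power by a sum of terms
    \<open>0 powr s = 0\<close>. A power vanishes only if its base does, so \<open>\<Phi>\<close> of
    the zero sequence is 0.\<close>
  moreover have "\<Phi> F k (\<lambda>j. \<zero>\<^bsub>F\<^esub>) powr s \<le> 0"
    using \<Phi>_le[OF F.normed_nspace_axioms, of "\<lambda>j. \<zero>\<^bsub>F\<^esub>" k] s by simp
  ultimately show "\<Phi> F k (\<lambda>j. (\<lambda>x\<in>prod_carrier n E. \<zero>\<^bsub>F\<^esub>) (arg x j)) \<le> 0 * prodn k x"
    using powr_ge_zero[of "\<Phi> F k (\<lambda>j. \<zero>\<^bsub>F\<^esub>)" s] by simp
qed

lemma bound_scale:
  assumes T: "multilinear_on n E F T" "bound T C"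
  shows "bound (\<lambda>x\<in>prod_carrier n E. c \<odot>\<^bsub>F\<^esub> T x) (norm c * C)"
proof (rule boundI)
  fix k :: nat and x assume x: "adm k x"
  have TF: "(\<lambda>j. T (arg x j)) \<in> {1..k} \<rightarrow> carrier F"
    by (rule op_seq_mem[OF T(1) x])
  have "\<Phi> F k (\<lambda>j. (\<lambda>x\<in>prod_carrier n E. c \<odot>\<^bsub>F\<^esub> T x) (arg x j)) = \<Phi> F k (\<lambda>j. c \<odot>\<^bsub>F\<^esub> T (arg x j))"
    using arg_mem[OF x] TF by (intro \<Phi>_cong) (auto simp: F.normed_nspace_axioms)
  also have "\<dots> \<le> norm c * \<Phi> F k (\<lambda>j. T (arg x j))"
    using F.normed_nspace_axioms TF
    by (intro \<Phi>_linear[where V = F and t = "\<lambda>y. c \<odot>\<^bsub>F\<^esub> y"])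
      (auto simp: linear_on_def F.scale_r_distr F.scale_scale F.snorm_scale mult.commute)
  also have "\<dots> \<le> norm c * C * prodn k x"
    using boundD[OF T(2) x] by (simp add: mult_left_mono mult.assoc)
  finally show "\<Phi> F k (\<lambda>j. (\<lambda>x\<in>prod_carrier n E. c \<odot>\<^bsub>F\<^esub> T x) (arg x j)) \<le> norm c * C * prodn k x" .
qed

text \<open>The subadditivity axiom concerns the s-th power of \<open>\<Phi>\<close>, so the
  constants combine as B^s + C^s. The s-th power of the resulting constant is the right side of the
  s-triangle inequality.\<close>

lemma bound_add:
  assumes S: "multilinear_on n E F S" "bound S B" "0 \<le> B"
    and T: "multilinear_on n E F T" "bound T C" "0 \<le> C"
  shows "bound (\<lambda>x\<in>prod_carrier n E. S x \<oplus>\<^bsub>F\<^esub> T x) ((B powr s + C powr s) powr (1 / s))"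
proof (rule boundI)
  fix k :: nat and x assume x: "adm k x"
  note P = prodn_nonneg[OF x]
  have SF: "(\<lambda>j. S (arg x j)) \<in> {1..k} \<rightarrow> carrier F" and TF: "(\<lambda>j. T (arg x j)) \<in> {1..k} \<rightarrow> carrier F"
    by (rule op_seq_mem[OF S(1) x] op_seq_mem[OF T(1) x]; assumption)+
  have eq: "\<Phi> F k (\<lambda>j. (\<lambda>x\<in>prod_carrier n E. S x \<oplus>\<^bsub>F\<^esub> T x) (arg x j)) =
      \<Phi> F k (\<lambda>j. S (arg x j) \<oplus>\<^bsub>F\<^esub> T (arg x j))" (is "?l = ?r")
    using arg_mem[OF x] SF TF by (intro \<Phi>_cong) (auto simp: F.normed_nspace_axioms)
  have nn: "0 \<le> ?r" "0 \<le> \<Phi> F k (\<lambda>j. S (arg x j))" "0 \<le> \<Phi> F k (\<lambda>j. T (arg x j))"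
    using SF TF by (auto intro!: \<Phi>_nonneg F.normed_nspace_axioms F.M.a_closed)
  have "?r powr s \<le> \<Phi> F k (\<lambda>j. S (arg x j)) powr s + \<Phi> F k (\<lambda>j. T (arg x j)) powr s"
    using F.normed_nspace_axioms SF TF by (rule \<Phi>_add)
  also have "\<dots> \<le> (B * prodn k x) powr s + (C * prodn k x) powr s"
    using s nn boundD[OF S(2) x] boundD[OF T(2) x] by (intro add_mono powr_mono2) auto
  also have "\<dots> = (B powr s + C powr s) * prodn k x powr s"
    using S(3) T(3) P by (simp add: powr_mult algebra_simps)
  finally have "(?r powr s) powr (1 / s) \<le> ((B powr s + C powr s) * prodn k x powr s) powr (1 / s)"
    using s by (intro powr_mono2) auto
  then show "?l \<le> (B powr s + C powr s) powr (1 / s) * prodn k x"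
    unfolding eq using s nn P by (simp add: powr_mult powr_powr)
qed

lemma bops_zero: "(\<lambda>x\<in>prod_carrier n E. \<zero>\<^bsub>F\<^esub>) \<in> bops"
  using multilinear_on_zero bound_zero by (intro bopsI[where C = 0]) auto

lemma bops_scale: "T \<in> bops \<Longrightarrow> (\<lambda>x\<in>prod_carrier n E. c \<odot>\<^bsub>F\<^esub> T x) \<in> bops"
  using multilinear_on_scale bound_scale bopsD
  by (intro bopsI[where C = "norm c * nrm (E, F, T)"]) auto

lemma bops_add: "S \<in> bops \<Longrightarrow> T \<in> bops \<Longrightarrow> (\<lambda>x\<in>prod_carrier n E. S x \<oplus>\<^bsub>F\<^esub> T x) \<in> bops"
  using multilinear_on_add bound_add bopsD
  by (intro bopsI[where C = "(nrm (E, F, S) powr s + nrm (E, F, T) powr s) powr (1 / s)"]) auto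

abbreviation "L \<equiv> multilinear_space n E F"

sublocale L: scalar_module L
  by (rule scalar_module_multilinear_space)

lemma submodule_bops: "submodule bops (ring_of_type_algebra :: 'k ring) L"
proof (rule L.submoduleI)
  fix T assume T: "T \<in> bops"
  then have "T \<in> carrier L" using bops_subset by auto
  then show "\<ominus>\<^bsub>L\<^esub> T \<in> bops"
    using bops_scale[OF T, of "- 1"] by (simp flip: L.scale_minus_one)
qed (use bops_subset bops_zero bops_add bops_scale in auto)

text \<open>One inequality follows from \<open>bound_scale\<close>; applied to the factor 1 / c and
  the scaled operator it gives the other. For c = 0 nonnegativity takes the place of
  division.\<close>

lemma nrm_scale:
  assumes T: "T \<in> bops"
  shows "nrm (E, F, c \<odot>\<^bsub>L\<^esub> T) = norm c * nrm (E, F, T)"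
proof -
  have le: "nrm (E, F, d \<odot>\<^bsub>L\<^esub> S) \<le> norm d * nrm (E, F, S)" if "S \<in> bops" for d S
    using bopsD[OF that] bound_scale by (intro nrm_le) auto
  show ?thesis
  proof (cases "c = 0")
    case True
    moreover have "c \<odot>\<^bsub>L\<^esub> T \<in> bops"
      using bops_scale[OF T] by simp
    ultimately show ?thesis
      using le[OF T, of c] bopsD(3) by force
  next
    case False
    have TL: "T \<in> carrier L" using T bops_subset by auto
    have cT: "c \<odot>\<^bsub>L\<^esub> T \<in> bops"
      using bops_scale[OF T] by simp
    have "(1 / c) \<odot>\<^bsub>L\<^esub> (c \<odot>\<^bsub>L\<^esub> T) = T"
      using False L.scale_scale[OF TL] L.scale_one[OF TL] by (simp del: multilinear_space_simps)
    then have "nrm (E, F, T) \<le> norm (1 / c) * nrm (E, F, c \<odot>\<^bsub>L\<^esub> T)"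
      using le[OF cT, of "1 / c"] by metis
    then have "norm c * nrm (E, F, T) \<le> nrm (E, F, c \<odot>\<^bsub>L\<^esub> T)"
      using False by (simp add: norm_divide field_simps del: multilinear_space_simps)
    then show ?thesis
      using le[OF T, of c] by linarith
  qed
qed

lemma snormed_bops: "snormed_module L bops (\<lambda>T. nrm (E, F, T)) s"
proof (intro snormed_module.intro snormed_module_axioms.intro)
  show "scalar_module L" by (rule L.scalar_module_axioms)
  show "0 < s" by (rule s)
  show "submodule bops (ring_of_type_algebra :: 'k ring) L" by (rule submodule_bops)
  fix T assume T: "T \<in> bops"
  show "0 \<le> nrm (E, F, T)" using bopsD(3)[OF T] .
  show "nrm (E, F, T) = 0 \<longleftrightarrow> T = \<zero>\<^bsub>L\<^esub>"
  proof
    assume 0: "nrm (E, F, T) = 0"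
    show "T = \<zero>\<^bsub>L\<^esub>"
    proof
      fix x
      show "T x = \<zero>\<^bsub>L\<^esub> x"
      proof (cases "x \<in> prod_carrier n E")
        case True
        then have "vnorm F (T x) \<le> 0"
          using bound_norm[OF bopsD(1,2)[OF T] True] 0 by simp
        then show ?thesis
          using True F.snorm_eq_0 F.snorm_nonneg multilinear_onD(1)[OF bopsD(1)[OF T] True]
          by (metis multilinear_space_simps(2) order_antisym restrict_apply')
      next
        case False
        then show ?thesis
          using multilinear_onD(2)[OF bopsD(1)[OF T] False] by simp
      qed
    qed
  next
    assume "T = \<zero>\<^bsub>L\<^esub>"
    then show "nrm (E, F, T) = 0"
      using nrm_le[OF _ bound_zero] bopsD(3)[OF T] by simp
  qed
  show "nrm (E, F, c \<odot>\<^bsub>L\<^esub> T) = norm c * nrm (E, F, T)" for c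
    by (rule nrm_scale[OF T])
  fix S assume S: "S \<in> bops"
  have "nrm (E, F, T \<oplus>\<^bsub>L\<^esub> S) \<le> (nrm (E, F, T) powr s + nrm (E, F, S) powr s) powr (1 / s)"
    using bopsD[OF S] bopsD[OF T] bound_add by (intro nrm_le) auto
  then have "nrm (E, F, T \<oplus>\<^bsub>L\<^esub> S) powr s \<le>
      ((nrm (E, F, T) powr s + nrm (E, F, S) powr s) powr (1 / s)) powr s"
    using s bopsD(3)[OF bops_add[OF T S]] by (intro powr_mono2) auto
  then show "nrm (E, F, T \<oplus>\<^bsub>L\<^esub> S) powr s \<le> nrm (E, F, T) powr s + nrm (E, F, S) powr s"
    using s by (simp add: powr_powr)
qed

section \<open>Completeness of the best constant\<close>

sublocale N: snormed_module L bops "\<lambda>T. nrm (E, F, T)" s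
  by (rule snormed_bops)

text \<open>The additive inverse of \<open>L\<close> is determined by the group structure and not
  given pointwise, so it is rewritten as multiplication by -1.\<close>

lemma diff_apply:
  assumes "S \<in> multilinear_ops n E F" "T \<in> multilinear_ops n E F" "x \<in> prod_carrier n E"
  shows "(S \<ominus>\<^bsub>L\<^esub> T) x = S x \<ominus>\<^bsub>F\<^esub> T x"
proof -
  have "T x \<in> carrier F"
    using assms multilinear_onD(1) by (auto simp: multilinear_ops_iff)
  moreover have "\<ominus>\<^bsub>L\<^esub> T = (- 1) \<odot>\<^bsub>L\<^esub> T"
    using assms L.scale_minus_one[of T] by simp
  ultimately show ?thesis
    using assms(3) F.scale_minus_one[of "T x"] by (simp add: a_minus_def)
qed

lemma mcomplete_bops:
  assumes complete: "F.mcomplete"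
  shows "N.mcomplete"
  unfolding N.mcomplete_snorm
proof (intro allI impI, elim conjE)
  fix u :: "nat \<Rightarrow> (nat \<Rightarrow> 'a + 'k) \<Rightarrow> 'a + 'k"
  assume "range u \<subseteq> bops"
    and cauchy: "\<forall>e>0. \<exists>N. \<forall>m\<ge>N. \<forall>l\<ge>N. nrm (E, F, u m \<ominus>\<^bsub>L\<^esub> u l) < e"
  then have u: "u m \<in> bops" for m by auto
  then have uL: "u m \<in> multilinear_ops n E F" for m using bops_subset by auto
  have um: "multilinear_on n E F (u m)" for m using bopsD(1)[OF u] .
  have uF: "u m x \<in> carrier F" if "x \<in> prod_carrier n E" for m x
    using multilinear_onD(1)[OF um that] .
  have "\<exists>l. F.conv (\<lambda>m. u m x) l" if x: "x \<in> prod_carrier n E" for x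
  proof (rule F.mcomplete_conv[OF complete uF[OF x]])
    define P where "P = (\<Prod>i=1..n. vnorm (E i) (x i))"
    have P: "0 \<le> P"
      unfolding P_def using E prod_carrier_mem[OF x]
      by (intro prod_nonneg ballI snormed_module.snorm_nonneg[OF normed_nspace.axioms(1)]) auto
    fix e :: real assume "0 < e"
    \<comment> \<open>P vanishes when some coordinate of x is zero, so P + 1 serves as the
      divisor.\<close>
    then have "0 < e / (P + 1)" using P by simp
    then obtain N where N: "\<And>m l. m \<ge> N \<Longrightarrow> l \<ge> N \<Longrightarrow> nrm (E, F, u m \<ominus>\<^bsub>L\<^esub> u l) < e / (P + 1)"
      using cauchy by meson
    have "vnorm F (u m x \<ominus>\<^bsub>F\<^esub> u l x) < e" if "m \<ge> N" "l \<ge> N" for m l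
    proof -
      have D: "u m \<ominus>\<^bsub>L\<^esub> u l \<in> bops" using N.sub_diff[OF u u] .
      have "vnorm F (u m x \<ominus>\<^bsub>F\<^esub> u l x) \<le> nrm (E, F, u m \<ominus>\<^bsub>L\<^esub> u l) * P"
        using bound_norm[OF bopsD(1,2)[OF D] x] by (simp add: diff_apply uL x P_def)
      also have "\<dots> \<le> nrm (E, F, u m \<ominus>\<^bsub>L\<^esub> u l) * (P + 1)"
        using bopsD(3)[OF D] by (intro mult_left_mono) auto
      also have "\<dots> < e"
        using N[OF that] P by (simp add: pos_less_divide_eq)
      finally show ?thesis .
    qed
    then show "\<exists>N. \<forall>m\<ge>N. \<forall>l\<ge>N. vnorm F (u m x \<ominus>\<^bsub>F\<^esub> u l x) < e" by blast
  qed
  then obtain l where l: "\<And>x. x \<in> prod_carrier n E \<Longrightarrow> F.conv (\<lambda>m. u m x) (l x)"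
    by metis
  define T where "T = restrict l (prod_carrier n E)"
  have T: "F.conv (\<lambda>m. u m x) (T x)" if "x \<in> prod_carrier n E" for x
    using l that by (simp add: T_def)
  have Tm: "multilinear_on n E F T"
  proof (rule multilinear_onI)
    show "T x \<in> carrier F" if "x \<in> prod_carrier n E" for x
      using T[OF that] by (simp add: F.conv_def)
    show "T x = undefined" if "x \<notin> prod_carrier n E" for x
      using that by (simp add: T_def)
  next
    fix x i a b
    assume *: "x \<in> prod_carrier n E" "i \<in> {1..n}" "a \<in> carrier (E i)" "b \<in> carrier (E i)"
      and P: "x(i := a) \<in> prod_carrier n E" "x(i := b) \<in> prod_carrier n E"
        "x(i := a \<oplus>\<^bsub>E i\<^esub> b) \<in> prod_carrier n E"
    show "T (x(i := a \<oplus>\<^bsub>E i\<^esub> b)) = T (x(i := a)) \<oplus>\<^bsub>F\<^esub> T (x(i := b))"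
      using T[OF P(3)] F.conv_add[OF T[OF P(1)] T[OF P(2)]]
      by (intro F.conv_unique) (simp_all add: multilinear_onD(3)[OF um *])
  next
    fix x i a c
    assume *: "x \<in> prod_carrier n E" "i \<in> {1..n}" "a \<in> carrier (E i)"
      and P: "x(i := a) \<in> prod_carrier n E" "x(i := c \<odot>\<^bsub>E i\<^esub> a) \<in> prod_carrier n E"
    show "T (x(i := c \<odot>\<^bsub>E i\<^esub> a)) = c \<odot>\<^bsub>F\<^esub> T (x(i := a))"
      using T[OF P(2)] F.conv_scale[OF T[OF P(1)]]
      by (intro F.conv_unique) (simp_all add: multilinear_onD(4)[OF um *])
  qed
  \<comment> \<open>D m stands for u m - T. It is built pointwise because T is not yet known to lie
    in the carrier of \<open>L\<close>, where subtraction could be evaluated by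
    \<open>diff_apply\<close>.\<close>
  define D where "D m = (\<lambda>x\<in>prod_carrier n E. u m x \<oplus>\<^bsub>F\<^esub> (\<lambda>x\<in>prod_carrier n E. (- 1) \<odot>\<^bsub>F\<^esub> T x) x)" for m
  have TF: "T x \<in> carrier F" if "x \<in> prod_carrier n E" for x
    using multilinear_onD(1)[OF Tm that] .
  have Dm: "multilinear_on n E F (D m)" for m
    unfolding D_def by (intro multilinear_on_add um multilinear_on_scale Tm)
  have D: "D m x = u m x \<ominus>\<^bsub>F\<^esub> T x" if "x \<in> prod_carrier n E" for m x
    using that TF[OF that] F.scale_minus_one[of "T x"] by (simp add: D_def a_minus_def)
  \<comment> \<open>Write D m = (u m - u l) + D l. The first term satisfies the inequality with
    constant e for every l \<ge> N. By \<open>\<Phi>_le\<close> the second contributes a finite sum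
    over j \<le> k, which tends to 0 as l grows while x and k are fixed. In the limit the constant e
    remains for D m.\<close>
  have Db: "\<exists>N. \<forall>m\<ge>N. bound (D m) e" if "0 < e" for e
  proof -
    obtain N where "\<forall>m\<ge>N. \<forall>l\<ge>N. nrm (E, F, u m \<ominus>\<^bsub>L\<^esub> u l) < e"
      using cauchy \<open>0 < e\<close> by blast
    then have N: "nrm (E, F, u m \<ominus>\<^bsub>L\<^esub> u l) < e" if "m \<ge> N" "l \<ge> N" for m l
      using that by blast
    have "bound (D m) e" if m: "m \<ge> N" for m
    proof (rule boundI)
      fix k :: nat and x assume x: "adm k x"
      note P = prodn_nonneg[OF x]
      note a = arg_mem[OF x]
      have lim: "(\<lambda>l. (e * prodn k x) powr s + (\<Sum>j=1..k. vnorm F (D l (arg x j)) powr s)) \<longlonglongrightarrow>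
          (e * prodn k x) powr s + (\<Sum>j=1..k. 0)"
      proof (intro tendsto_add tendsto_const tendsto_sum)
        fix j assume j: "j \<in> {1..k}"
        have "(\<lambda>l. vnorm F (D l (arg x j))) \<longlonglongrightarrow> 0"
          unfolding D[OF a[OF j]] using T[OF a[OF j]] by (simp add: F.conv_def)
        then have "(\<lambda>l. vnorm F (D l (arg x j)) powr s) \<longlonglongrightarrow> 0 powr s"
          using s multilinear_onD(1)[OF Dm a[OF j]]
          by (intro tendsto_powr' tendsto_const) (auto intro!: always_eventually)
        then show "(\<lambda>l. vnorm F (D l (arg x j)) powr s) \<longlonglongrightarrow> 0" by simp
      qed
      have "\<Phi> F k (\<lambda>j. D m (arg x j)) powr s \<le>
          (e * prodn k x) powr s + (\<Sum>j=1..k. vnorm F (D l (arg x j)) powr s)" if l: "l \<ge> N" for l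
      proof -
        define S where "S = u m \<ominus>\<^bsub>L\<^esub> u l"
        have S: "S \<in> bops" unfolding S_def using N.sub_diff[OF u u] .
        have SF: "(\<lambda>j. S (arg x j)) \<in> {1..k} \<rightarrow> carrier F"
          by (rule op_seq_mem[OF bopsD(1)[OF S] x])
        have DF: "(\<lambda>j. D l (arg x j)) \<in> {1..k} \<rightarrow> carrier F"
          by (rule op_seq_mem[OF Dm x])
        have "\<Phi> F k (\<lambda>j. D m (arg x j)) = \<Phi> F k (\<lambda>j. S (arg x j) \<oplus>\<^bsub>F\<^esub> D l (arg x j))"
        proof (rule \<Phi>_cong[OF F.normed_nspace_axioms])
          show "(\<lambda>j. S (arg x j) \<oplus>\<^bsub>F\<^esub> D l (arg x j)) \<in> {1..k} \<rightarrow> carrier F"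
            using SF DF by auto
          fix j assume j: "j \<in> {1..k}"
          show "D m (arg x j) = S (arg x j) \<oplus>\<^bsub>F\<^esub> D l (arg x j)"
            unfolding S_def diff_apply[OF uL uL a[OF j]] D[OF a[OF j]]
            by (rule F.diff_add_diff[OF uF[OF a[OF j]] uF[OF a[OF j]] TF[OF a[OF j]], symmetric])
        qed
        also have "\<dots> powr s \<le> \<Phi> F k (\<lambda>j. S (arg x j)) powr s + \<Phi> F k (\<lambda>j. D l (arg x j)) powr s"
          using F.normed_nspace_axioms SF DF by (rule \<Phi>_add)
        also have "\<dots> \<le> (e * prodn k x) powr s + (\<Sum>j=1..k. vnorm F (D l (arg x j)) powr s)"
        proof (intro add_mono powr_mono2 \<Phi>_le F.normed_nspace_axioms DF)
          show "0 \<le> \<Phi> F k (\<lambda>j. S (arg x j))"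
            using F.normed_nspace_axioms SF by (rule \<Phi>_nonneg)
          show "\<Phi> F k (\<lambda>j. S (arg x j)) \<le> e * prodn k x"
            using bound_mono[OF bopsD(2)[OF S], of e] N[OF m l]
            by (intro boundD[OF _ x]) (auto simp: S_def)
        qed (use s in auto)
        finally show ?thesis .
      qed
      then have le: "\<Phi> F k (\<lambda>j. D m (arg x j)) powr s \<le> (e * prodn k x) powr s + (\<Sum>j=1..k. 0)"
        by (intro LIMSEQ_le_const[OF lim]) blast
      have "(\<Phi> F k (\<lambda>j. D m (arg x j)) powr s) powr (1 / s) \<le> ((e * prodn k x) powr s) powr (1 / s)"
        by (rule powr_mono2) (use s le in auto)
      moreover have "0 \<le> \<Phi> F k (\<lambda>j. D m (arg x j))"
        using F.normed_nspace_axioms op_seq_mem[OF Dm x] by (rule \<Phi>_nonneg)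
      ultimately show "\<Phi> F k (\<lambda>j. D m (arg x j)) \<le> e * prodn k x"
        using s P \<open>0 < e\<close> by (simp add: powr_powr)
    qed
    then show ?thesis by blast
  qed
  obtain N where "bound (D N) 1"
    using Db[of 1] by auto
  then have DN: "D N \<in> bops"
    using Dm by (intro bopsI[where C = 1]) auto
  \<comment> \<open>T is recovered as a difference of two members of the subspace
    \<open>bops\<close>, which provides its finite constant.\<close>
  have "u N \<ominus>\<^bsub>L\<^esub> D N = T"
  proof
    fix x
    show "(u N \<ominus>\<^bsub>L\<^esub> D N) x = T x"
    proof (cases "x \<in> prod_carrier n E")
      case True
      have "u N x \<ominus>\<^bsub>F\<^esub> (u N x \<ominus>\<^bsub>F\<^esub> T x) = T x"
        using uF[OF True] TF[OF True] F.minus_diff[of "u N x" "T x"] F.diff_add_cancel[of "u N x" "T x"]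
        by (simp add: a_minus_def)
      then show ?thesis
        using True DN bops_subset by (subst diff_apply) (auto simp: uL D)
    next
      case False
      then show ?thesis
        using multilinear_onD(2)[OF Tm False] multilinear_onD(2)[OF bopsD(1)[OF N.sub_diff[OF u DN]] False]
        by simp
    qed
  qed
  then have Tb: "T \<in> bops"
    using N.sub_diff[OF u DN] by metis
  have DT: "u m \<ominus>\<^bsub>L\<^esub> T = D m" for m
  proof
    fix x
    show "(u m \<ominus>\<^bsub>L\<^esub> T) x = D m x"
    proof (cases "x \<in> prod_carrier n E")
      case True
      then show ?thesis
        using Tb bops_subset by (subst diff_apply) (auto simp: uL D)
    next
      case False
      then show ?thesis
        using multilinear_onD(2)[OF Dm False] multilinear_onD(2)[OF bopsD(1)[OF N.sub_diff[OF u Tb]] False]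
        by simp
    qed
  qed
  show "\<exists>T\<in>bops. \<forall>e>0. \<exists>N. \<forall>m\<ge>N. nrm (E, F, u m \<ominus>\<^bsub>L\<^esub> T) < e"
  proof (intro bexI[OF _ Tb] allI impI)
    fix e :: real assume "0 < e"
    then obtain N where N: "\<And>m. m \<ge> N \<Longrightarrow> bound (D m) (e / 2)"
      using Db[of "e / 2"] by auto
    have "nrm (E, F, u m \<ominus>\<^bsub>L\<^esub> T) < e" if "m \<ge> N" for m
      using nrm_le[OF _ N[OF that]] \<open>0 < e\<close> by (simp add: DT)
    then show "\<exists>N. \<forall>m\<ge>N. nrm (E, F, u m \<ominus>\<^bsub>L\<^esub> T) < e" by blast
  qed
qed

lemma complete_snorm_bops:
  assumes "F.mcomplete"
  shows "complete_snorm s L bops (\<lambda>T. nrm (E, F, T))"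
  unfolding complete_snorm_def
  using N.snorm_nonneg N.snorm_eq_0 N.snorm_scale N.snorm_add mcomplete_bops[OF assms] by blast

section \<open>Operators of finite type\<close>

lemma elementary_op_bops:
  assumes \<phi>: "\<And>i. i \<in> {1..n} \<Longrightarrow> \<phi> i \<in> linear_ops (E i) scalar_space" and b: "b \<in> carrier F"
  shows "elementary_op n E F \<phi> b \<in> bops"
proof (rule bopsI)
  note lin = linear_onD[OF linear_on_of_linear_ops[OF \<phi>]]
  note K = normed_nspace_scalar_space[where 'k = 'k and 'a = 'a]
  show "multilinear_on n E F (elementary_op n E F \<phi> b)"
  proof (rule multilinear_onI)
    show "elementary_op n E F \<phi> b x \<in> carrier F" if "x \<in> prod_carrier n E" for x
      using that b by (simp add: elementary_op_def)
    show "elementary_op n E F \<phi> b x = undefined" if "x \<notin> prod_carrier n E" for x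
      using that by (simp add: elementary_op_def)
  next
    \<comment> \<open>Only the i-th factor depends on the updated coordinate, which makes the
      product linear in it.\<close>
    have split: "(\<Prod>l=1..n. projr (\<phi> l ((x(i := a)) l))) =
        projr (\<phi> i a) * (\<Prod>l\<in>{1..n} - {i}. projr (\<phi> l (x l)))" if "i \<in> {1..n}" for x i a
      using that by (subst prod.remove[of _ i]) auto
    fix x i a b' c
    assume *: "x \<in> prod_carrier n E" "i \<in> {1..n}" "a \<in> carrier (E i)" "x(i := a) \<in> prod_carrier n E"
    show "elementary_op n E F \<phi> b (x(i := c \<odot>\<^bsub>E i\<^esub> a)) = c \<odot>\<^bsub>F\<^esub> elementary_op n E F \<phi> b (x(i := a))"
      if "x(i := c \<odot>\<^bsub>E i\<^esub> a) \<in> prod_carrier n E"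
      unfolding elementary_op_def restrict_apply'[OF that] restrict_apply'[OF *(4)] split[OF *(2)]
      using * b by (simp add: lin F.scale_scale mult.assoc)
    show "elementary_op n E F \<phi> b (x(i := a \<oplus>\<^bsub>E i\<^esub> b')) =
        elementary_op n E F \<phi> b (x(i := a)) \<oplus>\<^bsub>F\<^esub> elementary_op n E F \<phi> b (x(i := b'))"
      if "b' \<in> carrier (E i)" "x(i := b') \<in> prod_carrier n E" "x(i := a \<oplus>\<^bsub>E i\<^esub> b') \<in> prod_carrier n E"
      unfolding elementary_op_def restrict_apply'[OF that(3)] restrict_apply'[OF *(4)]
        restrict_apply'[OF that(2)] split[OF *(2)]
      using * that b by (simp add: lin F.scale_l_distr distrib_right)
  qed
  have op: "0 \<le> op_norm (E i) scalar_space (\<phi> i)" if "i \<in> {1..n}" for i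
    using linear_ops_bounded(1)[OF E[OF that] K \<phi>[OF that]] .
  show "0 \<le> vnorm F b * (\<Prod>i=1..n. op_norm (E i) scalar_space (\<phi> i))"
    using op b by (intro mult_nonneg_nonneg prod_nonneg) auto
  show "bound (elementary_op n E F \<phi> b) (vnorm F b * (\<Prod>i=1..n. op_norm (E i) scalar_space (\<phi> i)))"
  proof (rule boundI)
    fix k :: nat and x assume x: "adm k x"
    \<comment> \<open>The functionals turn the vector sequences into scalar ones.
      \<open>scalar_Holder\<close> bounds those, and \<open>\<Psi>_linear\<close> with the operator
      norm of each \<phi> i leads back to the original sequences.\<close>
    define z where "z i j = \<phi> i (x i j)" for i j
    have z: "z i \<in> {1..k} \<rightarrow> range Inr" if "i \<in> {1..n}" for i
      using lin(1)[OF that] funcset_mem[OF admD[OF x that]] by (simp add: z_def Pi_def)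
    have "\<Phi> F k (\<lambda>j. elementary_op n E F \<phi> b (arg x j)) = \<Phi> F k (\<lambda>j. (\<Prod>i=1..n. projr (z i j)) \<odot>\<^bsub>F\<^esub> b)"
      using arg_mem[OF x] b
      by (intro \<Phi>_cong) (auto simp: F.normed_nspace_axioms elementary_op_def z_def intro!: arg_cong2[where f = "smult F"] prod.cong)
    also have "\<dots> \<le> vnorm F b * (\<Prod>i=1..n. \<Psi> i scalar_space k (z i))"
      using F.normed_nspace_axioms b z by (rule scalar_Holder)
    also have "\<dots> \<le> vnorm F b * (\<Prod>i=1..n. op_norm (E i) scalar_space (\<phi> i) * \<Psi> i (E i) k (x i))"
    proof (intro mult_left_mono prod_mono conjI)
      fix i assume i: "i \<in> {1..n}"
      show "0 \<le> \<Psi> i scalar_space k (z i)"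
        using z[OF i] by (intro \<Psi>_nonneg i K) simp
      show "\<Psi> i scalar_space k (z i) \<le> op_norm (E i) scalar_space (\<phi> i) * \<Psi> i (E i) k (x i)"
        unfolding z_def
        using i E[OF i] K linear_on_of_linear_ops[OF \<phi>[OF i]] op[OF i]
          linear_ops_bounded(2)[OF E[OF i] K \<phi>[OF i]] admD[OF x i] by (rule \<Psi>_linear)
    qed (use b in simp)
    finally show "\<Phi> F k (\<lambda>j. elementary_op n E F \<phi> b (arg x j)) \<le>
        vnorm F b * (\<Prod>i=1..n. op_norm (E i) scalar_space (\<phi> i)) * prodn k x"
      by (simp add: prod.distrib mult.assoc)
  qed
qed

lemma finite_type_ops_subset: "finite_type_ops n E F \<subseteq> bops"
proof
  fix T assume "T \<in> finite_type_ops n E F"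
  then obtain m c \<phi> b where T: "T = finsum L (\<lambda>j. c j \<odot>\<^bsub>L\<^esub> elementary_op n E F (\<phi> j) (b j)) {1..m::nat}"
    and \<phi>: "\<And>j i. j \<in> {1..m} \<Longrightarrow> i \<in> {1..n} \<Longrightarrow> \<phi> j i \<in> linear_ops (E i) scalar_space"
    and b: "\<And>j. j \<in> {1..m} \<Longrightarrow> b j \<in> carrier F"
    unfolding finite_type_ops_def by blast
  have el: "elementary_op n E F (\<phi> j) (b j) \<in> bops" if "j \<in> {1..m}" for j
    using \<phi> b that by (intro elementary_op_bops) auto
  have sum: "finsum L f J \<in> bops" if "finite J" "\<And>j. j \<in> J \<Longrightarrow> f j \<in> bops" for f and J :: "nat set"
    using that
  proof (induction J rule: finite_induct)
    case empty
    show ?case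
      unfolding L.M.finsum_empty multilinear_space_simps by (rule bops_zero)
  next
    case (insert j J)
    then have "f \<in> J \<rightarrow> carrier L" "f j \<in> carrier L"
      using bops_subset by auto
    then have eq: "finsum L f (insert j J) = f j \<oplus>\<^bsub>L\<^esub> finsum L f J"
      using insert by (intro L.M.finsum_insert) auto
    show ?case
      unfolding eq multilinear_space_simps using insert by (intro bops_add) auto
  qed
  show "T \<in> bops"
    unfolding T
  proof (rule sum)
    show "c j \<odot>\<^bsub>L\<^esub> elementary_op n E F (\<phi> j) (b j) \<in> bops" if "j \<in> {1..m}" for j
      unfolding multilinear_space_simps by (rule bops_scale[OF el[OF that]])
  qed simp
qed

end

section \<open>The ideal axioms\<close>

context sequence_norms
begin

lemma tupleI:
  assumes "\<And>i. i \<in> {1..n} \<Longrightarrow> normed_nspace (E i)" "normed_nspace F"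
  shows "sequence_norms_tuple n s \<Phi> \<Psi> F E"
  using assms sequence_norms_axioms
  by (simp add: sequence_norms_tuple_def normed_tuple_def normed_tuple_axioms_def)

lemma component_ops:
  assumes "E \<in> banach_family n" "banach_space F"
  shows "component ops E F = sequence_norms_tuple.bops n \<Phi> \<Psi> F E"
proof -
  have "normed_nspace (E i)" if "i \<in> {1..n}" for i
    using assms(1) that by (auto simp: banach_family_def banach_space_iff)
  moreover have "normed_nspace F"
    using assms(2) by (simp add: banach_space_iff)
  ultimately interpret sequence_norms_tuple n s \<Phi> \<Psi> F E
    by (rule tupleI)
  show ?thesis
    using assms bops_subset
    by (auto simp: component_def ops_def all_mops_def bops_def multilinear_ops_iff)
qed

text \<open>The upper bound is \<open>scalar_Holder\<close> with b = 1. The lower bound tests an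
  admissible constant on the sequences of length one with entry 1.\<close>

lemma nrm_scalar_mult_op: "nrm (scalar_mult_op n) = 1"
proof -
  let ?K = "scalar_space :: ('k, 'a + 'k) nspace"
  define E where "E = (\<lambda>i\<in>{1..n}. ?K)"
  define T where "T = (\<lambda>x\<in>prod_carrier n (\<lambda>i. ?K). Inr (\<Prod>i=1..n. projr (x i)) :: 'a + 'k)"
  have EK: "E i = ?K" if "i \<in> {1..n}" for i
    using that by (simp add: E_def)
  interpret sequence_norms_tuple n s \<Phi> \<Psi> ?K E
    using normed_nspace_scalar_space[where 'k = 'k and 'a = 'a] by (intro tupleI) (auto simp: E_def)
  \<comment> \<open>\<open>scalar_mult_op\<close> describes the domain of its map by a constant
    family and its tuple of spaces by a restricted one. They agree on the indices 1 to n, the only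
    ones that \<open>prod_carrier\<close> looks at.\<close>
  have PE: "prod_carrier n (\<lambda>i. ?K) = prod_carrier n E"
    unfolding prod_carrier_def by (intro PiE_cong) (simp add: EK)
  have A: "scalar_mult_op n = (E, ?K, T)"
    by (simp add: scalar_mult_op_def E_def T_def)
  have b1: "bound T 1"
  proof (rule boundI)
    fix k :: nat and x assume x: "adm k x"
    have "\<Phi> ?K k (\<lambda>j. T (arg x j)) = \<Phi> ?K k (\<lambda>j. (\<Prod>i=1..n. projr (x i j)) \<odot>\<^bsub>?K\<^esub> Inr 1)"
      using arg_mem[OF x] F.normed_nspace_axioms by (intro \<Phi>_cong) (auto simp: T_def PE intro!: prod.cong)
    also have "\<dots> \<le> vnorm ?K (Inr 1) * (\<Prod>i=1..n. \<Psi> i ?K k (x i))"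
      using admD[OF x] by (intro scalar_Holder F.normed_nspace_axioms) (auto simp: EK)
    also have "\<dots> = 1 * prodn k x"
      by (auto simp: EK intro!: prod.cong)
    finally show "\<Phi> ?K k (\<lambda>j. T (arg x j)) \<le> 1 * prodn k x" .
  qed
  have "1 \<le> C" if C: "bound T C" for C
  proof -
    define x :: "nat \<Rightarrow> nat \<Rightarrow> 'a + 'k" where "x = (\<lambda>i j. Inr 1)"
    have x: "adm 1 x"
      by (auto simp: adm_def x_def EK)
    have T1: "T (arg x j) = Inr 1" for j
      using arg_mem[OF x, of 1] by (auto simp: T_def PE x_def)
    have "\<Phi> ?K 1 (\<lambda>j. T (arg x j)) \<le> C * prodn 1 x"
      using boundD[OF C x] .
    also have "prodn 1 x = (\<Prod>i=1..n. 1)"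
    proof (intro prod.cong refl)
      fix i assume i: "i \<in> {1..n}"
      show "\<Psi> i (E i) 1 (x i) = 1"
        using \<Psi>_single[OF i F.normed_nspace_axioms, of "x i"] by (simp add: EK[OF i] x_def)
    qed
    finally show ?thesis
      unfolding T1 using \<Phi>_single[OF F.normed_nspace_axioms, of "\<lambda>j. Inr 1"] by simp
  qed
  then have "1 \<le> nrm (E, ?K, T)"
    using bound_nrm[OF bounds_nonempty[OF _ b1]] by simp
  then show ?thesis
    unfolding A using nrm_le[OF _ b1] by simp
qed

lemma comp_op_ideal:
  assumes E: "E \<in> banach_family n" and G: "G \<in> banach_family n" and F: "banach_space F" and H: "banach_space H"
    and A: "A \<in> component ops E F" and u: "\<And>m. m \<in> {1..n} \<Longrightarrow> u m \<in> linear_ops (G m) (E m)"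
    and t: "t \<in> linear_ops F H"
  shows "comp_op n G t A u \<in> component ops G H"
    and "nrm (G, H, comp_op n G t A u) \<le>
      op_norm F H t * nrm (E, F, A) * (\<Prod>m=1..n. op_norm (G m) (E m) (u m))"
proof -
  have En: "normed_nspace (E i)" and Gn: "normed_nspace (G i)" if "i \<in> {1..n}" for i
    using E G that by (auto simp: banach_family_def banach_space_iff)
  have Fn: "normed_nspace F" and Hn: "normed_nspace H"
    using F H by (simp_all add: banach_space_iff)
  interpret EF: sequence_norms_tuple n s \<Phi> \<Psi> F E
    using En Fn by (rule tupleI)
  interpret GH: sequence_norms_tuple n s \<Phi> \<Psi> H G
    using Gn Hn by (rule tupleI)
  have Ab: "A \<in> EF.bops"
    using A component_ops[OF E F] by simp
  note A' = EF.bopsD[OF Ab] and Am = multilinear_onD[OF EF.bopsD(1)[OF Ab]]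
  note tl = linear_on_of_linear_ops[OF t] and tb = linear_ops_bounded[OF Fn Hn t]
  note t' = linear_onD[OF tl]
  note ul = linear_on_of_linear_ops[OF u]
  note ub = linear_ops_bounded[OF Gn En u]
  note u' = linear_onD[OF ul]
  \<comment> \<open>The inner tuple map respects the update of a single coordinate, see
    \<open>w_upd\<close>; this carries multilinearity from A to the composite.\<close>
  define w where "w x = (\<lambda>i\<in>{1..n}. u i (x i))" for x
  have w: "w x \<in> prod_carrier n E" if "x \<in> prod_carrier n G" for x
    using u'(1) prod_carrier_mem[OF that] by (auto simp: w_def prod_carrier_def)
  have w_upd: "w (x(i := a)) = (w x)(i := u i a)" if "i \<in> {1..n}" for x i a
    using that by (auto simp: w_def)
  have co: "comp_op n G t A u = (\<lambda>x\<in>prod_carrier n G. t (A (w x)))"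
    by (simp add: comp_op_def w_def)
  have lin: "multilinear_on n G H (comp_op n G t A u)"
    by (rule GH.multilinear_onI) (simp_all add: co w w_upd Am u' t' prod_carrier_upd)
  define C where "C = op_norm F H t * nrm (E, F, A) * (\<Prod>m=1..n. op_norm (G m) (E m) (u m))"
  have C: "0 \<le> C"
    unfolding C_def using tb(1) A'(3) ub(1) by (intro mult_nonneg_nonneg prod_nonneg) auto
  have bd: "GH.bound (comp_op n G t A u) C"
  proof (rule GH.boundI)
    fix k :: nat and x assume x: "GH.adm k x"
    define y where "y i j = u i (x i j)" for i j
    have y: "EF.adm k y"
      using u'(1) x by (auto simp: y_def EF.adm_def GH.adm_def)
    have AF: "(\<lambda>j. A (GH.arg y j)) \<in> {1..k} \<rightarrow> carrier F"
      by (rule EF.op_seq_mem[OF A'(1) y])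
    have eq: "w (GH.arg x j) = GH.arg y j" for j
      by (auto simp: w_def y_def)
    have "\<Phi> H k (\<lambda>j. comp_op n G t A u (GH.arg x j)) = \<Phi> H k (\<lambda>j. t (A (GH.arg y j)))"
      using AF t'(1) GH.arg_mem[OF x] eq by (intro \<Phi>_cong Hn) (auto simp: co)
    also have "\<dots> \<le> op_norm F H t * \<Phi> F k (\<lambda>j. A (GH.arg y j))"
      by (rule \<Phi>_linear[OF Fn Hn tl tb AF])
    also have "\<dots> \<le> op_norm F H t * (nrm (E, F, A) * EF.prodn k y)"
      using EF.boundD[OF A'(2) y] tb(1) by (rule mult_left_mono)
    also have "\<dots> \<le> op_norm F H t * (nrm (E, F, A) * (\<Prod>i=1..n. op_norm (G i) (E i) (u i) * \<Psi> i (G i) k (x i)))"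
    proof (intro mult_left_mono prod_mono conjI tb(1) A'(3))
      fix i assume i: "i \<in> {1..n}"
      show "0 \<le> \<Psi> i (E i) k (y i)"
        using EF.admD[OF y i] by (intro \<Psi>_nonneg i En)
      show "\<Psi> i (E i) k (y i) \<le> op_norm (G i) (E i) (u i) * \<Psi> i (G i) k (x i)"
        unfolding y_def
        using i Gn[OF i] En[OF i] ul[OF i] ub[OF i i i] GH.admD[OF x i] by (rule \<Psi>_linear)
    qed
    finally show "\<Phi> H k (\<lambda>j. comp_op n G t A u (GH.arg x j)) \<le> C * GH.prodn k x"
      by (simp add: C_def prod.distrib mult_ac)
  qed
  show "comp_op n G t A u \<in> component ops G H"
    unfolding component_ops[OF G H] using lin C bd by (rule GH.bopsI)
  show "nrm (G, H, comp_op n G t A u) \<le>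
      op_norm F H t * nrm (E, F, A) * (\<Prod>m=1..n. op_norm (G m) (E m) (u m))"
    using GH.nrm_le[OF C bd] by (simp add: C_def)
qed

lemma s_banach_ideal_ops: "s_banach_ideal n s ops nrm"
  unfolding s_banach_ideal_def
proof (intro conjI ballI allI impI)
  show "0 < s" "s \<le> 1" by (fact s)+
  show "ops \<subseteq> all_mops n" by (auto simp: ops_def)
  show "nrm (scalar_mult_op n) = 1" by (rule nrm_scalar_mult_op)
next
  fix E :: "nat \<Rightarrow> ('k, 'a + 'k) nspace" and F :: "('k, 'a + 'k) nspace"
  assume Ef: "E \<in> banach_family n" and "F \<in> Collect banach_space"
  then have F: "banach_space F" by simp
  have "normed_nspace (E i)" if "i \<in> {1..n}" for i
    using Ef that by (auto simp: banach_family_def banach_space_iff)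
  then interpret sequence_norms_tuple n s \<Phi> \<Psi> F E
    using F by (intro tupleI) (auto simp: banach_space_iff)
  note c = component_ops[OF Ef F]
  show "submodule (component ops E F) (ring_of_type_algebra :: 'k ring) (multilinear_space n E F)"
    unfolding c by (rule submodule_bops)
  show "complete_snorm s (multilinear_space n E F) (component ops E F) (\<lambda>T. nrm (E, F, T))"
    unfolding c using F by (intro complete_snorm_bops) (simp add: banach_space_iff)
  show "finite_type_ops n E F \<subseteq> component ops E F"
    unfolding c by (rule finite_type_ops_subset)
next
  fix E G :: "nat \<Rightarrow> ('k, 'a + 'k) nspace" and F H :: "('k, 'a + 'k) nspace" and A u t
  assume "E \<in> banach_family n" "G \<in> banach_family n" "F \<in> Collect banach_space"
    "H \<in> Collect banach_space" "A \<in> component ops E F"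
    and ut: "(\<forall>m\<in>{1..n}. u m \<in> linear_ops (G m) (E m)) \<and> t \<in> linear_ops F H"
  then have "banach_space F" "banach_space H" by auto
  note * = comp_op_ideal[OF \<open>E \<in> _\<close> \<open>G \<in> _\<close> this \<open>A \<in> _\<close>, of u t]
  show "comp_op n G t A u \<in> component ops G H"
    using ut by (intro *(1)) auto
  show "nrm (G, H, comp_op n G t A u) \<le>
      op_norm F H t * nrm (E, F, A) * (\<Prod>m=1..n. op_norm (G m) (E m) (u m))"
    using ut by (intro *(2)) auto
qed

end

section \<open>Rademacher averages\<close>

lemma set_integrable_sum:
  fixes f :: "'i \<Rightarrow> 'b \<Rightarrow> real"
  assumes "\<And>i. i \<in> I \<Longrightarrow> set_integrable M A (f i)"
  shows "set_integrable M A (\<lambda>x. \<Sum>i\<in>I. f i x)"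
  unfolding set_integrable_def scaleR_sum_right
  by (intro Bochner_Integration.integrable_sum) (use assms in \<open>simp add: set_integrable_def\<close>)

lemma set_integral_sum:
  fixes f :: "'i \<Rightarrow> 'b \<Rightarrow> real"
  assumes "\<And>i. i \<in> I \<Longrightarrow> set_integrable M A (f i)"
  shows "(LINT x:A|M. (\<Sum>i\<in>I. f i x)) = (\<Sum>i\<in>I. LINT x:A|M. f i x)"
  unfolding set_lebesgue_integral_def scaleR_sum_right
  by (intro Bochner_Integration.integral_sum) (use assms in \<open>simp add: set_integrable_def\<close>)

lemma rademacher_measurable [measurable]: "rademacher j \<in> borel_measurable borel"
  unfolding rademacher_def[abs_def] by measurable

text \<open>The first k Rademacher functions together take finitely many values, so any function of
  them is simple and bounded. With g built from the norm of V, this makes the integrand of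
  \<open>rad_norm\<close> integrable although V carries no \<sigma>-algebra.\<close>

lemma integrable_rademacher_fun:
  fixes g :: "(nat \<Rightarrow> real) \<Rightarrow> real"
  shows "set_integrable lborel {a..b} (\<lambda>t. g (\<lambda>j\<in>{1..k}. rademacher j t))"
proof -
  define f where "f t = (\<lambda>j\<in>{1..k}. rademacher j t)" for t
  \<comment> \<open>The value 0 occurs where the sine vanishes, as \<open>sgn 0 = 0\<close>.\<close>
  have "range f \<subseteq> (\<Pi>\<^sub>E j\<in>{1..k}. {-1, 0, 1})"
    by (auto simp: f_def rademacher_def sgn_if split: if_splits)
  then have fin: "finite (range f)"
    by (rule finite_subset) (intro finite_PiE, auto)
  have "simple_function lborel f"
    unfolding simple_function_def
  proof (intro conjI ballI)
    show "finite (f ` space lborel)" using fin by simp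
    fix c assume "c \<in> f ` space lborel"
    then have "c \<in> extensional {1..k}" by (auto simp: f_def)
    then have "f -` {c} \<inter> space lborel = {t \<in> space lborel. \<forall>j\<in>{1..k}. rademacher j t = c j}"
      by (auto simp: f_def fun_eq_iff extensional_def)
    also have "\<dots> \<in> sets lborel" by measurable
    finally show "f -` {c} \<inter> space lborel \<in> sets lborel" .
  qed
  then have "simple_function lborel (\<lambda>t. g (f t))"
    by (rule simple_function_compose1)
  then have m: "(\<lambda>t. g (f t)) \<in> borel_measurable lborel"
    by (rule borel_measurable_simple_function)
  \<comment> \<open>The sum over the finite range is a bound that does not depend on t.\<close>
  have "norm (g (f t)) \<le> (\<Sum>c\<in>range f. norm (g c))" for t
    using fin by (intro member_le_sum) auto
  then show ?thesis
    unfolding set_integrable_def f_def[symmetric]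
    by (intro integrableI_bounded_set_indicator[OF _ m]) (auto simp: emeasure_lborel_Icc_eq intro!: AE_I2)
qed

text \<open>The translation adds 2^(j-i) pi to the argument of the sine: an even multiple of pi when
  i < j, and pi itself for the function with index i.\<close>

lemma rademacher_shift:
  assumes "i < j"
  shows "rademacher j (t + 1 / 2 ^ i) = rademacher j t"
    and "rademacher i (t + 1 / 2 ^ i) = - rademacher i t"
proof -
  have "(2::real) ^ j = 2 ^ i * (2 * 2 ^ (j - i - 1))"
    using assms by (simp flip: power_add power_Suc)
  then have "2 ^ j * pi * (t + 1 / 2 ^ i) = 2 ^ j * pi * t + 2 * real (2 ^ (j - i - 1)) * pi"
    by (simp add: algebra_simps)
  then have "sin (2 ^ j * pi * (t + 1 / 2 ^ i)) = sin (2 ^ j * pi * t)"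
    by (metis sin_2npi add.commute sin_add cos_2npi mult.commute mult_1 mult_zero_left add_0)
  then show "rademacher j (t + 1 / 2 ^ i) = rademacher j t"
    by (simp add: rademacher_def)
  have "2 ^ i * pi * (t + 1 / 2 ^ i) = 2 ^ i * pi * t + pi"
    by (simp add: algebra_simps)
  then show "rademacher i (t + 1 / 2 ^ i) = - rademacher i t"
    by (simp add: rademacher_def sgn_minus)
qed

lemma rademacher_periodic: "1 \<le> j \<Longrightarrow> rademacher j (t + 1) = rademacher j t"
  using rademacher_shift(1)[of 0 j t] by simp

lemma rademacher_1: "rademacher j 1 = 0"
  using sin_npi[of "2 ^ j"] by (simp add: rademacher_def)

text \<open>Translation by $2^{-i}$ changes the sign of $r_i$ and leaves $r_j$ unchanged, and $r_i r_j$ has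
  period 1.\<close>

lemma integral_rademacher_mult:
  assumes "1 \<le> i" "i < j"
  shows "(LINT t:{0..1}|lborel. rademacher i t * rademacher j t) = 0"
proof -
  define f where "f t = rademacher i t * rademacher j t" for t
  define h where "h = (1 / 2 ^ i :: real)"
  have h: "0 < h" "h \<le> 1" by (auto simp: h_def)
  have fh: "f (t + h) = - f t" for t
    using rademacher_shift[OF assms(2), of t] by (simp add: f_def h_def)
  have f1: "f (t + 1) = f t" for t
    using assms by (simp add: f_def rademacher_periodic)
  \<comment> \<open>With half-open intervals adjacent pieces are disjoint, so indicators add up
    exactly, and translates are of the same kind.\<close>
  define I where "I a b = (\<integral>t. indicator {a..<b} t * f t \<partial>lborel)" for a b
  have icc: "set_integrable lborel {a..b} f" for a b
    using integrable_rademacher_fun[of a b "\<lambda>c. c i * c j" j] assms by (simp add: f_def[abs_def])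
  have "set_integrable lborel {a..<b} f" for a b
    by (rule set_integrable_subset[OF icc[of a b]]) auto
  then have int: "integrable lborel (\<lambda>t. indicator {a..<b} t * f t)" for a b
    by (simp add: set_integrable_def)
  have shift: "I a b = (\<integral>t. indicator {a - c..<b - c} t * f (t + c) \<partial>lborel)" for a b c
    unfolding I_def
    by (subst lborel_integral_real_affine[where c = 1 and t = c])
      (auto simp: indicator_def add.commute algebra_simps intro!: Bochner_Integration.integral_cong)
  \<comment> \<open>Both sides are the integral from 0 to 1 + h, cut at h on the left and at 1 on
    the right. With period 1 this yields I h (1 + h) = I 0 1, and the sign change under translation
    by h yields the opposite value.\<close>
  have "I h (1 + h) + I 0 h = I 0 1 + I 1 (1 + h)"
    unfolding I_def using h
    by (subst (1 2) Bochner_Integration.integral_add[OF int int, symmetric])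
      (intro Bochner_Integration.integral_cong, auto simp: indicator_def)
  moreover have "I 1 (1 + h) = I 0 h"
    using shift[of 1 "1 + h" 1] by (simp add: f1 I_def)
  moreover have "I h (1 + h) = - I 0 1"
    using shift[of h "1 + h" h] by (simp add: fh I_def)
  ultimately have "I 0 1 = 0" by simp
  \<comment> \<open>The closed and the half-open integrand agree also at the endpoint 1, where f is
    0 by \<open>rademacher_1\<close>.\<close>
  moreover have "(LINT t:{0..1}|lborel. f t) = I 0 1"
    unfolding set_lebesgue_integral_def I_def
    by (intro Bochner_Integration.integral_cong refl)
      (auto simp: indicator_def f_def rademacher_1 le_less)
  ultimately show ?thesis
    by (simp add: f_def)
qed

lemma integral_rademacher_square: "(LINT t:{0..1}|lborel. (rademacher j t)\<^sup>2) = 1"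
proof -
  \<comment> \<open>A countable set containing all zeros of the sine in question. The half-integers
    come from \<open>sin_zero_iff_int\<close>, which writes the zeros as even multiples of pi /
    2.\<close>
  let ?Z = "range (\<lambda>i::int. of_int i / 2 / 2 ^ j :: real)"
  have "rademacher j t ^ 2 = 1" if "t \<notin> ?Z" for t
  proof -
    have "sin (2 ^ j * pi * t) \<noteq> 0"
    proof
      assume "sin (2 ^ j * pi * t) = 0"
      then obtain i :: int where "2 ^ j * pi * t = of_int i * (pi / 2)"
        using sin_zero_iff_int by blast
      then have "t = of_int i / 2 / 2 ^ j"
        by (simp add: field_simps)
      then show False using that by blast
    qed
    then show ?thesis by (simp add: rademacher_def sgn_if)
  qed
  moreover have "AE t in lborel. t \<notin> ?Z"
    by (intro AE_not_in countable_imp_null_set_lborel) auto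
  ultimately have "AE t in lborel. rademacher j t ^ 2 = 1"
    by (auto elim!: eventually_mono)
  then have "(LINT t:{0..1}|lborel. (rademacher j t)\<^sup>2) = (LINT t:{0..1::real}|lborel. 1)"
    unfolding set_lebesgue_integral_def
    by (intro integral_cong_AE) (auto elim!: eventually_mono)
  then show ?thesis
    by (simp add: set_lebesgue_integral_def)
qed

lemma abs_rademacher_le: "\<bar>rademacher j t\<bar> \<le> 1"
  by (simp add: rademacher_def sgn_if)

section \<open>The Rademacher average on finite sequences\<close>

context normed_nspace
begin

definition rad_sum :: "nat \<Rightarrow> (nat \<Rightarrow> 'v) \<Rightarrow> real \<Rightarrow> 'v" where
  "rad_sum k x t = (\<Oplus>j\<in>{1..k}. (of_real (rademacher j t) :: 'k) \<odot> x j)"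

lemma rad_sum_closed: "x \<in> {1..k} \<rightarrow> carrier V \<Longrightarrow> rad_sum k x t \<in> carrier V"
  unfolding rad_sum_def by (intro M.finsum_closed) auto

lemma rad_norm_eq: "rad_norm V k x = sqrt (LINT t:{0..1}|lborel. (vnorm V (rad_sum k x t))\<^sup>2)"
  by (simp add: rad_norm_def rad_sum_def)

lemma integrable_rad_sum:
  assumes "x \<in> {1..k} \<rightarrow> carrier V"
  shows "set_integrable lborel {0..1} (\<lambda>t. (vnorm V (rad_sum k x t))\<^sup>2)"
proof -
  have "rad_sum k x t = (\<Oplus>j\<in>{1..k}. (of_real ((\<lambda>j\<in>{1..k}. rademacher j t) j) :: 'k) \<odot> x j)" for t
    unfolding rad_sum_def using assms by (intro M.finsum_cong') auto
  then show ?thesis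
    using integrable_rademacher_fun[of 0 1 "\<lambda>c. (vnorm V (\<Oplus>j\<in>{1..k}. (of_real (c j) :: 'k) \<odot> x j))\<^sup>2" k]
    by simp
qed

lemma rad_norm_nonneg: "0 \<le> rad_norm V k x"
  unfolding rad_norm_eq set_lebesgue_integral_def
  by (intro real_sqrt_ge_zero Bochner_Integration.integral_nonneg) auto

lemma rad_norm_square:
  "(rad_norm V k x)\<^sup>2 = (LINT t:{0..1}|lborel. (vnorm V (rad_sum k x t))\<^sup>2)"
  unfolding rad_norm_eq set_lebesgue_integral_def
  by (intro real_sqrt_pow2 Bochner_Integration.integral_nonneg) auto

lemma rad_norm_cong:
  assumes "y \<in> {1..k} \<rightarrow> carrier V" "\<And>j. j \<in> {1..k} \<Longrightarrow> x j = y j"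
  shows "rad_norm V k x = rad_norm V k y"
proof -
  have "rad_sum k x t = rad_sum k y t" for t
    unfolding rad_sum_def using assms by (intro M.finsum_cong') auto
  then show ?thesis by (simp add: rad_norm_eq)
qed

lemma rad_norm_le:
  assumes x: "x \<in> {1..k} \<rightarrow> carrier V" and "0 \<le> B" and le: "\<And>t. vnorm V (rad_sum k x t) \<le> B"
  shows "rad_norm V k x \<le> B"
proof (rule power2_le_imp_le)
  have "(LINT t:{0..1}|lborel. (vnorm V (rad_sum k x t))\<^sup>2) \<le> (LINT t:{0..1::real}|lborel. B\<^sup>2)"
    using le rad_sum_closed[OF x]
    by (intro set_integral_mono integrable_rad_sum x) (auto intro!: power_mono simp: set_integrable_def)
  then show "(rad_norm V k x)\<^sup>2 \<le> B\<^sup>2"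
    by (simp add: rad_norm_square set_lebesgue_integral_def)
qed fact

lemma rad_norm_le_sum:
  assumes x: "x \<in> {1..k} \<rightarrow> carrier V"
  shows "rad_norm V k x \<le> (\<Sum>j=1..k. vnorm V (x j))"
proof (rule rad_norm_le[OF x])
  have xj: "x j \<in> carrier V" if "j \<in> {1..k}" for j using x that by auto
  then show "0 \<le> (\<Sum>j=1..k. vnorm V (x j))"
    by (intro sum_nonneg) simp
  fix t
  have "vnorm V (rad_sum k x t) \<le> (\<Sum>j=1..k. vnorm V ((of_real (rademacher j t) :: 'k) \<odot> x j))"
    unfolding rad_sum_def using x by (intro norm_finsum) auto
  also have "\<dots> \<le> (\<Sum>j=1..k. vnorm V (x j))"
    using xj abs_rademacher_le by (intro sum_mono) (simp add: snorm_scale mult_left_le_one_le)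
  finally show "vnorm V (rad_sum k x t) \<le> (\<Sum>j=1..k. vnorm V (x j))" .
qed

lemma rad_norm_single:
  assumes "x 1 \<in> carrier V"
  shows "rad_norm V 1 x = vnorm V (x 1)"
proof -
  have "rad_sum 1 x t = (of_real (rademacher 1 t) :: 'k) \<odot> x 1" for t
    unfolding rad_sum_def using assms by (simp add: M.finsum_insert[of "{}" 1, simplified])
  then have "(rad_norm V 1 x)\<^sup>2 = (LINT t:{0..1}|lborel. (rademacher 1 t)\<^sup>2 * (vnorm V (x 1))\<^sup>2)"
    unfolding rad_norm_square using assms by (simp add: snorm_scale power_mult_distrib)
  also have "\<dots> = (vnorm V (x 1))\<^sup>2"
    using integral_rademacher_square[of 1] by (simp add: set_integral_mult_left)
  finally show ?thesis
    using rad_norm_nonneg assms by (simp add: power2_eq_iff_nonneg)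
qed

lemma rad_sum_add:
  assumes "x \<in> {1..k} \<rightarrow> carrier V" "y \<in> {1..k} \<rightarrow> carrier V"
  shows "rad_sum k (\<lambda>j. x j \<oplus> y j) t = rad_sum k x t \<oplus> rad_sum k y t"
proof -
  have "rad_sum k (\<lambda>j. x j \<oplus> y j) t =
      (\<Oplus>j\<in>{1..k}. (of_real (rademacher j t) :: 'k) \<odot> x j \<oplus> (of_real (rademacher j t) :: 'k) \<odot> y j)"
    unfolding rad_sum_def using assms by (intro M.finsum_cong') (auto simp: scale_r_distr Pi_def)
  also have "\<dots> = rad_sum k x t \<oplus> rad_sum k y t"
    unfolding rad_sum_def using assms by (intro M.finsum_addf) auto
  finally show ?thesis .
qed

text \<open>For positive a and b, convexity of the square gives (u + v)^2 \<le> (a + b) (u^2 / a +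
  v^2 / b). With u and v the pointwise norms and a and b at least the two averages, integration
  leaves at most (a + b)^2 on the right.\<close>

lemma rad_norm_add:
  assumes x: "x \<in> {1..k} \<rightarrow> carrier V" and y: "y \<in> {1..k} \<rightarrow> carrier V"
  shows "rad_norm V k (\<lambda>j. x j \<oplus> y j) \<le> rad_norm V k x + rad_norm V k y"
proof (rule field_le_epsilon)
  fix e :: real assume e: "0 < e"
  \<comment> \<open>The summand e / 2 makes both weights of the Titu inequality below positive.\<close>
  define a b where "a = rad_norm V k x + e / 2" and "b = rad_norm V k y + e / 2"
  have ab: "0 < a" "0 < b" "(rad_norm V k x)\<^sup>2 \<le> a\<^sup>2" "(rad_norm V k y)\<^sup>2 \<le> b\<^sup>2"
    using e rad_norm_nonneg[of k x] rad_norm_nonneg[of k y]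
    by (auto simp: a_def b_def add_nonneg_pos intro!: power_mono)
  have xy: "(\<lambda>j. x j \<oplus> y j) \<in> {1..k} \<rightarrow> carrier V" using x y by auto
  have Titu: "(u + v)\<^sup>2 \<le> (a + b) * (u\<^sup>2 / a + v\<^sup>2 / b)" for u v :: real
  proof -
    have "(a + b) * (a * r\<^sup>2 + b * w\<^sup>2) - (a * r + b * w)\<^sup>2 = a * b * (r - w)\<^sup>2" for r w
      by (simp add: power2_eq_square algebra_simps)
    moreover have "0 \<le> a * b * (u / a - v / b)\<^sup>2"
      using ab by simp
    ultimately have "(a * (u / a) + b * (v / b))\<^sup>2 \<le> (a + b) * (a * (u / a)\<^sup>2 + b * (v / b)\<^sup>2)"
      by (metis diff_ge_0_iff_ge)
    then show ?thesis
      using ab by (simp add: power2_eq_square)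
  qed
  have i: "set_integrable lborel {0..1} (\<lambda>t. (vnorm V (rad_sum k x t))\<^sup>2 / a)"
    "set_integrable lborel {0..1} (\<lambda>t. (vnorm V (rad_sum k y t))\<^sup>2 / b)"
    using integrable_rad_sum[OF x] integrable_rad_sum[OF y] by simp_all
  have "(LINT t:{0..1}|lborel. (vnorm V (rad_sum k (\<lambda>j. x j \<oplus> y j) t))\<^sup>2) \<le>
      (LINT t:{0..1}|lborel. (a + b) * ((vnorm V (rad_sum k x t))\<^sup>2 / a + (vnorm V (rad_sum k y t))\<^sup>2 / b))"
  proof (rule set_integral_mono)
    show "set_integrable lborel {0..1} (\<lambda>t. (vnorm V (rad_sum k (\<lambda>j. x j \<oplus> y j) t))\<^sup>2)"
      by (rule integrable_rad_sum[OF xy])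
    show "set_integrable lborel {0..1} (\<lambda>t. (a + b) * ((vnorm V (rad_sum k x t))\<^sup>2 / a + (vnorm V (rad_sum k y t))\<^sup>2 / b))"
      using set_integral_add(1)[OF i] by simp
    fix t :: real
    have "(vnorm V (rad_sum k (\<lambda>j. x j \<oplus> y j) t))\<^sup>2 \<le> (vnorm V (rad_sum k x t) + vnorm V (rad_sum k y t))\<^sup>2"
      unfolding rad_sum_add[OF x y] using rad_sum_closed[OF x] rad_sum_closed[OF y]
      by (intro power_mono norm_triangle) auto
    also note Titu
    finally show "(vnorm V (rad_sum k (\<lambda>j. x j \<oplus> y j) t))\<^sup>2 \<le>
        (a + b) * ((vnorm V (rad_sum k x t))\<^sup>2 / a + (vnorm V (rad_sum k y t))\<^sup>2 / b)" .
  qed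
  also have "\<dots> = (a + b) * ((rad_norm V k x)\<^sup>2 / a + (rad_norm V k y)\<^sup>2 / b)"
    using set_integral_add(2)[OF i] by (simp add: rad_norm_square)
  also have "\<dots> \<le> (a + b) * (a\<^sup>2 / a + b\<^sup>2 / b)"
    using ab by (intro mult_left_mono add_mono divide_right_mono) auto
  also have "\<dots> = (a + b)\<^sup>2"
    using ab by (simp add: power2_eq_square)
  finally have "(rad_norm V k (\<lambda>j. x j \<oplus> y j))\<^sup>2 \<le> (a + b)\<^sup>2"
    by (simp add: rad_norm_square)
  then have "rad_norm V k (\<lambda>j. x j \<oplus> y j) \<le> a + b"
    by (rule power2_le_imp_le) (use ab in simp)
  then show "rad_norm V k (\<lambda>j. x j \<oplus> y j) \<le> rad_norm V k x + rad_norm V k y + e"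
    by (simp add: a_def b_def)
qed

end

text \<open>A linear map commutes with the Rademacher sum at every point, so the factor B appears
  pointwise and then in the integral.\<close>

lemma rad_norm_linear:
  fixes V :: "('k::real_normed_field, 'v) nspace" and W :: "('k, 'w) nspace"
  assumes V: "normed_nspace V" and W: "normed_nspace W" and t: "linear_on V W u" and B: "0 \<le> B"
    and le: "\<And>y. y \<in> carrier V \<Longrightarrow> vnorm W (u y) \<le> B * vnorm V y" and x: "x \<in> {1..k} \<rightarrow> carrier V"
  shows "rad_norm W k (\<lambda>j. u (x j)) \<le> B * rad_norm V k x"
proof -
  interpret V: normed_nspace V by fact
  interpret W: normed_nspace W by fact
  note u = linear_onD[OF t]
  have ux: "(\<lambda>j. u (x j)) \<in> {1..k} \<rightarrow> carrier W" using x u(1) by auto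
  have eq: "W.rad_sum k (\<lambda>j. u (x j)) r = u (V.rad_sum k x r)" for r
  proof -
    have "u (V.rad_sum k x r) = (\<Oplus>\<^bsub>W\<^esub>j\<in>{1..k}. u ((of_real (rademacher j r) :: 'k) \<odot>\<^bsub>V\<^esub> x j))"
      unfolding V.rad_sum_def using x by (intro linear_on_finsum[OF V W t]) auto
    also have "\<dots> = W.rad_sum k (\<lambda>j. u (x j)) r"
      unfolding W.rad_sum_def using x ux by (intro W.M.finsum_cong') (auto simp: Pi_def u)
    finally show ?thesis by simp
  qed
  have "(LINT r:{0..1}|lborel. (vnorm W (W.rad_sum k (\<lambda>j. u (x j)) r))\<^sup>2) \<le>
      (LINT r:{0..1}|lborel. B\<^sup>2 * (vnorm V (V.rad_sum k x r))\<^sup>2)"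
  proof (rule set_integral_mono)
    show "set_integrable lborel {0..1} (\<lambda>r. (vnorm W (W.rad_sum k (\<lambda>j. u (x j)) r))\<^sup>2)"
      by (rule W.integrable_rad_sum[OF ux])
    show "set_integrable lborel {0..1} (\<lambda>r. B\<^sup>2 * (vnorm V (V.rad_sum k x r))\<^sup>2)"
      using V.integrable_rad_sum[OF x] by simp
    fix r :: real
    show "(vnorm W (W.rad_sum k (\<lambda>j. u (x j)) r))\<^sup>2 \<le> B\<^sup>2 * (vnorm V (V.rad_sum k x r))\<^sup>2"
      unfolding eq power_mult_distrib[symmetric] using le V.rad_sum_closed[OF x] u(1)
      by (intro power_mono) auto
  qed
  then have "(rad_norm W k (\<lambda>j. u (x j)))\<^sup>2 \<le> (B * rad_norm V k x)\<^sup>2"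
    by (simp add: W.rad_norm_square V.rad_norm_square power_mult_distrib)
  then show ?thesis
    by (rule power2_le_imp_le) (use B V.rad_norm_nonneg in simp)
qed

text \<open>Viewing the scalar field as a real inner product space treats real and complex scalars
  at once. The squared norm of the Rademacher sum expands into products r_i r_j times inner
  products, and integration leaves the diagonal.\<close>

lemma rad_norm_scalar_space:
  fixes x :: "nat \<Rightarrow> 'a + 'k::{real_normed_field, real_inner}"
  assumes x: "x \<in> {1..k} \<rightarrow> range Inr"
  shows "rad_norm (scalar_space :: ('k, 'a + 'k) nspace) k x = sqrt (\<Sum>j=1..k. (norm (projr (x j)))\<^sup>2)"
proof -
  let ?K = "scalar_space :: ('k, 'a + 'k) nspace"
  interpret K: normed_nspace ?K by (rule normed_nspace_scalar_space)
  define a where "a j = projr (x j)" for j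
  have sum: "finsum ?K y J = Inr (\<Sum>j\<in>J. projr (y j))" if "finite J" "y \<in> J \<rightarrow> range Inr"
    for y :: "nat \<Rightarrow> 'a + 'k" and J
    using that by (induction J rule: finite_induct) (auto simp: K.M.finsum_insert Pi_def)
  have "projr (K.rad_sum k x t) = (\<Sum>j=1..k. rademacher j t *\<^sub>R a j)" for t
    unfolding K.rad_sum_def by (subst sum) (auto simp: a_def scaleR_conv_of_real)
  then have "(vnorm ?K (K.rad_sum k x t))\<^sup>2 =
      (\<Sum>i=1..k. \<Sum>j=1..k. (rademacher i t * rademacher j t) * inner (a i) (a j))" for t
    by (simp add: power2_norm_eq_inner inner_sum_left inner_sum_right sum_distrib_left mult_ac inner_commute)
  then have "(rad_norm ?K k x)\<^sup>2 = (LINT t:{0..1}|lborel.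
      (\<Sum>i=1..k. \<Sum>j=1..k. (rademacher i t * rademacher j t) * inner (a i) (a j)))"
    by (simp only: K.rad_norm_square)
  also have "\<dots> = (\<Sum>i=1..k. \<Sum>j=1..k. (LINT t:{0..1}|lborel. rademacher i t * rademacher j t) * inner (a i) (a j))"
  proof -
    have int: "set_integrable lborel {0..1} (\<lambda>t. rademacher i t * rademacher j t)" if "i \<in> {1..k}" "j \<in> {1..k}" for i j
      using integrable_rademacher_fun[of 0 1 "\<lambda>c. c i * c j" k] that by simp
    then have int': "set_integrable lborel {0..1} (\<lambda>t. (rademacher i t * rademacher j t) * inner (a i) (a j))"
      if "i \<in> {1..k}" "j \<in> {1..k}" for i j
      using that by (intro set_integrable_mult_left) auto
    have "(LINT t:{0..1}|lborel. (\<Sum>i=1..k. \<Sum>j=1..k. (rademacher i t * rademacher j t) * inner (a i) (a j))) =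
        (\<Sum>i=1..k. LINT t:{0..1}|lborel. (\<Sum>j=1..k. (rademacher i t * rademacher j t) * inner (a i) (a j)))"
      by (intro set_integral_sum set_integrable_sum int')
    also have "\<dots> = (\<Sum>i=1..k. \<Sum>j=1..k. LINT t:{0..1}|lborel. (rademacher i t * rademacher j t) * inner (a i) (a j))"
      by (intro sum.cong refl set_integral_sum int')
    finally show ?thesis
      by simp
  qed
  also have "\<dots> = (\<Sum>i=1..k. \<Sum>j=1..k. if i = j then (norm (a i))\<^sup>2 else 0)"
  proof (intro sum.cong refl)
    fix i j assume ij: "i \<in> {1..k}" "j \<in> {1..k}"
    have "(LINT t:{0..1}|lborel. rademacher i t * rademacher j t) = (if i = j then 1 else 0)"
      using ij integral_rademacher_mult[of i j] integral_rademacher_mult[of j i] integral_rademacher_square[of i]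
      by (cases i j rule: linorder_cases) (auto simp: power2_eq_square mult.commute)
    then show "(LINT t:{0..1}|lborel. rademacher i t * rademacher j t) * inner (a i) (a j) =
        (if i = j then (norm (a i))\<^sup>2 else 0)"
      by (simp add: power2_norm_eq_inner)
  qed
  also have "\<dots> = (\<Sum>j=1..k. (norm (a j))\<^sup>2)"
    by simp
  finally show ?thesis
    unfolding a_def by (metis K.rad_norm_nonneg real_sqrt_unique)
qed

section \<open>Type and cotype\<close>

context normed_nspace
begin

lemma lp_norm_nonneg: "0 \<le> lp_norm V k q x"
  by (simp add: lp_norm_def)

lemma lp_norm_single:
  assumes "0 < q" "x 1 \<in> carrier V"
  shows "lp_norm V 1 q x = vnorm V (x 1)"
  using assms by (simp add: lp_norm_def powr_powr)

lemma lp_norm_powr: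
  assumes "0 < q"
  shows "lp_norm V k q x powr q = (\<Sum>j=1..k. vnorm V (x j) powr q)"
  using assms by (simp add: lp_norm_def powr_powr sum_nonneg)

text \<open>The exponent \<open>min 1 q\<close> covers two regimes: for q \<le> 1 the q-th powers
  are subadditive term by term, for q > 1 the claim is Minkowski's inequality.\<close>

lemma lp_norm_add:
  assumes q: "0 < q" and x: "x \<in> {1..k} \<rightarrow> carrier V" and y: "y \<in> {1..k} \<rightarrow> carrier V"
  shows "lp_norm V k q (\<lambda>j. x j \<oplus> y j) powr (min 1 q) \<le>
    lp_norm V k q x powr (min 1 q) + lp_norm V k q y powr (min 1 q)"
proof -
  have xy: "x j \<in> carrier V" "y j \<in> carrier V" if "j \<in> {1..k}" for j
    using x y that by auto
  have tri: "vnorm V (x j \<oplus> y j) powr q \<le> (vnorm V (x j) + vnorm V (y j)) powr q"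
    if "j \<in> {1..k}" for j
    using xy[OF that] q by (intro powr_mono2 norm_triangle) auto
  show ?thesis
  proof (cases "q \<le> 1")
    case True
    have "(\<Sum>j=1..k. vnorm V (x j \<oplus> y j) powr q) \<le>
        (\<Sum>j=1..k. vnorm V (x j) powr q + vnorm V (y j) powr q)"
    proof (rule sum_mono)
      fix j assume j: "j \<in> {1..k}"
      show "vnorm V (x j \<oplus> y j) powr q \<le> vnorm V (x j) powr q + vnorm V (y j) powr q"
        using tri[OF j] powr_add_le[of "vnorm V (x j)" "vnorm V (y j)" q] xy[OF j] q True by simp
    qed
    then show ?thesis
      using True q by (simp add: lp_norm_powr min_def sum.distrib)
  next
    case False
    have "lp_norm V k q (\<lambda>j. x j \<oplus> y j) \<le> (\<Sum>j=1..k. (vnorm V (x j) + vnorm V (y j)) powr q) powr (1 / q)"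
      unfolding lp_norm_def using tri q
      by (intro powr_mono2[of "1 / q"] sum_mono) (auto intro: sum_nonneg)
    also have "\<dots> \<le> lp_norm V k q x + lp_norm V k q y"
      unfolding lp_norm_def using xy False by (intro lp_Minkowski) auto
    finally show ?thesis
      using False lp_norm_nonneg by (simp add: min_def)
  qed
qed

text \<open>For q \<le> 1 both sides are the same sum; for q > 1 the l_q norm is compared with the
  l_1 norm.\<close>

lemma lp_norm_le_sum:
  assumes q: "0 < q" and x: "x \<in> {1..k} \<rightarrow> carrier V"
  shows "lp_norm V k q x powr (min 1 q) \<le> (\<Sum>j=1..k. vnorm V (x j) powr (min 1 q))"
proof (cases "q \<le> 1")
  case True
  then show ?thesis
    using q by (simp add: lp_norm_powr min_def)
next
  case False
  have xj: "0 \<le> vnorm V (x j)" if "j \<in> {1..k}" for j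
    using x that by (intro snorm_nonneg) auto
  have "lp_norm V k q x \<le> ((\<Sum>j=1..k. vnorm V (x j)) powr q) powr (1 / q)"
    unfolding lp_norm_def using xj False
    by (intro powr_mono2[of "1 / q"] sum_powr_le_powr_sum) (auto intro: sum_nonneg)
  also have "\<dots> = (\<Sum>j=1..k. vnorm V (x j))"
    using sum_nonneg[of "{1..k}", OF xj] q by (simp add: powr_powr)
  finally show ?thesis
    using False xj lp_norm_nonneg by (simp add: min_def)
qed

end

lemma lp_norm_linear:
  assumes V: "normed_nspace V" and W: "normed_nspace W" and u: "linear_on V W u" and B: "0 \<le> B"
    and le: "\<And>y. y \<in> carrier V \<Longrightarrow> vnorm W (u y) \<le> B * vnorm V y" and x: "x \<in> {1..k} \<rightarrow> carrier V"
    and q: "0 < q"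
  shows "lp_norm W k q (\<lambda>j. u (x j)) \<le> B * lp_norm V k q x"
proof -
  interpret V: normed_nspace V by fact
  interpret W: normed_nspace W by fact
  have xj: "x j \<in> carrier V" if "j \<in> {1..k}" for j using x that by auto
  have "(\<Sum>j=1..k. vnorm W (u (x j)) powr q) \<le> (\<Sum>j=1..k. (B * vnorm V (x j)) powr q)"
    using xj le q linear_onD(1)[OF u] by (intro sum_mono powr_mono2) auto
  also have "\<dots> = B powr q * (\<Sum>j=1..k. vnorm V (x j) powr q)"
    using xj B by (simp add: sum_distrib_left powr_mult)
  finally have "lp_norm W k q (\<lambda>j. u (x j)) \<le> (B powr q * (\<Sum>j=1..k. vnorm V (x j) powr q)) powr (1 / q)"
    unfolding lp_norm_def using q by (intro powr_mono2[of "1 / q"]) (auto intro: sum_nonneg)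
  also have "\<dots> = B * lp_norm V k q x"
    using q B by (simp add: lp_norm_def powr_mult powr_powr sum_nonneg)
  finally show ?thesis .
qed

lemma linear_on_scale_vector:
  fixes V :: "('k::real_normed_field, 'a + 'k) nspace"
  assumes "normed_nspace V" "b \<in> carrier V"
  shows "linear_on (scalar_space :: ('k, 'a + 'k) nspace) V (\<lambda>c. projr c \<odot>\<^bsub>V\<^esub> b)"
proof -
  interpret V: normed_nspace V by fact
  show ?thesis
    using assms(2) by (auto simp: linear_on_def V.scale_l_distr V.scale_scale)
qed

text \<open>The sequence is the image of a scalar sequence under the linear map c \<mapsto> c b,
  which is bounded by the norm of b, and for scalars the average is the l_2 norm.\<close>

lemma rad_norm_scale_vector:
  fixes V :: "('k::{real_normed_field, real_inner}, 'a + 'k) nspace"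
  assumes V: "normed_nspace V" and b: "b \<in> carrier V"
  shows "rad_norm V k (\<lambda>j. c j \<odot>\<^bsub>V\<^esub> b) \<le> vnorm V b * sqrt (\<Sum>j=1..k. (norm (c j))\<^sup>2)"
proof -
  interpret V: normed_nspace V by fact
  have "rad_norm V k (\<lambda>j. projr (Inr (c j) :: 'a + 'k) \<odot>\<^bsub>V\<^esub> b) \<le>
      vnorm V b * rad_norm (scalar_space :: ('k, 'a + 'k) nspace) k (\<lambda>j. Inr (c j))"
    using b by (intro rad_norm_linear[OF normed_nspace_scalar_space V linear_on_scale_vector[OF V b]])
      (auto simp: V.snorm_scale mult.commute)
  then show ?thesis
    by (simp add: rad_norm_scalar_space)
qed

lemma sqrt_sum_squares_eq_powr:
  assumes "\<And>j. j \<in> J \<Longrightarrow> 0 \<le> a j"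
  shows "sqrt (\<Sum>j\<in>J. (a j)\<^sup>2) = (\<Sum>j\<in>J. a j powr 2) powr (1 / 2)"
proof -
  have "(\<Sum>j\<in>J. (a j)\<^sup>2) = (\<Sum>j\<in>J. a j powr 2)"
    using assms by (intro sum.cong) auto
  then show ?thesis
    by (simp add: powr_half_sqrt sum_nonneg)
qed

section \<open>Type and cotype as instances\<close>

lemma sequence_norms_type:
  assumes n: "1 \<le> n" and p: "\<And>i. i \<in> {1..n} \<Longrightarrow> 0 < p i" and le: "1 / 2 \<le> (\<Sum>i=1..n. 1 / p i)"
  shows "sequence_norms n 1
    (rad_norm :: ('k::{real_normed_field, real_inner}, 'a + 'k) nspace \<Rightarrow> _) (\<lambda>i V k. lp_norm V k (p i))"
\<comment> \<open>The numbered cases are the axioms of \<open>sequence_norms\<close> in their order.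
  The first three, on n and s, are left to the final \<open>auto\<close>.\<close>
proof (unfold_locales, goal_cases)
  case (4 V x k)
  then show ?case by (simp add: normed_nspace.rad_norm_nonneg)
next
  case (5 V y k x)
  then show ?case by (intro normed_nspace.rad_norm_cong)
next
  case (6 V W t B x k)
  then show ?case by (intro rad_norm_linear)
next
  case (7 V x k y)
  then show ?case
    using normed_nspace.rad_norm_add[of V x k y] by (simp add: normed_nspace.rad_norm_nonneg)
next
  case (8 V x)
  then show ?case by (intro normed_nspace.rad_norm_single)
next
  case (9 V x k)
  interpret normed_nspace V by fact
  have "0 \<le> vnorm V (x j)" if "j \<in> {1..k}" for j
    using 9 that by (intro snorm_nonneg) auto
  then show ?case
    using 9 rad_norm_le_sum[of x k] rad_norm_nonneg by simp
next
  case (10 i V x k)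
  then show ?case by (simp add: normed_nspace.lp_norm_nonneg)
next
  case (11 i V W t B x k)
  then show ?case using p by (intro lp_norm_linear)
next
  case (12 i V x)
  then show ?case using p by (intro normed_nspace.lp_norm_single)
next
  case (13 V b z k)
  interpret normed_nspace V by fact
  have "rad_norm V k (\<lambda>j. (\<Prod>i=1..n. projr (z i j)) \<odot>\<^bsub>V\<^esub> b) \<le>
      vnorm V b * sqrt (\<Sum>j=1..k. (norm (\<Prod>i=1..n. projr (z i j)))\<^sup>2)"
    using 13 by (intro rad_norm_scale_vector)
  also have "sqrt (\<Sum>j=1..k. (norm (\<Prod>i=1..n. projr (z i j)))\<^sup>2) =
      (\<Sum>j=1..k. (\<Prod>i=1..n. norm (projr (z i j))) powr 2) powr (1 / 2)"
    unfolding prod_norm[symmetric] by (intro sqrt_sum_squares_eq_powr) (simp add: prod_nonneg)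
  also have "\<dots> \<le> (\<Prod>i=1..n. (\<Sum>j=1..k. norm (projr (z i j)) powr p i) powr (1 / p i))"
    using p le by (intro lp_Holder) auto
  also have "\<dots> = (\<Prod>i=1..n. lp_norm (scalar_space :: ('k, 'a + 'k) nspace) k (p i) (z i))"
    by (simp add: lp_norm_def)
  finally show ?case
    using 13 by (simp add: mult_left_mono)
qed (use n in auto)

lemma sequence_norms_cotype:
  assumes n: "1 \<le> n" and q: "2 / real n \<le> q"
  shows "sequence_norms n (min 1 q) (\<lambda>V k. lp_norm V k q)
    (\<lambda>i. rad_norm :: ('k::{real_normed_field, real_inner}, 'a + 'k) nspace \<Rightarrow> _)"
proof -
  have "0 < 2 / real n" using n by simp
  then have q0: "0 < q" using q by linarith
  \<comment> \<open>The sum is n / 2, so this is 2 / n \<le> q in the form required by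
    \<open>lp_Holder\<close> with r = q and all exponents equal to 2.\<close>
  have q2: "1 / q \<le> (\<Sum>i=1..n. 1 / 2)"
    using q q0 n by (simp add: field_simps)
  show ?thesis
  proof (unfold_locales, goal_cases)
    case (4 V x k)
    then show ?case by (simp add: normed_nspace.lp_norm_nonneg)
  next
    case (5 V y k x)
    then show ?case by (simp add: lp_norm_def)
  next
    case (6 V W t B x k)
    then show ?case using q0 by (intro lp_norm_linear)
  next
    case (7 V x k y)
    then show ?case using q0 by (intro normed_nspace.lp_norm_add)
  next
    case (8 V x)
    then show ?case using q0 by (intro normed_nspace.lp_norm_single)
  next
    case (9 V x k)
    then show ?case using q0 by (intro normed_nspace.lp_norm_le_sum)
  next
    case (10 i V x k)
    then show ?case by (simp add: normed_nspace.rad_norm_nonneg)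
  next
    case (11 i V W t B x k)
    then show ?case by (intro rad_norm_linear)
  next
    case (12 i V x)
    then show ?case by (intro normed_nspace.rad_norm_single)
  next
    case (13 V b z k)
    interpret normed_nspace V by fact
    have nb: "0 \<le> vnorm V b" using 13 by simp
    have "lp_norm V k q (\<lambda>j. (\<Prod>i=1..n. projr (z i j)) \<odot>\<^bsub>V\<^esub> b) =
        (\<Sum>j=1..k. vnorm V b powr q * (\<Prod>i=1..n. norm (projr (z i j))) powr q) powr (1 / q)"
      using 13 by (simp add: lp_norm_def snorm_scale powr_mult prod_nonneg mult.commute flip: prod_norm)
    also have "\<dots> = vnorm V b * (\<Sum>j=1..k. (\<Prod>i=1..n. norm (projr (z i j))) powr q) powr (1 / q)"
      using q0 nb by (simp add: powr_mult powr_powr sum_nonneg flip: sum_distrib_left)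
    also have "(\<Sum>j=1..k. (\<Prod>i=1..n. norm (projr (z i j))) powr q) powr (1 / q) \<le>
        (\<Prod>i=1..n. (\<Sum>j=1..k. norm (projr (z i j)) powr 2) powr (1 / 2))"
      using q0 q2 by (intro lp_Holder) auto
    also have "\<dots> = (\<Prod>i=1..n. rad_norm (scalar_space :: ('k, 'a + 'k) nspace) k (z i))"
    proof (intro prod.cong refl)
      fix i assume "i \<in> {1..n}"
      then have "z i \<in> {1..k} \<rightarrow> range Inr" using 13 by auto
      then show "(\<Sum>j=1..k. norm (projr (z i j)) powr 2) powr (1 / 2) =
          rad_norm (scalar_space :: ('k, 'a + 'k) nspace) k (z i)"
        by (simp add: rad_norm_scalar_space sqrt_sum_squares_eq_powr)
    qed
    finally show ?case
      using nb by (simp add: mult_left_mono)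
  qed (use n q0 in auto)
qed

lemma type_banach_ideal:
  assumes "1 \<le> n" "\<And>i. i \<in> {1..n} \<Longrightarrow> 0 < p i" "1 / 2 \<le> (\<Sum>i=1..n. 1 / p i)"
  shows "banach_ideal n (type_ops n p :: ('k::{real_normed_field, real_inner}, 'a + 'k) mop set) (type_norm n p)"
proof -
  interpret sequence_norms n 1 "rad_norm :: ('k, 'a + 'k) nspace \<Rightarrow> _" "\<lambda>i V k. lp_norm V k (p i)"
    using assms by (rule sequence_norms_type)
  have c: "bounds = type_consts n p"
    by (simp add: fun_eq_iff bounds_def type_consts_def op_bound_def)
  have "ops = type_ops n p" "nrm = type_norm n p"
    by (auto simp: ops_def type_ops_def nrm_def type_norm_def c)
  then show ?thesis
    using s_banach_ideal_ops by (simp add: banach_ideal_def)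
qed

lemma cotype_s_banach_ideal:
  assumes "1 \<le> n" "2 / real n \<le> q"
  shows "s_banach_ideal n (min 1 q)
    (cotype_ops n q :: ('k::{real_normed_field, real_inner}, 'a + 'k) mop set) (cotype_norm n q)"
proof -
  interpret sequence_norms n "min 1 q" "\<lambda>V k. lp_norm V k q" "\<lambda>i. rad_norm :: ('k, 'a + 'k) nspace \<Rightarrow> _"
    using assms by (rule sequence_norms_cotype)
  have c: "bounds = cotype_consts n q"
    by (simp add: fun_eq_iff bounds_def cotype_consts_def op_bound_def)
  have "ops = cotype_ops n q" "nrm = cotype_norm n q"
    by (auto simp: ops_def cotype_ops_def nrm_def cotype_norm_def c)
  then show ?thesis
    using s_banach_ideal_ops by simp
qed

theorem theorem2p7:
  fixes n :: nat and p :: "nat \<Rightarrow> real" and q :: real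
  assumes "n \<ge> 2"
    and "\<forall>i\<in>{1..n}. 0 < p i"
    and "1 / 2 \<le> (\<Sum>i=1..n. 1 / p i)" and "(\<Sum>i=1..n. 1 / p i) < 1"
    and "2 / real n \<le> q"
  shows "(banach_ideal n (type_ops n p :: (real, 'a + real) mop set) (type_norm n p) \<and>
          (q \<le> 1 \<longrightarrow> s_banach_ideal n q (cotype_ops n q :: (real, 'a + real) mop set) (cotype_norm n q)) \<and>
          (q > 1 \<longrightarrow> banach_ideal n (cotype_ops n q :: (real, 'a + real) mop set) (cotype_norm n q))) \<and>
         (banach_ideal n (type_ops n p :: (complex, 'a + complex) mop set) (type_norm n p) \<and>
          (q \<le> 1 \<longrightarrow> s_banach_ideal n q (cotype_ops n q :: (complex, 'a + complex) mop set) (cotype_norm n q)) \<and>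
          (q > 1 \<longrightarrow> banach_ideal n (cotype_ops n q :: (complex, 'a + complex) mop set) (cotype_norm n q)))"
proof -
  have n: "1 \<le> n" using assms(1) by simp
  note type = type_banach_ideal[OF n assms(2)[rule_format] assms(3)]
  \<comment> \<open>\<open>min 1 q\<close> is q when q \<le> 1 and 1 when q > 1, so this one fact
    yields both cotype clauses.\<close>
  note cotype = cotype_s_banach_ideal[OF n assms(5)]
  show ?thesis
    using type[where 'k = real and 'a = 'a] type[where 'k = complex and 'a = 'a]
      cotype[where 'k = real and 'a = 'a] cotype[where 'k = complex and 'a = 'a]
    by (auto simp: banach_ideal_def min_def)
qed

end
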